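(* For every schema $\mathcal{S}$ and ER specification $\Sigma=\langle\Gamma_O,\Gamma_V,\Delta\rangle$ over $\mathcal{S}$ there is a normal logic program $\Pi_{Sol}$ (answer set program with default negation, depending on $\Sigma$ but not on the database), using among others a binary predicate $\mathit{EqO}$ and a 4-ary predicate $\mathit{EqV}$, such that for every $\mathcal{S}$-database $D$ (given to the program as ground facts, together with the ground facts of the similarity predicates) and all relations $E,V$: $\langle E,V\rangle\in\mathsf{Sol}(D,\Sigma)$ if and only if there is a stable model $M$ of $(\Pi_{Sol},D)$ with $E=\{(a,b)\mid \mathit{EqO}(a,b)\in M\}$ and $V=\{(\langle t,i\rangle,\langle t',i'\rangle)\mid \mathit{EqV}(t,i,t',i')\in M\}$.
   Context: Constants come from three pairwise disjoint infinite sets: objects $\mathsf{O}$, values $\mathsf{V}$, and tuple identifiers (tids) $\mathsf{TID}$. A schema $\mathcal{S}$ is a finite set of relation symbols $R$, each with an arity $k$ and a type vector in $\{\mathsf{O},\mathsf{V}\}^k$; position $i$ of $R$ is an object (resp. value) position if $\mathbf{type}(R,i)=\mathsf{O}$ (resp. $\mathsf{V}$). An $\mathcal{S}$-database $D$ is a finite set of facts $R(t,c_1,\dots,c_k)$ with $R/k\in\mathcal{S}$, $t\in\mathsf{TID}$, $c_i\in\mathbf{type}(R,i)$, each tid occurring in at most one fact; $t[i]$ is the constant at position $i$ of the fact with tid $t$. $\mathsf{Obj}(D)$ is the set of objects occurring in $D$, $\mathsf{Dom}(D)$ the set of constants occurring in $D$, and $\mathsf{Cells}(D)=\{\langle t,i\rangle\mid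 R(t,c_1,\dots,c_k)\in D,\ \mathbf{type}(R,i)=\mathsf{V}\}$. A conjunctive query (CQ) $q(\vec x)=\exists\vec y.\varphi(\vec x,\vec y)$ has $\varphi$ a conjunction of relational atoms $R(u_0,u_1,\dots,u_k)$ ($u_0$ in the tid position, terms are constants or variables); extended CQs may also contain inequality atoms $z\neq z'$ and atoms $u\approx u'$ of binary similarity predicates with a fixed interpretation over constants. A denial constraint has the form $\exists\vec y.\varphi(\vec y)\to\bot$ with $\varphi$ a Boolean CQ possibly with inequalities, every variable of an inequality occurring in a relational atom. $\mathsf{EqRel}(P,S)$ is the smallest equivalence relation on $S$ containing $P$. Induced database: for an equivalence relation $E$ on $\mathsf{Obj}(D)$ and $V$ on $\mathsf{Cells}(D)$, $D_{E,V}$ is obtained from $D$ by replacing each tid $t$ by $\{t\}$, each occurrence of an object $o$ by $\{o'\mid(o,o')\in E\}$, and the value in each cell $\langle t,i\rangle$ by $\{t'[i']\mid(\langle t,i\rangle,\langle t',i'\rangle)\in V\}$. A Boolean (extended) query $q$ is satisfied in $D_{E,V}$ if there are $h:\mathrm{vars}(q)\cup\mathrm{cons}(q)\to 2^{\mathsf{Dom}(D)}\setminus\{\emptyset\}$ and, for each $k$-ary relational atom $\pi$ of $q$, $g_\pi:\{0,\dots,k\}\to 2^{\mathsf{Dom}(D)}$ such that: (1) $h(a)=\{a\}$ for constants $a$, and for each variable $z$, $h(z)$ is the intersection of all $g_\pi(i)$ with $z$ the $i$-th argument of $\pi$; (2) for each relational atom $\pi=R(u_0,\dots,u_k)$, $R(g_\pi(0),\dots,g_\pi(k))\in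 D_{E,V}$, and $u_i\in g_\pi(i)$ whenever $u_i$ is a constant; (3) for each $z\neq z'$, $h(z)\cap h(z')=\emptyset$; (4) for each $u\approx u'$, some $c\in h(u)$, $c'\in h(u')$ satisfy $c\approx c'$. The answers $q(D_{E,V})$ of $q(\vec x)$ are the tuples $\vec c$ with $D_{E,V}\models q[\vec c]$. Rules: a hard (resp. soft) rule for objects is $q(x,y)\Rightarrow\mathsf{EqO}(x,y)$ (resp. $q(x,y)\dashrightarrow\mathsf{EqO}(x,y)$), $q$ a CQ possibly with similarity atoms, $x,y$ occurring only in object positions. A hard (resp. soft) rule for values is $q(x_t,y_t)\Rightarrow\mathsf{EqV}(\langle x_t,i\rangle,\langle y_t,j\rangle)$ (resp. with $\dashrightarrow$), $q$ a CQ possibly with similarity atoms, $x_t,y_t$ each occurring once in $q$, in position 0 of relational atoms over $R_x,R_y$, with $i,j$ value positions of $R_x,R_y$. An ER specification is $\Sigma=\langle\Gamma_O,\Gamma_V,\Delta\rangle$ with $\Gamma_O=\Gamma^o_h\cup\Gamma^o_s$ a finite set of hard and soft rules for objects, $\Gamma_V=\Gamma^v_h\cup\Gamma^v_s$ a finite set of hard and soft rules for values, $\Delta$ a finite set of denial constraints. $D_{E,V}$ satisfies a denial constraint iff it does not satisfy its body; it satisfies an object rule iff $q(D_{E,V})\subseteq E$; it satisfies a value rule iff $(t_1,t_2)\in q(D_{E,V})$ implies $(\langle t_1,i\rangle,\langle t_2,j\rangle)\in V$. Candidate solutions for $(D,\Sigma)$ are defined inductively: $\langle\mathsf{EqRel}(\emptyset,\mathsf{Obj}(D)),\mathsf{EqRel}(\emptyset,\mathsf{Cells}(D))\rangle$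 is one; if $\langle E',V\rangle$ is one and $(o,o')\in q(D_{E',V})$ for some rule $q(x,y)\to\mathsf{EqO}(x,y)\in\Gamma_O$ (hard or soft), then $\langle\mathsf{EqRel}(E'\cup\{(o,o')\},\mathsf{Obj}(D)),V\rangle$ is one; if $\langle E,V'\rangle$ is one and $(t,t')\in q(D_{E,V'})$ for some rule $q(x_t,y_t)\to\mathsf{EqV}(\langle x_t,i\rangle,\langle y_t,i'\rangle)\in\Gamma_V$, then $\langle E,\mathsf{EqRel}(V'\cup\{(\langle t,i\rangle,\langle t',i'\rangle)\},\mathsf{Cells}(D))\rangle$ is one. A solution is a candidate solution $\langle E,V\rangle$ with $D_{E,V}$ satisfying $\Gamma^o_h\cup\Gamma^v_h\cup\Delta$; $\mathsf{Sol}(D,\Sigma)$ is the set of solutions. Stable models of a normal logic program together with a set of ground facts are in the standard (Gelfond–Lifschitz) sense. *)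

theory Defs
  imports "HOL-Library.Infinite_Typeclass"
begin

section \<open>Constants, schemas and databases\<close>

datatype ('o, 'v, 't) cst = Obj 'o | Val 'v | Tid 't

datatype ty = ObjTy | ValTy

fun has_ty :: "('o, 'v, 't) cst \<Rightarrow> ty \<Rightarrow> bool" where
  "has_ty (Obj _) T \<longleftrightarrow> T = ObjTy"
| "has_ty (Val _) T \<longleftrightarrow> T = ValTy"
| "has_ty (Tid _) T \<longleftrightarrow> False"

text \<open>A schema maps each of its relation symbols to its type vector, whose length is the arity.\<close>

type_synonym 'r schema = "'r \<rightharpoonup> ty list"

definition is_schema :: "'r schema \<Rightarrow> bool" where
  "is_schema S \<longleftrightarrow> finite (dom S)"

text \<open>Argument positions are numbered from 1, position 0 being the tid; hence the shift by one
  when indexing type vectors and argument lists of facts.\<close>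

definition pos_ty :: "'r schema \<Rightarrow> 'r \<Rightarrow> nat \<Rightarrow> ty \<Rightarrow> bool" where
  "pos_ty S R i T \<longleftrightarrow> (\<exists>\<tau>. S R = Some \<tau> \<and> 1 \<le> i \<and> i \<le> length \<tau> \<and> \<tau> ! (i - 1) = T)"

type_synonym ('o, 'v, 't, 'r) fact = "'r \<times> 't \<times> ('o, 'v, 't) cst list"

definition database :: "'r schema \<Rightarrow> ('o, 'v, 't, 'r) fact set \<Rightarrow> bool" where
  "database S D \<longleftrightarrow> finite D
     \<and> (\<forall>(R, t, cs) \<in> D. \<exists>\<tau>. S R = Some \<tau> \<and> list_all2 has_ty cs \<tau>)
     \<and> (\<forall>(R, t, cs) \<in> D. \<forall>(R', t', cs') \<in> D. t = t' \<longrightarrow> R = R' \<and> cs = cs')"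

definition objs :: "('o, 'v, 't, 'r) fact set \<Rightarrow> ('o, 'v, 't) cst set" where
  "objs D = {Obj a | a R t cs. (R, t, cs) \<in> D \<and> Obj a \<in> set cs}"

definition dbdom :: "('o, 'v, 't, 'r) fact set \<Rightarrow> ('o, 'v, 't) cst set" where
  "dbdom D = (\<Union>(R, t, cs) \<in> D. insert (Tid t) (set cs))"

type_synonym 't cell = "'t \<times> nat"

definition cells :: "'r schema \<Rightarrow> ('o, 'v, 't, 'r) fact set \<Rightarrow> 't cell set" where
  "cells S D = {(t, i) | t i R cs. (R, t, cs) \<in> D \<and> pos_ty S R i ValTy}"

text \<open>\<open>const_at D t i c\<close> says that \<open>t[i]\<close> is defined and equal to \<open>c\<close>.\<close>

definition const_at ::
  "('o, 'v, 't, 'r) fact set \<Rightarrow> 't \<Rightarrow> nat \<Rightarrow> ('o, 'v, 't) cst \<Rightarrow> bool" where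
  "const_at D t i c \<longleftrightarrow>
     (\<exists>R cs. (R, t, cs) \<in> D \<and> 1 \<le> i \<and> i \<le> length cs \<and> c = cs ! (i - 1))"

definition EqRel :: "('a \<times> 'a) set \<Rightarrow> 'a set \<Rightarrow> ('a \<times> 'a) set" where
  "EqRel P A = \<Inter> {r. equiv A r \<and> P \<subseteq> r}"

text \<open>In the induced database the tid and all arguments are sets of constants; the tid set
  is the element at index 0 of the argument list.\<close>

definition induced_arg ::
  "'r schema \<Rightarrow> ('o, 'v, 't, 'r) fact set \<Rightarrow> ('o, 'v, 't) cst rel \<Rightarrow> 't cell rel \<Rightarrow>
   ('o, 'v, 't, 'r) fact \<Rightarrow> nat \<Rightarrow> ('o, 'v, 't) cst set" where
  "induced_arg S D E V = (\<lambda>(R, t, cs) i.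
     if i = 0 then {Tid t}
     else if pos_ty S R i ObjTy then {c. (cs ! (i - 1), c) \<in> E}
     else {c. \<exists>t' i'. ((t, i), (t', i')) \<in> V \<and> const_at D t' i' c})"

definition induced ::
  "'r schema \<Rightarrow> ('o, 'v, 't, 'r) fact set \<Rightarrow> ('o, 'v, 't) cst rel \<Rightarrow> 't cell rel \<Rightarrow>
   ('r \<times> ('o, 'v, 't) cst set list) set" where
  "induced S D E V =
     {(R, map (induced_arg S D E V (R, t, cs)) [0..<Suc (length cs)]) | R t cs. (R, t, cs) \<in> D}"


section \<open>Conjunctive queries\<close>

datatype 'c trm = Var nat | Con 'c

primrec trm_vars :: "'c trm \<Rightarrow> nat set" where
  "trm_vars (Var z) = {z}"
| "trm_vars (Con c) = {}"

primrec subst_trm :: "(nat \<Rightarrow> 'c trm) \<Rightarrow> 'c trm \<Rightarrow> 'c trm" where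
  "subst_trm \<sigma> (Var z) = \<sigma> z"
| "subst_trm \<sigma> (Con c) = Con c"

text \<open>Index 0 of the argument list of a relational atom is the tid position. Variables that are
  not answer variables are existentially quantified.\<close>

type_synonym ('c, 'r) ratom = "'r \<times> 'c trm list"

record ('c, 'r, 's) cq =
  ratoms :: "('c, 'r) ratom set"
  ineqs :: "('c trm \<times> 'c trm) set"
  sims :: "('s \<times> 'c trm \<times> 'c trm) set"

definition rel_vars :: "('c, 'r, 's) cq \<Rightarrow> nat set" where
  "rel_vars q = (\<Union>(R, us) \<in> ratoms q. \<Union>u \<in> set us. trm_vars u)"

definition ineq_vars :: "('c, 'r, 's) cq \<Rightarrow> nat set" where
  "ineq_vars q = (\<Union>(u, u') \<in> ineqs q. trm_vars u \<union> trm_vars u')"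

definition sim_vars :: "('c, 'r, 's) cq \<Rightarrow> nat set" where
  "sim_vars q = (\<Union>(p, u, u') \<in> sims q. trm_vars u \<union> trm_vars u')"

definition cq_terms :: "('c, 'r, 's) cq \<Rightarrow> 'c trm set" where
  "cq_terms q = (\<Union>(R, us) \<in> ratoms q. set us)
     \<union> (\<Union>(u, u') \<in> ineqs q. {u, u'}) \<union> (\<Union>(p, u, u') \<in> sims q. {u, u'})"

definition subst_cq :: "(nat \<Rightarrow> 'c trm) \<Rightarrow> ('c, 'r, 's) cq \<Rightarrow> ('c, 'r, 's) cq" where
  "subst_cq \<sigma> q =
     \<lparr>ratoms = (\<lambda>(R, us). (R, map (subst_trm \<sigma>) us)) ` ratoms q,
      ineqs = (\<lambda>(u, u'). (subst_trm \<sigma> u, subst_trm \<sigma> u')) ` ineqs q,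
      sims = (\<lambda>(p, u, u'). (p, subst_trm \<sigma> u, subst_trm \<sigma> u')) ` sims q\<rparr>"

definition wf_cq :: "'r schema \<Rightarrow> ('c, 'r, 's) cq \<Rightarrow> bool" where
  "wf_cq S q \<longleftrightarrow> finite (ratoms q) \<and> finite (ineqs q) \<and> finite (sims q)
     \<and> (\<forall>(R, us) \<in> ratoms q. \<exists>\<tau>. S R = Some \<tau> \<and> length us = Suc (length \<tau>))"

text \<open>Satisfaction of a Boolean query in the induced database; \<open>sim\<close> interprets the similarity
  predicates. The intersection defining \<open>h (Var z)\<close> is taken within \<open>dbdom D\<close>, so for a variable
  without any occurrence in a relational atom it is \<open>dbdom D\<close> itself.\<close>

definition sat ::
  "'r schema \<Rightarrow> ('s \<Rightarrow> ('o, 'v, 't) cst rel) \<Rightarrow> ('o, 'v, 't, 'r) fact set \<Rightarrow>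
   ('o, 'v, 't) cst rel \<Rightarrow> 't cell rel \<Rightarrow> (('o, 'v, 't) cst, 'r, 's) cq \<Rightarrow> bool" where
  "sat S sim D E V q \<longleftrightarrow>
     (\<exists>(h :: ('o, 'v, 't) cst trm \<Rightarrow> ('o, 'v, 't) cst set)
       (g :: (('o, 'v, 't) cst, 'r) ratom \<Rightarrow> nat \<Rightarrow> ('o, 'v, 't) cst set).
        (\<forall>u \<in> cq_terms q. h u \<noteq> {} \<and> h u \<subseteq> dbdom D)
      \<and> (\<forall>(R, us) \<in> ratoms q. \<forall>i < length us. g (R, us) i \<subseteq> dbdom D)
      \<and> (\<forall>a. Con a \<in> cq_terms q \<longrightarrow> h (Con a) = {a})
      \<and> (\<forall>z. Var z \<in> cq_terms q \<longrightarrow>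
           h (Var z) = {c \<in> dbdom D.
             \<forall>(R, us) \<in> ratoms q. \<forall>i < length us. us ! i = Var z \<longrightarrow> c \<in> g (R, us) i})
      \<and> (\<forall>(R, us) \<in> ratoms q.
           (R, map (g (R, us)) [0..<length us]) \<in> induced S D E V
         \<and> (\<forall>i < length us. \<forall>a. us ! i = Con a \<longrightarrow> a \<in> g (R, us) i))
      \<and> (\<forall>(u, u') \<in> ineqs q. h u \<inter> h u' = {})
      \<and> (\<forall>(p, u, u') \<in> sims q. \<exists>c \<in> h u. \<exists>c' \<in> h u'. (c, c') \<in> sim p))"

text \<open>Answers of a query with the two (not necessarily distinct) answer variables \<open>x\<close> and \<open>y\<close>.\<close>

definition answers ::
  "'r schema \<Rightarrow> ('s \<Rightarrow> ('o, 'v, 't) cst rel) \<Rightarrow> ('o, 'v, 't, 'r) fact set \<Rightarrow>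
   ('o, 'v, 't) cst rel \<Rightarrow> 't cell rel \<Rightarrow> (('o, 'v, 't) cst, 'r, 's) cq \<Rightarrow> nat \<Rightarrow> nat \<Rightarrow>
   ('o, 'v, 't) cst rel" where
  "answers S sim D E V q x y =
     {(c, c'). (x = y \<longrightarrow> c = c') \<and>
        sat S sim D E V (subst_cq (Var(x := Con c, y := Con c')) q)}"


section \<open>Entity resolution specifications\<close>

record ('c, 'r, 's) obj_rule =
  obody :: "('c, 'r, 's) cq"
  ox :: nat
  oy :: nat

record ('c, 'r, 's) val_rule =
  vbody :: "('c, 'r, 's) cq"
  vx :: nat
  vi :: nat
  vy :: nat
  vj :: nat

record ('c, 'r, 's) er_spec =
  hard_obj :: "('c, 'r, 's) obj_rule set"
  soft_obj :: "('c, 'r, 's) obj_rule set"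
  hard_val :: "('c, 'r, 's) val_rule set"
  soft_val :: "('c, 'r, 's) val_rule set"
  denials :: "('c, 'r, 's) cq set"

text \<open>Similarity atoms have no object positions; occurrences of \<open>x\<close> in them are not restricted.\<close>

definition only_obj_pos :: "'r schema \<Rightarrow> ('c, 'r, 's) cq \<Rightarrow> nat \<Rightarrow> bool" where
  "only_obj_pos S q x \<longleftrightarrow> x \<in> rel_vars q \<and>
     (\<forall>(R, us) \<in> ratoms q. \<forall>i < length us. us ! i = Var x \<longrightarrow> pos_ty S R i ObjTy)"

definition wf_obj_rule :: "'r schema \<Rightarrow> ('c, 'r, 's) obj_rule \<Rightarrow> bool" where
  "wf_obj_rule S \<rho> \<longleftrightarrow> wf_cq S (obody \<rho>) \<and> ineqs (obody \<rho>) = {}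
     \<and> only_obj_pos S (obody \<rho>) (ox \<rho>) \<and> only_obj_pos S (obody \<rho>) (oy \<rho>)"

text \<open>The variable \<open>x\<close> occurs exactly once, as the tid of an atom for which \<open>i\<close> is a value
  position.\<close>

definition tid_var :: "'r schema \<Rightarrow> ('c, 'r, 's) cq \<Rightarrow> nat \<Rightarrow> nat \<Rightarrow> bool" where
  "tid_var S q x i \<longleftrightarrow> x \<notin> ineq_vars q \<and> x \<notin> sim_vars q \<and>
     (\<exists>R us. {(\<pi>, k). \<pi> \<in> ratoms q \<and> k < length (snd \<pi>) \<and> snd \<pi> ! k = Var x} = {((R, us), 0)}
        \<and> pos_ty S R i ValTy)"

definition wf_val_rule :: "'r schema \<Rightarrow> ('c, 'r, 's) val_rule \<Rightarrow> bool" where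
  "wf_val_rule S \<rho> \<longleftrightarrow> wf_cq S (vbody \<rho>) \<and> ineqs (vbody \<rho>) = {}
     \<and> tid_var S (vbody \<rho>) (vx \<rho>) (vi \<rho>) \<and> tid_var S (vbody \<rho>) (vy \<rho>) (vj \<rho>)"

definition wf_denial :: "'r schema \<Rightarrow> ('c, 'r, 's) cq \<Rightarrow> bool" where
  "wf_denial S q \<longleftrightarrow> wf_cq S q \<and> sims q = {} \<and> ineq_vars q \<subseteq> rel_vars q"

definition wf_spec :: "'r schema \<Rightarrow> ('c, 'r, 's) er_spec \<Rightarrow> bool" where
  "wf_spec S \<Sigma> \<longleftrightarrow>
     finite (hard_obj \<Sigma>) \<and> finite (soft_obj \<Sigma>) \<and>
     finite (hard_val \<Sigma>) \<and> finite (soft_val \<Sigma>) \<and> finite (denials \<Sigma>) \<and>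
     (\<forall>\<rho> \<in> hard_obj \<Sigma> \<union> soft_obj \<Sigma>. wf_obj_rule S \<rho>) \<and>
     (\<forall>\<rho> \<in> hard_val \<Sigma> \<union> soft_val \<Sigma>. wf_val_rule S \<rho>) \<and>
     (\<forall>q \<in> denials \<Sigma>. wf_denial S q)"

inductive candidate ::
  "'r schema \<Rightarrow> (('o, 'v, 't) cst, 'r, 's) er_spec \<Rightarrow> ('s \<Rightarrow> ('o, 'v, 't) cst rel) \<Rightarrow>
   ('o, 'v, 't, 'r) fact set \<Rightarrow> ('o, 'v, 't) cst rel \<Rightarrow> 't cell rel \<Rightarrow> bool"
  for S \<Sigma> sim D where
  init: "candidate S \<Sigma> sim D (EqRel {} (objs D)) (EqRel {} (cells S D))"
| obj: "candidate S \<Sigma> sim D (EqRel (E \<union> {(a, b)}) (objs D)) V"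
    if "candidate S \<Sigma> sim D E V" "\<rho> \<in> hard_obj \<Sigma> \<union> soft_obj \<Sigma>"
       "(a, b) \<in> answers S sim D E V (obody \<rho>) (ox \<rho>) (oy \<rho>)"
| val: "candidate S \<Sigma> sim D E (EqRel (V \<union> {((t, vi \<rho>), (t', vj \<rho>))}) (cells S D))"
    if "candidate S \<Sigma> sim D E V" "\<rho> \<in> hard_val \<Sigma> \<union> soft_val \<Sigma>"
       "(Tid t, Tid t') \<in> answers S sim D E V (vbody \<rho>) (vx \<rho>) (vy \<rho>)"

definition Sol ::
  "'r schema \<Rightarrow> (('o, 'v, 't) cst, 'r, 's) er_spec \<Rightarrow> ('s \<Rightarrow> ('o, 'v, 't) cst rel) \<Rightarrow>
   ('o, 'v, 't, 'r) fact set \<Rightarrow> (('o, 'v, 't) cst rel \<times> 't cell rel) set" where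
  "Sol S \<Sigma> sim D = {(E, V). candidate S \<Sigma> sim D E V
     \<and> (\<forall>\<rho> \<in> hard_obj \<Sigma>. answers S sim D E V (obody \<rho>) (ox \<rho>) (oy \<rho>) \<subseteq> E)
     \<and> (\<forall>\<rho> \<in> hard_val \<Sigma>. \<forall>t t'.
          (Tid t, Tid t') \<in> answers S sim D E V (vbody \<rho>) (vx \<rho>) (vy \<rho>) \<longrightarrow>
          ((t, vi \<rho>), (t', vj \<rho>)) \<in> V)
     \<and> (\<forall>q \<in> denials \<Sigma>. \<not> sat S sim D E V q)}"


section \<open>Normal logic programs and stable models\<close>

type_synonym ('p, 'c) atm = "'p \<times> 'c trm list"
type_synonym ('p, 'c) gatm = "'p \<times> 'c list"

text \<open>The rule \<open>Rule a bs ns\<close> stands for \<open>a \<leftarrow> bs, not ns\<close>.\<close>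

datatype ('p, 'c) rule =
  Rule (head: "('p, 'c) atm") (pos: "('p, 'c) atm list") (neg: "('p, 'c) atm list")

definition rule_atoms :: "('p, 'c) rule \<Rightarrow> ('p, 'c) atm set" where
  "rule_atoms r = insert (head r) (set (pos r) \<union> set (neg r))"

definition atm_vars :: "('p, 'c) atm \<Rightarrow> nat set" where
  "atm_vars a = (\<Union>u \<in> set (snd a). trm_vars u)"

definition rule_vars :: "('p, 'c) rule \<Rightarrow> nat set" where
  "rule_vars r = (\<Union>a \<in> rule_atoms r. atm_vars a)"

definition safe :: "('p, 'c) rule \<Rightarrow> bool" where
  "safe r \<longleftrightarrow> rule_vars r \<subseteq> (\<Union>a \<in> set (pos r). atm_vars a)"

primrec ground_trm :: "(nat \<Rightarrow> 'c) \<Rightarrow> 'c trm \<Rightarrow> 'c" where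
  "ground_trm \<theta> (Var z) = \<theta> z"
| "ground_trm \<theta> (Con c) = c"

definition ground_atm :: "(nat \<Rightarrow> 'c) \<Rightarrow> ('p, 'c) atm \<Rightarrow> ('p, 'c) gatm" where
  "ground_atm \<theta> a = (fst a, map (ground_trm \<theta>) (snd a))"

definition herbrand :: "('p, 'c) rule set \<Rightarrow> ('p, 'c) gatm set \<Rightarrow> 'c set" where
  "herbrand \<Pi> F = {c. \<exists>r \<in> \<Pi>. \<exists>a \<in> rule_atoms r. Con c \<in> set (snd a)}
     \<union> (\<Union>(p, cs) \<in> F. set cs)"

text \<open>A ground rule is a triple of its head, its positive body and its negative body.\<close>

type_synonym ('p, 'c) grule =
  "('p, 'c) gatm \<times> ('p, 'c) gatm set \<times> ('p, 'c) gatm set"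

definition ground ::
  "('p, 'c) rule set \<Rightarrow> ('p, 'c) gatm set \<Rightarrow> ('p, 'c) grule set" where
  "ground \<Pi> F =
     {(ground_atm \<theta> (head r), ground_atm \<theta> ` set (pos r), ground_atm \<theta> ` set (neg r)) | r \<theta>.
        r \<in> \<Pi> \<and> (\<forall>z \<in> rule_vars r. \<theta> z \<in> herbrand \<Pi> F)}
     \<union> {(f, {}, {}) | f. f \<in> F}"

definition reduct ::
  "('p, 'c) grule set \<Rightarrow> ('p, 'c) gatm set \<Rightarrow> (('p, 'c) gatm \<times> ('p, 'c) gatm set) set" where
  "reduct G M = {(a, B) | a B N. (a, B, N) \<in> G \<and> N \<inter> M = {}}"

definition least_model :: "('a \<times> 'a set) set \<Rightarrow> 'a set" where
  "least_model P = \<Inter> {I. \<forall>(a, B) \<in> P. B \<subseteq> I \<longrightarrow> a \<in> I}"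

definition stable_model ::
  "('p, 'c) rule set \<Rightarrow> ('p, 'c) gatm set \<Rightarrow> ('p, 'c) gatm set \<Rightarrow> bool" where
  "stable_model \<Pi> F M \<longleftrightarrow> M = least_model (reduct (ground \<Pi> F) M)"


section \<open>Programs over databases\<close>

text \<open>The constants of programs are the database constants and the position numbers needed as
  arguments of \<open>EqV\<close>.\<close>

datatype ('o, 'v, 't) pcst = Cst "('o, 'v, 't) cst" | Pos nat

datatype ('r, 's) pred = RelP 'r | SimP 's | EqO | EqV | Aux nat

fun pred_arity :: "'r schema \<Rightarrow> (nat \<Rightarrow> nat) \<Rightarrow> ('r, 's) pred \<Rightarrow> nat option" where
  "pred_arity S aux (RelP R) = map_option (\<lambda>\<tau>. Suc (length \<tau>)) (S R)"
| "pred_arity S aux (SimP p) = Some 2"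
| "pred_arity S aux EqO = Some 2"
| "pred_arity S aux EqV = Some 4"
| "pred_arity S aux (Aux n) = Some (aux n)"

definition normal_program ::
  "'r schema \<Rightarrow> (('r, 's) pred, ('o, 'v, 't) pcst) rule set \<Rightarrow> bool" where
  "normal_program S \<Pi> \<longleftrightarrow> finite \<Pi> \<and> (\<forall>r \<in> \<Pi>. safe r)
     \<and> (\<exists>aux. \<forall>r \<in> \<Pi>. \<forall>(p, us) \<in> rule_atoms r. pred_arity S aux p = Some (length us))"

definition input_facts ::
  "('s \<Rightarrow> ('o, 'v, 't) cst rel) \<Rightarrow> ('o, 'v, 't, 'r) fact set \<Rightarrow>
   (('r, 's) pred, ('o, 'v, 't) pcst) gatm set" where
  "input_facts sim D =
     {(RelP R, map Cst (Tid t # cs)) | R t cs. (R, t, cs) \<in> D}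
     \<union> {(SimP p, [Cst c, Cst c']) | p c c'. (c, c') \<in> sim p}"

definition pcell :: "'t cell \<Rightarrow> ('o, 'v, 't) pcst \<times> ('o, 'v, 't) pcst" where
  "pcell = (\<lambda>(t, i). (Cst (Tid t), Pos i))"

end

theory Submission
  imports Defs
begin

text \<open>The program computes the closure of \<open>EqO\<close> and \<open>EqV\<close> under equivalence and all rules, where an
  instance of a soft rule is blocked by an atom \<open>NeqO\<close> or \<open>NeqV\<close>, derivable exactly for the pairs that are
  not merged. So the merges in a stable model are precisely those that can be reached from the trivial
  equivalences by rule applications staying within the final relations, which is what being a
  candidate solution means, and closedness under the hard rules comes for free. Since rule bodies have
  no inequalities, they compile to positive bodies. By maximality, a maximal candidate solution
  contained in a stable model is closed under all rule applications within that model, so it already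
  contains all of its merges.

  Query satisfaction over sets of constants is expressed pointwise: once a fact is chosen for each
  relational atom, non-emptiness of the set of a term is witnessed by a single constant. Only
  inequalities need a universal statement, and they are handled by negated auxiliary atoms that
  record, for a choice of facts, that two of these sets meet.\<close>

section \<open>Stable models of safe programs\<close>

text \<open>The clauses for soft rules negate \<open>NeqO\<close> or \<open>NeqV\<close>, whose own
  clauses negate \<open>EqO\<close> or \<open>EqV\<close>. This even loop through negation acts as a
  guess of the final relations, while the least model of the reduct demands that every guessed merge
  be derived from the facts without circularity; that is the counterpart of the inductive generation
  of candidates. No order of rule applications has to be encoded, because an answer of a rule body
  survives further merges. The obstacle lies in matching queries. In an induced database a repeated
  variable asks for intersecting argument sets, not for equal stored constants, so query atoms
  cannot be copied into clauses. Relational atoms therefore only select facts, with a fresh variable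
  per position, and joins go through atoms stating that a constant belongs to an argument set, keyed
  by the tid, which determines the fact. Answer variables need extra care: substitution turns them
  into constants, so every similarity atom must use the very constant that is reported.\<close>

inductive_set derivable ::
  "('p, 'c) rule set \<Rightarrow> ('p, 'c) gatm set \<Rightarrow> ('p, 'c) gatm set \<Rightarrow> ('p, 'c) gatm set"
  for \<Pi> F M where
  fact: "f \<in> F \<Longrightarrow> f \<in> derivable \<Pi> F M"
| rule: "r \<in> \<Pi> \<Longrightarrow> (\<And>a. a \<in> set (pos r) \<Longrightarrow> ground_atm \<theta> a \<in> derivable \<Pi> F M) \<Longrightarrow>
    (\<And>a. a \<in> set (neg r) \<Longrightarrow> ground_atm \<theta> a \<notin> M) \<Longrightarrow>
    ground_atm \<theta> (head r) \<in> derivable \<Pi> F M"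

lemma set_ground_atm: "set (snd (ground_atm \<theta> a)) = ground_trm \<theta> ` set (snd a)"
  by (simp add: ground_atm_def)

lemma mem_trm_vars: "z \<in> trm_vars u \<longleftrightarrow> u = Var z"
  by (cases u) auto

lemma mem_atm_vars: "z \<in> atm_vars a \<longleftrightarrow> Var z \<in> set (snd a)"
  unfolding atm_vars_def by (auto simp: mem_trm_vars)

text \<open>A variable of the head occurs in a positive body atom by safety, so its value is a
  constant of an atom derived earlier; constants written in the head belong to the Herbrand universe
  by definition.\<close>

lemma derivable_herbrand:
  assumes "\<forall>r \<in> \<Pi>. safe r" and "a \<in> derivable \<Pi> F M"
  shows "set (snd a) \<subseteq> herbrand \<Pi> F"
  using assms(2)
proof induction
  case (fact f)
  then show ?case by (force simp: herbrand_def)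
next
  case (rule r \<theta>)
  show ?case
  proof
    fix c assume "c \<in> set (snd (ground_atm \<theta> (head r)))"
    then obtain u where u: "u \<in> set (snd (head r))" "c = ground_trm \<theta> u"
      by (auto simp: set_ground_atm)
    show "c \<in> herbrand \<Pi> F"
    proof (cases u)
      case (Var z)
      then have "z \<in> rule_vars r"
        using u unfolding rule_vars_def rule_atoms_def by (simp add: mem_atm_vars)
      then obtain b where b: "b \<in> set (pos r)" "z \<in> atm_vars b"
        using assms(1) rule(1) unfolding safe_def by blast
      have "Var z \<in> set (snd b)"
        using b(2) by (simp add: mem_atm_vars)
      then show ?thesis
        using rule.IH[OF b(1)] u Var by (force simp: set_ground_atm)
    next
      case (Con d)
      then show ?thesis
        using u rule(1) by (auto simp: herbrand_def rule_atoms_def)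
    qed
  qed
qed

text \<open>\<open>derivable\<close> admits substitutions by arbitrary constants, while
  \<open>ground\<close> stays inside the Herbrand universe. Safety closes the gap: a substitution
  whose positive body is derived takes only Herbrand values on the variables of the rule.\<close>

lemma least_model_eq_derivable:
  assumes "\<forall>r \<in> \<Pi>. safe r"
  shows "least_model (reduct (ground \<Pi> F) M) = derivable \<Pi> F M"
proof
  show "least_model (reduct (ground \<Pi> F) M) \<subseteq> derivable \<Pi> F M"
  proof -
    have "\<forall>(a, B) \<in> reduct (ground \<Pi> F) M. B \<subseteq> derivable \<Pi> F M \<longrightarrow> a \<in> derivable \<Pi> F M"
    proof clarify
      fix p xs B assume "((p, xs), B) \<in> reduct (ground \<Pi> F) M" and B: "B \<subseteq> derivable \<Pi> F M"
      then obtain N where N: "((p, xs), B, N) \<in> ground \<Pi> F" "N \<inter> M = {}"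
        by (auto simp: reduct_def)
      from N(1) consider (rule) r \<theta> where "r \<in> \<Pi>" "(p, xs) = ground_atm \<theta> (head r)"
          "B = ground_atm \<theta> ` set (pos r)" "N = ground_atm \<theta> ` set (neg r)"
        | (fact) "(p, xs) \<in> F"
        unfolding ground_def by blast
      then show "(p, xs) \<in> derivable \<Pi> F M"
      proof cases
        case rule
        show ?thesis unfolding rule(2)
          by (rule derivable.rule[OF rule(1)]) (use rule B N(2) in auto)
      qed (rule derivable.fact)
    qed
    then show ?thesis unfolding least_model_def by blast
  qed
next
  show "derivable \<Pi> F M \<subseteq> least_model (reduct (ground \<Pi> F) M)"
  proof
    fix a assume "a \<in> derivable \<Pi> F M"
    then show "a \<in> least_model (reduct (ground \<Pi> F) M)"
    proof induction
      case (fact f)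
      then have "(f, {}) \<in> reduct (ground \<Pi> F) M"
        unfolding reduct_def ground_def by blast
      then show ?case unfolding least_model_def by blast
    next
      case (rule r \<theta>)
      have "\<theta> z \<in> herbrand \<Pi> F" if z: "z \<in> rule_vars r" for z
      proof -
        obtain b where b: "b \<in> set (pos r)" "z \<in> atm_vars b"
          using assms rule(1) z unfolding safe_def by blast
        have "Var z \<in> set (snd b)"
          using b(2) by (simp add: mem_atm_vars)
        then show ?thesis
          using derivable_herbrand[OF assms rule(2)[OF b(1)]]
          by (force simp: set_ground_atm)
      qed
      then have "(ground_atm \<theta> (head r), ground_atm \<theta> ` set (pos r)) \<in> reduct (ground \<Pi> F) M"
        using rule(1,3) unfolding reduct_def ground_def by blast
      note red = this
      show ?case
        unfolding least_model_def
      proof (intro InterI, unfold mem_Collect_eq)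
        fix I assume I: "\<forall>(a, B) \<in> reduct (ground \<Pi> F) M. B \<subseteq> I \<longrightarrow> a \<in> I"
        have "least_model (reduct (ground \<Pi> F) M) \<subseteq> I"
          unfolding least_model_def by (rule Inter_lower) (simp add: I)
        then have "ground_atm \<theta> ` set (pos r) \<subseteq> I" using rule.IH by auto
        then show "ground_atm \<theta> (head r) \<in> I" using bspec[OF I red] by simp
      qed
    qed
  qed
qed

lemma stable_model_iff:
  assumes "\<forall>r \<in> \<Pi>. safe r"
  shows "stable_model \<Pi> F M \<longleftrightarrow> M = derivable \<Pi> F M"
  by (simp add: stable_model_def least_model_eq_derivable[OF assms])

section \<open>Queries in induced databases\<close>

text \<open>Replaces the function \<open>g\<close> of \<open>sat\<close>: each
  \<open>g \<pi>\<close> must list the argument sets of one induced fact, so choosing that fact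
  determines it. The \<open>Suc\<close> accounts for the tid position.\<close>

definition fact_assignment ::
  "('o, 'v, 't, 'r) fact set \<Rightarrow> ('c, 'r, 's) cq \<Rightarrow>
   (('c, 'r) ratom \<Rightarrow> ('o, 'v, 't, 'r) fact) \<Rightarrow> bool" where
  "fact_assignment D q F \<longleftrightarrow> (\<forall>\<pi> \<in> ratoms q. F \<pi> \<in> D \<and> fst (F \<pi>) = fst \<pi>
     \<and> length (snd \<pi>) = Suc (length (snd (snd (F \<pi>)))))"

text \<open>For a constant \<open>Con a\<close> this set is \<open>{a}\<close> if all the membership conditions on \<open>a\<close> in the
  definition of \<^const>\<open>sat\<close> hold, and empty otherwise; constants and variables can thus be
  treated alike.\<close>

definition trm_set ::
  "'r schema \<Rightarrow> ('o, 'v, 't, 'r) fact set \<Rightarrow> ('o, 'v, 't) cst rel \<Rightarrow> 't cell rel \<Rightarrow>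
   (('o, 'v, 't) cst, 'r, 's) cq \<Rightarrow> ((('o, 'v, 't) cst, 'r) ratom \<Rightarrow> ('o, 'v, 't, 'r) fact) \<Rightarrow>
   ('o, 'v, 't) cst trm \<Rightarrow> ('o, 'v, 't) cst set" where
  "trm_set S D E V q F u = {c \<in> dbdom D. (\<forall>a. u = Con a \<longrightarrow> c = a)
     \<and> (\<forall>\<pi> \<in> ratoms q. \<forall>i < length (snd \<pi>). snd \<pi> ! i = u \<longrightarrow> c \<in> induced_arg S D E V (F \<pi>) i)}"

lemma induced_arg_subset:
  assumes "f \<in> D" "E \<subseteq> objs D \<times> objs D"
  shows "induced_arg S D E V f i \<subseteq> dbdom D"
proof
  fix c assume c: "c \<in> induced_arg S D E V f i"
  obtain R t cs where f: "f = (R, t, cs)" by (cases f)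
  have "c = Tid t \<or> c \<in> objs D \<or> (\<exists>t' i'. const_at D t' i' c)"
    using c assms(2) unfolding induced_arg_def f by (auto split: if_splits)
  then consider "c = Tid t" | "c \<in> objs D" | t' i' where "const_at D t' i' c"
    by blast
  then show "c \<in> dbdom D"
  proof cases
    case 1 then show ?thesis using assms(1) f by (force simp: dbdom_def)
  next
    case 2 then show ?thesis by (force simp: objs_def dbdom_def)
  next
    case 3
    then obtain R' cs' where "(R', t', cs') \<in> D" "1 \<le> i'" "i' \<le> length cs'" "c = cs' ! (i' - 1)"
      by (auto simp: const_at_def)
    moreover then have "c \<in> set cs'" by simp
    ultimately show ?thesis by (force simp: dbdom_def)
  qed
qed

text \<open>Once facts are chosen, the conditions on \<open>h\<close> determine it on every term of
  the query, and its value is \<open>trm_set\<close>; only the choice \<open>F\<close> remains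
  existential. The bound on \<open>E\<close> keeps the argument sets inside
  \<open>dbdom D\<close>.\<close>

lemma sat_iff:
  assumes E: "E \<subseteq> objs D \<times> objs D"
  shows "sat S sim D E V q \<longleftrightarrow> (\<exists>F. fact_assignment D q F
    \<and> (\<forall>u \<in> cq_terms q. trm_set S D E V q F u \<noteq> {})
    \<and> (\<forall>(u, u') \<in> ineqs q. trm_set S D E V q F u \<inter> trm_set S D E V q F u' = {})
    \<and> (\<forall>(p, u, u') \<in> sims q.
         \<exists>c \<in> trm_set S D E V q F u. \<exists>c' \<in> trm_set S D E V q F u'. (c, c') \<in> sim p))"
    (is "_ \<longleftrightarrow> (\<exists>F. ?P F)")
proof
  assume "sat S sim D E V q"
  then obtain h g where hg: "(\<forall>u \<in> cq_terms q. h u \<noteq> {} \<and> h u \<subseteq> dbdom D)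
      \<and> (\<forall>(R, us) \<in> ratoms q. \<forall>i < length us. g (R, us) i \<subseteq> dbdom D)
      \<and> (\<forall>a. Con a \<in> cq_terms q \<longrightarrow> h (Con a) = {a})
      \<and> (\<forall>z. Var z \<in> cq_terms q \<longrightarrow>
           h (Var z) = {c \<in> dbdom D.
             \<forall>(R, us) \<in> ratoms q. \<forall>i < length us. us ! i = Var z \<longrightarrow> c \<in> g (R, us) i})
      \<and> (\<forall>(R, us) \<in> ratoms q.
           (R, map (g (R, us)) [0..<length us]) \<in> induced S D E V
         \<and> (\<forall>i < length us. \<forall>a. us ! i = Con a \<longrightarrow> a \<in> g (R, us) i))
      \<and> (\<forall>(u, u') \<in> ineqs q. h u \<inter> h u' = {})
      \<and> (\<forall>(p, u, u') \<in> sims q. \<exists>c \<in> h u. \<exists>c' \<in> h u'. (c, c') \<in> sim p)"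
    unfolding sat_def by (elim exE) (rule that)
  note h = hg[THEN conjunct1]
    and hC = hg[THEN conjunct2, THEN conjunct2, THEN conjunct1, rule_format]
    and hV = hg[THEN conjunct2, THEN conjunct2, THEN conjunct2, THEN conjunct1, rule_format]
    and g = hg[THEN conjunct2, THEN conjunct2, THEN conjunct2, THEN conjunct2, THEN conjunct1]
    and IZ = hg[THEN conjunct2, THEN conjunct2, THEN conjunct2, THEN conjunct2, THEN conjunct2]
  have "\<exists>f. f \<in> D \<and> fst f = fst \<pi> \<and> length (snd \<pi>) = Suc (length (snd (snd f)))
      \<and> (\<forall>i < length (snd \<pi>). g \<pi> i = induced_arg S D E V f i)" if "\<pi> \<in> ratoms q" for \<pi>
  proof -
    obtain R us where \<pi>: "\<pi> = (R, us)" by (cases \<pi>)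
    have "(R, map (g (R, us)) [0..<length us]) \<in> induced S D E V"
      using g that \<pi> by blast
    then obtain t cs where t: "(R, t, cs) \<in> D"
      "map (g (R, us)) [0..<length us]
        = map (induced_arg S D E V (R, t, cs)) [0..<Suc (length cs)]" (is "?l = ?r")
      unfolding induced_def mem_Collect_eq prod.inject by (elim exE conjE) (rule that; simp only:)
    have l: "length us = Suc (length cs)"
      using arg_cong[OF t(2), of length] by simp
    have "g (R, us) i = induced_arg S D E V (R, t, cs) i" if "i < length us" for i
      using arg_cong[OF t(2), of "\<lambda>xs. xs ! i"] that l by (simp del: upt_Suc)
    then show ?thesis using t(1) l by (intro exI[of _ "(R, t, cs)"]) (simp add: \<pi>)
  qed
  then obtain F where F: "\<And>\<pi>. \<pi> \<in> ratoms q \<Longrightarrow> F \<pi> \<in> D \<and> fst (F \<pi>) = fst \<pi>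
      \<and> length (snd \<pi>) = Suc (length (snd (snd (F \<pi>))))
      \<and> (\<forall>i < length (snd \<pi>). g \<pi> i = induced_arg S D E V (F \<pi>) i)"
    by metis
  have eq: "trm_set S D E V q F u = h u" if u: "u \<in> cq_terms q" for u
  proof (cases u)
    case (Var z)
    then show ?thesis using hV[of z] u F by (fastforce simp: trm_set_def)
  next
    case (Con a)
    then have "h u = {a}" "a \<in> dbdom D" using hC[of a] u h by auto
    moreover have "\<forall>\<pi> \<in> ratoms q. \<forall>i < length (snd \<pi>). snd \<pi> ! i = Con a
        \<longrightarrow> a \<in> induced_arg S D E V (F \<pi>) i"
      using g F by fastforce
    ultimately show ?thesis using Con by (auto simp: trm_set_def)
  qed
  have T: "u \<in> cq_terms q" "u' \<in> cq_terms q" if "(u, u') \<in> ineqs q" for u u'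
    using that unfolding cq_terms_def by blast+
  have T': "u \<in> cq_terms q" "u' \<in> cq_terms q" if "(p, u, u') \<in> sims q" for p u u'
    using that unfolding cq_terms_def by blast+
  show "\<exists>F. ?P F"
  proof (intro exI[of _ F] conjI)
    show "fact_assignment D q F" using F by (simp add: fact_assignment_def)
    show "\<forall>u \<in> cq_terms q. trm_set S D E V q F u \<noteq> {}"
      using h by (simp add: eq)
    show "\<forall>(u, u') \<in> ineqs q. trm_set S D E V q F u \<inter> trm_set S D E V q F u' = {}"
    proof clarify
      fix u u' assume "(u, u') \<in> ineqs q"
      then show "trm_set S D E V q F u \<inter> trm_set S D E V q F u' = {}"
        using bspec[OF IZ[THEN conjunct1]] eq T by fastforce
    qed
    show "\<forall>(p, u, u') \<in> sims q.
         \<exists>c \<in> trm_set S D E V q F u. \<exists>c' \<in> trm_set S D E V q F u'. (c, c') \<in> sim p"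
    proof clarify
      fix p u u' assume "(p, u, u') \<in> sims q"
      then show "\<exists>c \<in> trm_set S D E V q F u. \<exists>c' \<in> trm_set S D E V q F u'. (c, c') \<in> sim p"
        using bspec[OF IZ[THEN conjunct2]] eq T' by fastforce
    qed
  qed
next
  assume "\<exists>F. ?P F"
  then obtain F where FA: "fact_assignment D q F"
    and F: "(\<forall>u \<in> cq_terms q. trm_set S D E V q F u \<noteq> {})
    \<and> (\<forall>(u, u') \<in> ineqs q. trm_set S D E V q F u \<inter> trm_set S D E V q F u' = {})
    \<and> (\<forall>(p, u, u') \<in> sims q.
         \<exists>c \<in> trm_set S D E V q F u. \<exists>c' \<in> trm_set S D E V q F u'. (c, c') \<in> sim p)"
    by (elim exE conjE[of "fact_assignment _ _ _"]) (rule that)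
  let ?h = "trm_set S D E V q F" and ?g = "\<lambda>\<pi>. induced_arg S D E V (F \<pi>)"
  have FD: "F \<pi> \<in> D \<and> fst (F \<pi>) = fst \<pi> \<and> length (snd \<pi>) = Suc (length (snd (snd (F \<pi>))))"
    if "\<pi> \<in> ratoms q" for \<pi>
    using FA that by (simp add: fact_assignment_def)
  have at: "u \<in> cq_terms q" if "(R, us) \<in> ratoms q" "u \<in> set us" for R us u
    using that by (force simp: cq_terms_def)
  have ne: "?h u \<noteq> {}" if "u \<in> cq_terms q" for u
    using F[THEN conjunct1] that by blast
  \<comment> \<open>The set of a constant is contained in \<open>{a}\<close>, so being nonempty is
    the same as passing all membership conditions.\<close>
  have C: "a \<in> ?h (Con a)" if "Con a \<in> cq_terms q" for a
    using ne[OF that] by (auto simp: trm_set_def)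
  show "sat S sim D E V q"
    unfolding sat_def
  proof (intro exI[of _ ?h] exI[of _ ?g] conjI)
    show "\<forall>u \<in> cq_terms q. ?h u \<noteq> {} \<and> ?h u \<subseteq> dbdom D"
      using ne by (auto simp: trm_set_def)
    show "\<forall>(R, us) \<in> ratoms q. \<forall>i < length us. ?g (R, us) i \<subseteq> dbdom D"
    proof clarify
      fix R us i c assume "(R, us) \<in> ratoms q" and c: "c \<in> ?g (R, us) i"
      then have "F (R, us) \<in> D" using FD by blast
      then show "c \<in> dbdom D"
        using c induced_arg_subset[OF _ E] by blast
    qed
    show "\<forall>a. Con a \<in> cq_terms q \<longrightarrow> ?h (Con a) = {a}"
      using C by (auto simp: trm_set_def)
    show "\<forall>z. Var z \<in> cq_terms q \<longrightarrow> ?h (Var z) = {c \<in> dbdom D.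
             \<forall>(R, us) \<in> ratoms q. \<forall>i < length us. us ! i = Var z \<longrightarrow> c \<in> ?g (R, us) i}"
      by (force simp: trm_set_def)
    show "\<forall>(R, us) \<in> ratoms q. (R, map (?g (R, us)) [0..<length us]) \<in> induced S D E V
         \<and> (\<forall>i < length us. \<forall>a. us ! i = Con a \<longrightarrow> a \<in> ?g (R, us) i)"
    proof (clarify, intro conjI allI impI)
      fix R us assume us: "(R, us) \<in> ratoms q"
      obtain t cs where t: "F (R, us) = (R, t, cs)" using FD[OF us] by (metis fst_conv prod.collapse)
      show "(R, map (?g (R, us)) [0..<length us]) \<in> induced S D E V"
        using FD[OF us] t unfolding induced_def by auto
      fix i a assume i: "i < length us" "us ! i = Con a"
      then have "Con a \<in> cq_terms q" using at[OF us] by (metis nth_mem)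
      then show "a \<in> ?g (R, us) i"
        using C[of a] i us by (force simp: trm_set_def)
    qed
  qed (use F[THEN conjunct2] in simp_all)
qed

lemma mem_cq_terms:
  "\<pi> \<in> ratoms q \<Longrightarrow> i < length (snd \<pi>) \<Longrightarrow> snd \<pi> ! i \<in> cq_terms q"
  "(p, u, u') \<in> sims q \<Longrightarrow> u \<in> cq_terms q"
  "(p, u, u') \<in> sims q \<Longrightarrow> u' \<in> cq_terms q"
  by (force simp: cq_terms_def)+

text \<open>The substitution can identify relational atoms. This is harmless without inequalities, since
  dropping the duplicates only enlarges the sets assigned to variables.\<close>

lemma answers_iff:
  assumes E: "E \<subseteq> objs D \<times> objs D" and q: "ineqs q = {}"
    and xy: "Var x \<in> cq_terms q" "Var y \<in> cq_terms q"
  shows "(c, c') \<in> answers S sim D E V q x y \<longleftrightarrow> (\<exists>F w. fact_assignment D q F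
    \<and> (\<forall>u \<in> cq_terms q. w u \<in> trm_set S D E V q F u) \<and> w (Var x) = c \<and> w (Var y) = c'
    \<and> (\<forall>(p, u, u') \<in> sims q.
         \<exists>d \<in> trm_set S D E V q F u. \<exists>d' \<in> trm_set S D E V q F u'. (d, d') \<in> sim p
           \<and> (u \<in> {Var x, Var y} \<longrightarrow> d = w u) \<and> (u' \<in> {Var x, Var y} \<longrightarrow> d' = w u')))"
    (is "_ \<longleftrightarrow> (\<exists>F w. ?P F w)")
proof -
  define \<sigma> where "\<sigma> = subst_trm (Var(x := Con c, y := Con c'))"
  define \<tau> where "\<tau> = (\<lambda>\<pi> :: (('a, 'b, 'c) cst, 'd) ratom. (fst \<pi>, map \<sigma> (snd \<pi>)))"
  let ?q = "subst_cq (Var(x := Con c, y := Con c')) q"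
  have ra: "ratoms ?q = \<tau> ` ratoms q"
    by (simp add: subst_cq_def \<tau>_def \<sigma>_def case_prod_unfold)
  have si: "sims ?q = (\<lambda>(p, u, u'). (p, \<sigma> u, \<sigma> u')) ` sims q"
    by (simp add: subst_cq_def \<sigma>_def)
  have iq: "ineqs ?q = {}" by (simp add: subst_cq_def q)
  have te: "cq_terms ?q = \<sigma> ` cq_terms q"
    unfolding cq_terms_def iq ra si q by (force simp: \<tau>_def)
  have \<sigma>V: "\<sigma> u = Var z \<longleftrightarrow> u = Var z \<and> z \<noteq> x \<and> z \<noteq> y" for u z
    by (cases u) (auto simp: \<sigma>_def)
  \<comment> \<open>The update at \<open>y\<close> wins when \<open>x = y\<close>, hence the
    asymmetry between \<open>x\<close> and \<open>y\<close>.\<close>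
  have \<sigma>C: "\<sigma> u = Con a \<longleftrightarrow> u = Con a \<or> (u = Var y \<and> a = c') \<or> (u = Var x \<and> x \<noteq> y \<and> a = c)" for u a
    by (cases u) (auto simp: \<sigma>_def)
  show ?thesis
  proof
    assume "(c, c') \<in> answers S sim D E V q x y"
    then have xyc: "x = y \<longrightarrow> c = c'" and "sat S sim D E V ?q" by (auto simp: answers_def)
    then obtain F where F: "fact_assignment D ?q F"
      "\<And>u. u \<in> cq_terms ?q \<Longrightarrow> trm_set S D E V ?q F u \<noteq> {}"
      "\<forall>(p, u, u') \<in> sims ?q.
         \<exists>c \<in> trm_set S D E V ?q F u. \<exists>c' \<in> trm_set S D E V ?q F u'. (c, c') \<in> sim p"
      unfolding sat_iff[OF E] by blast
    define w where "w u = (SOME c. c \<in> trm_set S D E V ?q F (\<sigma> u))" for u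
    have w: "w u \<in> trm_set S D E V ?q F (\<sigma> u)" if "u \<in> cq_terms q" for u
      unfolding w_def by (rule someI_ex) (use F(2)[of "\<sigma> u"] that te in blast)
    \<comment> \<open>An atom of \<open>q\<close> inherits the fact of its image, and every
      occurrence of \<open>u\<close> in \<open>q\<close> becomes an occurrence of
      \<open>\<sigma> u\<close>; the substituted query thus imposes at least as many
      conditions.\<close>
    have sub: "trm_set S D E V ?q F (\<sigma> u) \<subseteq> trm_set S D E V q (F \<circ> \<tau>) u" for u
      unfolding trm_set_def ra by (force simp: \<tau>_def \<sigma>C)
    \<comment> \<open>After substitution an answer variable is a constant, whose set has at most one
      element, so similarity atoms can only use the reported value.\<close>
    have ans: "d = w u" if "d \<in> trm_set S D E V ?q F (\<sigma> u)" "u \<in> {Var x, Var y}" for d u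
    proof -
      obtain a where "\<sigma> u = Con a" using \<open>u \<in> _\<close> \<sigma>C by blast
      moreover have "u \<in> cq_terms q" using that xy by blast
      ultimately show ?thesis using that(1) w[of u] by (auto simp: trm_set_def)
    qed
    have "\<sigma> (Var x) = Con c" "\<sigma> (Var y) = Con c'" using xyc \<sigma>C by auto
    then have "w (Var x) = c" "w (Var y) = c'"
      using w[OF xy(1)] w[OF xy(2)] by (auto simp: trm_set_def)
    moreover have "fact_assignment D q (F \<circ> \<tau>)"
      using F(1) unfolding fact_assignment_def ra by (auto simp: \<tau>_def)
    moreover have "\<exists>d \<in> trm_set S D E V q (F \<circ> \<tau>) u. \<exists>d' \<in> trm_set S D E V q (F \<circ> \<tau>) u'.
        (d, d') \<in> sim p \<and> (u \<in> {Var x, Var y} \<longrightarrow> d = w u) \<and> (u' \<in> {Var x, Var y} \<longrightarrow> d' = w u')"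
      if s: "(p, u, u') \<in> sims q" for p u u'
    proof -
      have "(p, \<sigma> u, \<sigma> u') \<in> sims ?q" using s by (force simp: si)
      then obtain d d' where "d \<in> trm_set S D E V ?q F (\<sigma> u)" "d' \<in> trm_set S D E V ?q F (\<sigma> u')"
        "(d, d') \<in> sim p" using F(3) by blast
      then show ?thesis using sub ans by blast
    qed
    ultimately have "?P (F \<circ> \<tau>) w" using w sub by blast
    then show "\<exists>F w. ?P F w" by blast
  next
    assume "\<exists>F w. ?P F w"
    then obtain F w where FA: "fact_assignment D q F"
      and W: "(\<forall>u \<in> cq_terms q. w u \<in> trm_set S D E V q F u) \<and> w (Var x) = c \<and> w (Var y) = c'
    \<and> (\<forall>(p, u, u') \<in> sims q.
         \<exists>d \<in> trm_set S D E V q F u. \<exists>d' \<in> trm_set S D E V q F u'. (d, d') \<in> sim p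
           \<and> (u \<in> {Var x, Var y} \<longrightarrow> d = w u) \<and> (u' \<in> {Var x, Var y} \<longrightarrow> d' = w u'))"
      by (elim exE conjE[of "fact_assignment _ _ _"]) (rule that)
    have w: "w u \<in> trm_set S D E V q F u" if "u \<in> cq_terms q" for u using W that by blast
    have wx: "w (Var x) = c" "w (Var y) = c'" using W by simp_all
    have Z: "\<exists>d \<in> trm_set S D E V q F u. \<exists>d' \<in> trm_set S D E V q F u'. (d, d') \<in> sim p
           \<and> (u \<in> {Var x, Var y} \<longrightarrow> d = w u) \<and> (u' \<in> {Var x, Var y} \<longrightarrow> d' = w u')"
      if "(p, u, u') \<in> sims q" for p u u'
      using bspec[OF W[THEN conjunct2, THEN conjunct2, THEN conjunct2] that] by simp
    \<comment> \<open>Atoms of \<open>q\<close> identified by the substitution may carry different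
      facts under \<open>F\<close>; \<open>\<kappa>\<close> keeps one of these atoms.\<close>
    define \<kappa> where "\<kappa> = inv_into (ratoms q) \<tau>"
    have \<kappa>: "\<kappa> \<pi> \<in> ratoms q" "\<tau> (\<kappa> \<pi>) = \<pi>" if "\<pi> \<in> ratoms ?q" for \<pi>
      using that unfolding ra \<kappa>_def by (auto intro: inv_into_into f_inv_into_f)
    \<comment> \<open>A position holding \<open>\<sigma> u\<close> came either from \<open>u\<close>
      itself or, if \<open>\<sigma> u\<close> is a constant, from a possibly different term with the
      same image; the witness of that term is then the same constant \<open>d\<close>.\<close>
    have L: "d \<in> trm_set S D E V ?q (F \<circ> \<kappa>) (\<sigma> u)"
      if u: "u \<in> cq_terms q" and d: "d \<in> trm_set S D E V q F u" "u \<in> {Var x, Var y} \<longrightarrow> d = w u"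
      for d u
    proof -
      have const: "d = a" if "\<sigma> u = Con a" for a
        using that d wx \<sigma>C[of u a] by (auto simp: trm_set_def)
      have "d \<in> induced_arg S D E V (F (\<kappa> \<pi>)) i"
        if \<pi>: "\<pi> \<in> ratoms ?q" and i: "i < length (snd \<pi>)" "snd \<pi> ! i = \<sigma> u" for \<pi> i
      proof -
        have snd: "snd \<pi> = map \<sigma> (snd (\<kappa> \<pi>))"
          using \<kappa>(2)[OF \<pi>] unfolding \<tau>_def by (metis snd_conv)
        let ?v = "snd (\<kappa> \<pi>) ! i"
        have i': "i < length (snd (\<kappa> \<pi>))" "\<sigma> ?v = \<sigma> u" using i snd by auto
        have v: "?v \<in> cq_terms q" using mem_cq_terms(1)[OF \<kappa>(1)[OF \<pi>] i'(1)] .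
        show ?thesis
        proof (cases "\<sigma> u")
          case (Var z)
          then have "?v = u" using i'(2) \<sigma>V by metis
          then show ?thesis using d(1) \<kappa>(1)[OF \<pi>] i'(1) by (auto simp: trm_set_def)
        next
          case (Con a)
          then have "w ?v = d"
            using const[OF Con] w[OF v] wx i'(2) \<sigma>C[of ?v a] by (auto simp: trm_set_def)
          then show ?thesis using w[OF v] \<kappa>(1)[OF \<pi>] i'(1) by (auto simp: trm_set_def)
        qed
      qed
      then show ?thesis using const d(1) by (auto simp: trm_set_def)
    qed
    have "fact_assignment D ?q (F \<circ> \<kappa>)"
      unfolding fact_assignment_def
    proof
      fix \<pi> assume \<pi>: "\<pi> \<in> ratoms ?q"
      have "fst \<pi> = fst (\<kappa> \<pi>)" "length (snd \<pi>) = length (snd (\<kappa> \<pi>))"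
        using \<kappa>(2)[OF \<pi>] unfolding \<tau>_def by (metis fst_conv, metis snd_conv length_map)
      then show "(F \<circ> \<kappa>) \<pi> \<in> D \<and> fst ((F \<circ> \<kappa>) \<pi>) = fst \<pi>
          \<and> length (snd \<pi>) = Suc (length (snd (snd ((F \<circ> \<kappa>) \<pi>))))"
        using FA \<kappa>(1)[OF \<pi>] by (auto simp: fact_assignment_def)
    qed
    moreover have "trm_set S D E V ?q (F \<circ> \<kappa>) u \<noteq> {}" if "u \<in> cq_terms ?q" for u
      using that L w unfolding te by blast
    moreover have "\<exists>d \<in> trm_set S D E V ?q (F \<circ> \<kappa>) u. \<exists>d' \<in> trm_set S D E V ?q (F \<circ> \<kappa>) u'.
        (d, d') \<in> sim p" if s: "(p, u, u') \<in> sims ?q" for p u u'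
    proof -
      obtain v v' where v: "(p, v, v') \<in> sims q" "u = \<sigma> v" "u' = \<sigma> v'"
        using s unfolding si by auto
      then show ?thesis
        using Z[OF v(1)] L mem_cq_terms(2,3)[OF v(1)] by blast
    qed
    ultimately have "sat S sim D E V ?q"
      unfolding sat_iff[OF E] iq by blast
    then show "(c, c') \<in> answers S sim D E V q x y"
      using wx by (auto simp: answers_def)
  qed
qed

section \<open>The atoms describing an induced database\<close>

text \<open>In the intended models \<open>DomP\<close> is the set of database constants,
  \<open>SameP\<close> is equality on it (clauses have no built-in equality), \<open>AtP\<close>
  with arguments t, i, c gives the stored content c of position i of fact t, and \<open>InP\<close>
  says that c is in the i-th argument set of that fact in the induced database.
  \<open>MeetP k\<close> belongs to the k-th inequality; the offset 9 keeps these symbols apart from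
  the fixed ones.\<close>

abbreviation "DomP \<equiv> Aux 2"
abbreviation "InP \<equiv> Aux 3"
abbreviation "SameP \<equiv> Aux 4"
abbreviation "NeqO \<equiv> Aux 5"
abbreviation "NeqV \<equiv> Aux 6"
abbreviation "FailP \<equiv> Aux 7"
abbreviation "AtP \<equiv> Aux 8"
abbreviation "MeetP k \<equiv> Aux (k + 9)"

definition fact_arg :: "('o, 'v, 't, 'r) fact \<Rightarrow> nat \<Rightarrow> ('o, 'v, 't) cst" where
  "fact_arg f i = (Tid (fst (snd f)) # snd (snd f)) ! i"

text \<open>The part of the intended model that \<open>E\<close> and \<open>V\<close> determine
  positively. \<open>InP\<close> is indexed by the tid instead of the whole fact, which is faithful
  only because tids are unique in a database.\<close>

definition induced_atoms ::
  "'r schema \<Rightarrow> ('s \<Rightarrow> ('o, 'v, 't) cst rel) \<Rightarrow> ('o, 'v, 't, 'r) fact set \<Rightarrow>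
   ('o, 'v, 't) cst rel \<Rightarrow> 't cell rel \<Rightarrow> (('r, 's) pred, ('o, 'v, 't) pcst) gatm set" where
  "induced_atoms S sim D E V = input_facts sim D
     \<union> {(DomP, [Cst c]) | c. c \<in> dbdom D}
     \<union> {(SameP, [Cst c, Cst c]) | c. c \<in> dbdom D}
     \<union> {(AtP, [Cst (fact_arg f 0), Pos i, Cst (fact_arg f i)]) | f i.
          f \<in> D \<and> i \<le> length (snd (snd f))}
     \<union> {(InP, [Cst (fact_arg f 0), Pos i, Cst c]) | f i c.
          f \<in> D \<and> i \<le> length (snd (snd f)) \<and> c \<in> induced_arg S D E V f i}
     \<union> {(EqO, [Cst a, Cst b]) | a b. (a, b) \<in> E}
     \<union> {(EqV, [Cst (Tid t), Pos i, Cst (Tid t'), Pos j]) | t i t' j. ((t, i), (t', j)) \<in> V}"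

lemma induced_atoms_iff:
  fixes D :: "('o, 'v, 't, 'r) fact set"
  shows "(RelP R, xs) \<in> induced_atoms S sim D E V \<longleftrightarrow>
     (\<exists>f \<in> D. fst f = R \<and> xs = map (\<lambda>i. Cst (fact_arg f i)) [0..<Suc (length (snd (snd f)))])"
  "(SimP p, xs) \<in> induced_atoms S sim D E V \<longleftrightarrow> (\<exists>c c'. xs = [Cst c, Cst c'] \<and> (c, c') \<in> sim p)"
  "(DomP, xs) \<in> induced_atoms S sim D E V \<longleftrightarrow> (\<exists>c. xs = [Cst c] \<and> c \<in> dbdom D)"
  "(SameP, xs) \<in> induced_atoms S sim D E V \<longleftrightarrow> (\<exists>c. xs = [Cst c, Cst c] \<and> c \<in> dbdom D)"
  "(AtP, xs) \<in> induced_atoms S sim D E V \<longleftrightarrow>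
     (\<exists>f i. xs = [Cst (fact_arg f 0), Pos i, Cst (fact_arg f i)] \<and> f \<in> D \<and> i \<le> length (snd (snd f)))"
  "(InP, xs) \<in> induced_atoms S sim D E V \<longleftrightarrow>
     (\<exists>f i c. xs = [Cst (fact_arg f 0), Pos i, Cst c] \<and> f \<in> D \<and> i \<le> length (snd (snd f))
        \<and> c \<in> induced_arg S D E V f i)"
  "(EqO, xs) \<in> induced_atoms S sim D E V \<longleftrightarrow> (\<exists>a b. xs = [Cst a, Cst b] \<and> (a, b) \<in> E)"
  "(EqV, xs) \<in> induced_atoms S sim D E V \<longleftrightarrow>
     (\<exists>t i t' j. xs = [Cst (Tid t), Pos i, Cst (Tid t'), Pos j] \<and> ((t, i), (t', j)) \<in> V)"
proof -
  have *: "map (\<lambda>i. Cst (fact_arg (R, t, cs) i)) [0..<Suc (length cs)] = map Cst (Tid t # cs)"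
    for t :: 't and cs :: "('o, 'v, 't) cst list"
    by (rule nth_equalityI) (auto simp: fact_arg_def simp del: upt_Suc list.map)
  have "(RelP R, xs) \<in> induced_atoms S sim D E V \<longleftrightarrow>
     (\<exists>t cs. (R, t, cs) \<in> D \<and> xs = map Cst (Tid t # cs))"
    by (auto simp: induced_atoms_def input_facts_def)
  also have "\<dots> \<longleftrightarrow> (\<exists>f \<in> D. fst f = R \<and>
      xs = map (\<lambda>i. Cst (fact_arg f i)) [0..<Suc (length (snd (snd f)))])"
    by (simp add: * Bex_def split_paired_Ex del: upt_Suc list.map)
  finally show "(RelP R, xs) \<in> induced_atoms S sim D E V \<longleftrightarrow>
     (\<exists>f \<in> D. fst f = R \<and> xs = map (\<lambda>i. Cst (fact_arg f i)) [0..<Suc (length (snd (snd f)))])" .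
qed (simp_all add: induced_atoms_def input_facts_def conj_commute)

section \<open>Query bodies as sets of literals\<close>

text \<open>The literals are parametrised by the interpretation \<open>f\<close> of the variables and \<open>k\<close> of the
  constants, so that the same definitions yield rule bodies and their ground instances. A similarity
  atom gets witnesses of its own, because the witnesses chosen for different similarity atoms with
  a common variable need not agree.\<close>

datatype ('c, 'r, 's) role =
  Arg "('c, 'r) ratom" nat
| Wit "'c trm"
| SimL "'s \<times> 'c trm \<times> 'c trm"
| SimR "'s \<times> 'c trm \<times> 'c trm"
| Common

text \<open>Each position has its own variable, whatever term the query has there: these literals
  only select facts. Equality of stored constants would be too strong for a join, and a constant of
  the query need only belong to the argument set.\<close>

definition rel_lits ::
  "(('c, 'r, 's) role \<Rightarrow> 'x) \<Rightarrow> ('c, 'r, 's) cq \<Rightarrow> (('r, 's) pred \<times> 'x list) set" where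
  "rel_lits f q =
     (\<lambda>\<pi>. (RelP (fst \<pi>), map (\<lambda>i. f (Arg \<pi> i)) [0..<length (snd \<pi>)])) ` ratoms q"

text \<open>Says that the constant assigned to role \<open>r\<close> lies in the set of the term
  \<open>u\<close>, for the facts selected by the \<open>Arg\<close> roles. \<open>DomP\<close> is
  present for every term, also for one without relational occurrence.\<close>

definition wit_lits ::
  "((('o, 'v, 't) cst, 'r, 's) role \<Rightarrow> 'x) \<Rightarrow> (('o, 'v, 't) pcst \<Rightarrow> 'x) \<Rightarrow>
   (('o, 'v, 't) cst, 'r, 's) cq \<Rightarrow> ('o, 'v, 't) cst trm \<Rightarrow> (('o, 'v, 't) cst, 'r, 's) role \<Rightarrow>
   (('r, 's) pred \<times> 'x list) set" where
  "wit_lits f k q u r = {(DomP, [f r])}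
     \<union> (\<lambda>(\<pi>, i). (InP, [f (Arg \<pi> 0), k (Pos i), f r])) `
          {(\<pi>, i). \<pi> \<in> ratoms q \<and> i < length (snd \<pi>) \<and> snd \<pi> ! i = u}
     \<union> (\<lambda>a. (SameP, [f r, k (Cst a)])) ` {a. u = Con a}"

text \<open>\<open>A\<close> collects the answer variables: where one of them occurs in the
  similarity atom, its local witness is forced to equal its \<open>Wit\<close> role, which the head
  reports. Other terms keep one witness per similarity atom.\<close>

definition sim_lits ::
  "((('o, 'v, 't) cst, 'r, 's) role \<Rightarrow> 'x) \<Rightarrow> (('o, 'v, 't) pcst \<Rightarrow> 'x) \<Rightarrow>
   (('o, 'v, 't) cst, 'r, 's) cq \<Rightarrow> ('o, 'v, 't) cst trm set \<Rightarrow>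
   's \<times> ('o, 'v, 't) cst trm \<times> ('o, 'v, 't) cst trm \<Rightarrow> (('r, 's) pred \<times> 'x list) set" where
  "sim_lits f k q A s = wit_lits f k q (fst (snd s)) (SimL s) \<union> wit_lits f k q (snd (snd s)) (SimR s)
     \<union> {(SimP (fst s), [f (SimL s), f (SimR s)])}
     \<union> {a. a = (SameP, [f (SimL s), f (Wit (fst (snd s)))]) \<and> fst (snd s) \<in> A}
     \<union> {a. a = (SameP, [f (SimR s), f (Wit (snd (snd s)))]) \<and> snd (snd s) \<in> A}"

definition body_lits ::
  "((('o, 'v, 't) cst, 'r, 's) role \<Rightarrow> 'x) \<Rightarrow> (('o, 'v, 't) pcst \<Rightarrow> 'x) \<Rightarrow>
   (('o, 'v, 't) cst, 'r, 's) cq \<Rightarrow> ('o, 'v, 't) cst trm set \<Rightarrow>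
   (('r, 's) pred \<times> 'x list) set" where
  "body_lits f k q A = rel_lits f q \<union> (\<Union>u \<in> cq_terms q. wit_lits f k q u (Wit u))
     \<union> (\<Union>s \<in> sims q. sim_lits f k q A s)"

definition meet_lits ::
  "((('o, 'v, 't) cst, 'r, 's) role \<Rightarrow> 'x) \<Rightarrow> (('o, 'v, 't) pcst \<Rightarrow> 'x) \<Rightarrow>
   (('o, 'v, 't) cst, 'r, 's) cq \<Rightarrow> ('o, 'v, 't) cst trm \<times> ('o, 'v, 't) cst trm \<Rightarrow>
   (('r, 's) pred \<times> 'x list) set" where
  "meet_lits f k q \<iota> =
     rel_lits f q \<union> wit_lits f k q (fst \<iota>) Common \<union> wit_lits f k q (snd \<iota>) Common"

text \<open>Clause bodies and argument tuples are lists while queries consist of sets. Any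
  enumeration serves, provided that \<open>MeetP\<close> atoms are built with the same one where
  they are derived and where they are negated.\<close>

definition enum :: "'a set \<Rightarrow> 'a list" where
  "enum A = (SOME xs. set xs = A)"

lemma set_enum: "finite A \<Longrightarrow> set (enum A) = A"
  unfolding enum_def by (rule someI_ex) (rule finite_list)

definition tid_args :: "(('c, 'r, 's) role \<Rightarrow> 'x) \<Rightarrow> ('c, 'r, 's) cq \<Rightarrow> 'x list" where
  "tid_args f q = map (\<lambda>\<pi>. f (Arg \<pi> 0)) (enum (ratoms q))"

lemma ground_rel_lits: "ground_atm \<theta> ` rel_lits f q = rel_lits (ground_trm \<theta> \<circ> f) q"
  by (simp add: rel_lits_def ground_atm_def image_image comp_def)

lemma ground_wit_lits:
  "ground_atm \<theta> ` wit_lits f k q u r = wit_lits (ground_trm \<theta> \<circ> f) (ground_trm \<theta> \<circ> k) q u r"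
  unfolding wit_lits_def by (simp add: image_Un image_image ground_atm_def case_prod_unfold)

lemma ground_sim_lits:
  "ground_atm \<theta> ` sim_lits f k q A s = sim_lits (ground_trm \<theta> \<circ> f) (ground_trm \<theta> \<circ> k) q A s"
  unfolding sim_lits_def image_Un ground_wit_lits by (auto simp: ground_atm_def)

lemma ground_body_lits:
  "ground_atm \<theta> ` body_lits f k q A = body_lits (ground_trm \<theta> \<circ> f) (ground_trm \<theta> \<circ> k) q A"
  unfolding body_lits_def image_Un image_UN ground_wit_lits ground_sim_lits ground_rel_lits ..

lemma ground_meet_lits:
  "ground_atm \<theta> ` meet_lits f k q \<iota> = meet_lits (ground_trm \<theta> \<circ> f) (ground_trm \<theta> \<circ> k) q \<iota>"
  unfolding meet_lits_def image_Un image_UN ground_wit_lits ground_rel_lits ..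

definition args_of ::
  "((('o, 'v, 't) cst, 'r, 's) role \<Rightarrow> ('o, 'v, 't) pcst) \<Rightarrow> (('o, 'v, 't) cst, 'r, 's) cq \<Rightarrow>
   ((('o, 'v, 't) cst, 'r) ratom \<Rightarrow> ('o, 'v, 't, 'r) fact) \<Rightarrow> bool" where
  "args_of \<rho> q F \<longleftrightarrow> (\<forall>\<pi> \<in> ratoms q. \<forall>i < length (snd \<pi>). \<rho> (Arg \<pi> i) = Cst (fact_arg (F \<pi>) i))"

lemma rel_lits_iff:
  "rel_lits \<rho> q \<subseteq> induced_atoms S sim D E V \<longleftrightarrow> (\<exists>F. fact_assignment D q F \<and> args_of \<rho> q F)"
proof -
  have eq: "map (\<lambda>i. \<rho> (Arg \<pi> i)) [0..<m] = map (\<lambda>i. Cst (fact_arg f i)) [0..<n]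
      \<longleftrightarrow> m = n \<and> (\<forall>i < m. \<rho> (Arg \<pi> i) = Cst (fact_arg f i))" for \<pi> m n f
    by (auto simp: list_eq_iff_nth_eq)
  have "rel_lits \<rho> q \<subseteq> induced_atoms S sim D E V \<longleftrightarrow>
     (\<forall>\<pi> \<in> ratoms q. \<exists>f. f \<in> D \<and> fst f = fst \<pi> \<and> length (snd \<pi>) = Suc (length (snd (snd f)))
        \<and> (\<forall>i < length (snd \<pi>). \<rho> (Arg \<pi> i) = Cst (fact_arg f i)))"
    unfolding rel_lits_def image_subset_iff induced_atoms_iff(1) eq by (simp only: Bex_def)
  also have "\<dots> \<longleftrightarrow> (\<exists>F. fact_assignment D q F \<and> args_of \<rho> q F)"
    unfolding bchoice_iff fact_assignment_def args_of_def by (simp add: ball_conj_distrib conj_ac)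
  finally show ?thesis .
qed

lemma database_fact_eqI:
  assumes "database S D" "f \<in> D" "f' \<in> D" "fact_arg f 0 = fact_arg f' 0"
  shows "f = f'"
proof -
  obtain R t cs R' t' cs' where f: "f = (R, t, cs)" "f' = (R', t', cs')"
    by (cases f, cases f')
  show ?thesis using assms unfolding f database_def by (auto simp: fact_arg_def)
qed

text \<open>By uniqueness of tids, an \<open>InP\<close> atom carrying the tid of
  \<open>F \<pi>\<close> speaks about the fact \<open>F \<pi>\<close> and no other, so the literals
  amount to the membership conditions in \<open>trm_set\<close>.\<close>

lemma wit_lits_iff:
  assumes D: "database S D" and q: "wf_cq S q" and F: "fact_assignment D q F" "args_of \<rho> q F"
  shows "wit_lits \<rho> (\<lambda>x. x) q u r \<subseteq> induced_atoms S sim D E V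
    \<longleftrightarrow> (\<exists>c \<in> trm_set S D E V q F u. \<rho> r = Cst c)"
proof -
  have FD: "F \<pi> \<in> D" "length (snd \<pi>) = Suc (length (snd (snd (F \<pi>))))"
    "\<rho> (Arg \<pi> 0) = Cst (fact_arg (F \<pi>) 0)" if "\<pi> \<in> ratoms q" for \<pi>
    using F that by (simp_all add: fact_assignment_def args_of_def)
  have In: "(InP, [\<rho> (Arg \<pi> 0), Pos i, Cst c]) \<in> induced_atoms S sim D E V
      \<longleftrightarrow> c \<in> induced_arg S D E V (F \<pi>) i"
    if \<pi>: "\<pi> \<in> ratoms q" and i: "i < length (snd \<pi>)" for \<pi> i c
  proof
    assume "(InP, [\<rho> (Arg \<pi> 0), Pos i, Cst c]) \<in> induced_atoms S sim D E V"
    then obtain f where "f \<in> D" "fact_arg (F \<pi>) 0 = fact_arg f 0" "c \<in> induced_arg S D E V f i"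
      unfolding induced_atoms_iff FD(3)[OF \<pi>] by blast
    then show "c \<in> induced_arg S D E V (F \<pi>) i"
      using database_fact_eqI[OF D FD(1)[OF \<pi>]] by blast
  next
    assume "c \<in> induced_arg S D E V (F \<pi>) i"
    then show "(InP, [\<rho> (Arg \<pi> 0), Pos i, Cst c]) \<in> induced_atoms S sim D E V"
      unfolding induced_atoms_iff FD(3)[OF \<pi>] using FD[OF \<pi>] i
      by (intro exI[of _ "F \<pi>"] exI[of _ i] exI[of _ c]) simp
  qed
  have "wit_lits \<rho> (\<lambda>x. x) q u r \<subseteq> induced_atoms S sim D E V \<longleftrightarrow>
     (\<exists>c \<in> dbdom D. \<rho> r = Cst c \<and> (\<forall>a. u = Con a \<longrightarrow> c = a)
       \<and> (\<forall>\<pi> \<in> ratoms q. \<forall>i < length (snd \<pi>). snd \<pi> ! i = u \<longrightarrow>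
          (InP, [\<rho> (Arg \<pi> 0), Pos i, Cst c]) \<in> induced_atoms S sim D E V))" (is "?l \<longleftrightarrow> ?r")
  proof
    assume l: ?l
    then have "(DomP, [\<rho> r]) \<in> induced_atoms S sim D E V" by (auto simp: wit_lits_def)
    then obtain c where c: "c \<in> dbdom D" "\<rho> r = Cst c" by (auto simp: induced_atoms_iff)
    have "c = a" if "u = Con a" for a
    proof -
      have "(SameP, [\<rho> r, Cst a]) \<in> induced_atoms S sim D E V"
        using l that by (auto simp: wit_lits_def)
      then show ?thesis using c by (auto simp: induced_atoms_iff)
    qed
    moreover have "(InP, [\<rho> (Arg \<pi> 0), Pos i, Cst c]) \<in> induced_atoms S sim D E V"
      if "\<pi> \<in> ratoms q" "i < length (snd \<pi>)" "snd \<pi> ! i = u" for \<pi> i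
      using l that c unfolding wit_lits_def by fastforce
    ultimately show ?r using c by blast
  next
    assume ?r
    then show ?l unfolding wit_lits_def by (auto simp: induced_atoms_iff(3,4))
  qed
  also have "\<dots> \<longleftrightarrow> (\<exists>c \<in> trm_set S D E V q F u. \<rho> r = Cst c)"
    using In unfolding trm_set_def by (simp add: Bex_def conj_ac cong: conj_cong)
  finally show ?thesis .
qed

lemma sim_lits_iff:
  assumes "database S D" "wf_cq S q" "fact_assignment D q F" "args_of \<rho> q F"
  shows "sim_lits \<rho> (\<lambda>x. x) q A (p, u, u') \<subseteq> induced_atoms S sim D E V \<longleftrightarrow>
    (\<exists>d \<in> trm_set S D E V q F u. \<exists>d' \<in> trm_set S D E V q F u'. (d, d') \<in> sim p
       \<and> \<rho> (SimL (p, u, u')) = Cst d \<and> \<rho> (SimR (p, u, u')) = Cst d'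
       \<and> (u \<in> A \<longrightarrow> \<rho> (Wit u) = Cst d) \<and> (u' \<in> A \<longrightarrow> \<rho> (Wit u') = Cst d'))" (is "?l \<longleftrightarrow> ?r")
proof
  assume l: ?l
  then have "wit_lits \<rho> (\<lambda>x. x) q u (SimL (p, u, u')) \<subseteq> induced_atoms S sim D E V"
    "wit_lits \<rho> (\<lambda>x. x) q u' (SimR (p, u, u')) \<subseteq> induced_atoms S sim D E V"
    by (simp_all add: sim_lits_def)
  then obtain d d' where d: "d \<in> trm_set S D E V q F u" "\<rho> (SimL (p, u, u')) = Cst d"
    "d' \<in> trm_set S D E V q F u'" "\<rho> (SimR (p, u, u')) = Cst d'"
    unfolding wit_lits_iff[OF assms] by blast
  moreover have "(d, d') \<in> sim p" using l d by (simp add: sim_lits_def induced_atoms_iff)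
  moreover have "u \<in> A \<longrightarrow> \<rho> (Wit u) = Cst d" "u' \<in> A \<longrightarrow> \<rho> (Wit u') = Cst d'"
    using l d by (auto simp: sim_lits_def induced_atoms_iff)
  ultimately show ?r by blast
next
  assume ?r
  then obtain d d' where d: "d \<in> trm_set S D E V q F u" "d' \<in> trm_set S D E V q F u'"
    "(d, d') \<in> sim p" "\<rho> (SimL (p, u, u')) = Cst d" "\<rho> (SimR (p, u, u')) = Cst d'"
    "u \<in> A \<longrightarrow> \<rho> (Wit u) = Cst d" "u' \<in> A \<longrightarrow> \<rho> (Wit u') = Cst d'" by blast
  then have "wit_lits \<rho> (\<lambda>x. x) q u (SimL (p, u, u')) \<subseteq> induced_atoms S sim D E V"
    "wit_lits \<rho> (\<lambda>x. x) q u' (SimR (p, u, u')) \<subseteq> induced_atoms S sim D E V"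
    unfolding wit_lits_iff[OF assms] by blast+
  moreover have "d \<in> dbdom D" "d' \<in> dbdom D" using d(1,2) by (auto simp: trm_set_def)
  ultimately show ?l using d unfolding sim_lits_def
    by (auto simp: induced_atoms_iff)
qed

lemma body_lits_iff:
  assumes "database S D" "wf_cq S q" "fact_assignment D q F" "args_of \<rho> q F"
  shows "body_lits \<rho> (\<lambda>x. x) q A \<subseteq> induced_atoms S sim D E V \<longleftrightarrow>
    (\<forall>u \<in> cq_terms q. \<exists>c \<in> trm_set S D E V q F u. \<rho> (Wit u) = Cst c) \<and>
    (\<forall>(p, u, u') \<in> sims q.
     \<exists>d \<in> trm_set S D E V q F u. \<exists>d' \<in> trm_set S D E V q F u'. (d, d') \<in> sim p
       \<and> \<rho> (SimL (p, u, u')) = Cst d \<and> \<rho> (SimR (p, u, u')) = Cst d'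
       \<and> (u \<in> A \<longrightarrow> \<rho> (Wit u) = Cst d) \<and> (u' \<in> A \<longrightarrow> \<rho> (Wit u') = Cst d'))"
proof -
  have "rel_lits \<rho> q \<subseteq> induced_atoms S sim D E V"
    using assms(3,4) rel_lits_iff by blast
  moreover have "sim_lits \<rho> (\<lambda>x. x) q A s \<subseteq> induced_atoms S sim D E V \<longleftrightarrow> (case s of (p, u, u') \<Rightarrow>
     \<exists>d \<in> trm_set S D E V q F u. \<exists>d' \<in> trm_set S D E V q F u'. (d, d') \<in> sim p
       \<and> \<rho> (SimL (p, u, u')) = Cst d \<and> \<rho> (SimR (p, u, u')) = Cst d'
       \<and> (u \<in> A \<longrightarrow> \<rho> (Wit u) = Cst d) \<and> (u' \<in> A \<longrightarrow> \<rho> (Wit u') = Cst d'))" for s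
    by (cases s) (simp only: prod.case sim_lits_iff[OF assms])
  ultimately show ?thesis
    unfolding body_lits_def Un_subset_iff UN_subset_iff wit_lits_iff[OF assms] by simp
qed

text \<open>Soundness of compiled bodies. The choice of facts is read off the relational literals,
  and the \<open>SameP\<close> literals make similarity witnesses of answer variables agree with the
  \<open>Wit\<close> roles.\<close>

lemma body_lits_answers:
  assumes D: "database S D" and E: "E \<subseteq> objs D \<times> objs D" and q: "wf_cq S q" "ineqs q = {}"
    and xy: "Var x \<in> cq_terms q" "Var y \<in> cq_terms q"
    and body: "body_lits \<rho> (\<lambda>x. x) q {Var x, Var y} \<subseteq> induced_atoms S sim D E V"
  shows "\<exists>c c'. \<rho> (Wit (Var x)) = Cst c \<and> \<rho> (Wit (Var y)) = Cst c'
    \<and> (c, c') \<in> answers S sim D E V q x y"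
proof -
  have "rel_lits \<rho> q \<subseteq> induced_atoms S sim D E V" using body by (simp add: body_lits_def)
  then obtain F where F: "fact_assignment D q F" "args_of \<rho> q F" unfolding rel_lits_iff by blast
  note b = body[unfolded body_lits_iff[OF D q(1) F]]
  obtain w where w: "\<And>u. u \<in> cq_terms q \<Longrightarrow> w u \<in> trm_set S D E V q F u \<and> \<rho> (Wit u) = Cst (w u)"
    using b[THEN conjunct1] by metis
  have "(w (Var x), w (Var y)) \<in> answers S sim D E V q x y"
    unfolding answers_iff[OF E q(2) xy]
  proof (intro exI[of _ F] exI[of _ w] conjI refl F(1))
    show "\<forall>u \<in> cq_terms q. w u \<in> trm_set S D E V q F u" using w by blast
    show "\<forall>(p, u, u') \<in> sims q.
         \<exists>d \<in> trm_set S D E V q F u. \<exists>d' \<in> trm_set S D E V q F u'. (d, d') \<in> sim p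
           \<and> (u \<in> {Var x, Var y} \<longrightarrow> d = w u) \<and> (u' \<in> {Var x, Var y} \<longrightarrow> d' = w u')"
    proof clarify
      fix p u u' assume s: "(p, u, u') \<in> sims q"
      then obtain d d' where "d \<in> trm_set S D E V q F u" "d' \<in> trm_set S D E V q F u'"
        "(d, d') \<in> sim p" "u \<in> {Var x, Var y} \<longrightarrow> \<rho> (Wit u) = Cst d"
        "u' \<in> {Var x, Var y} \<longrightarrow> \<rho> (Wit u') = Cst d'"
        using bspec[OF b[THEN conjunct2] s] by auto
      then show "\<exists>d \<in> trm_set S D E V q F u. \<exists>d' \<in> trm_set S D E V q F u'. (d, d') \<in> sim p
           \<and> (u \<in> {Var x, Var y} \<longrightarrow> d = w u) \<and> (u' \<in> {Var x, Var y} \<longrightarrow> d' = w u')"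
        using w[OF mem_cq_terms(2)[OF s]] w[OF mem_cq_terms(3)[OF s]] by auto
    qed
  qed
  then show ?thesis using w[OF xy(1)] w[OF xy(2)] by blast
qed

text \<open>Completeness of compiled bodies. Every role receives its value from the chosen facts,
  the witnesses \<open>w\<close>, or the pair \<open>e s\<close> that is chosen separately for each
  similarity atom.\<close>

lemma answers_body_lits:
  assumes D: "database S D" and E: "E \<subseteq> objs D \<times> objs D" and q: "wf_cq S q" "ineqs q = {}"
    and xy: "Var x \<in> cq_terms q" "Var y \<in> cq_terms q"
    and ans: "(c, c') \<in> answers S sim D E V q x y"
  shows "\<exists>\<rho>. body_lits \<rho> (\<lambda>x. x) q {Var x, Var y} \<subseteq> induced_atoms S sim D E V
    \<and> \<rho> (Wit (Var x)) = Cst c \<and> \<rho> (Wit (Var y)) = Cst c'"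
proof -
  from ans obtain F w where F: "fact_assignment D q F"
    and W: "(\<forall>u \<in> cq_terms q. w u \<in> trm_set S D E V q F u) \<and> w (Var x) = c \<and> w (Var y) = c'
    \<and> (\<forall>(p, u, u') \<in> sims q.
         \<exists>d \<in> trm_set S D E V q F u. \<exists>d' \<in> trm_set S D E V q F u'. (d, d') \<in> sim p
           \<and> (u \<in> {Var x, Var y} \<longrightarrow> d = w u) \<and> (u' \<in> {Var x, Var y} \<longrightarrow> d' = w u'))"
    unfolding answers_iff[OF E q(2) xy]
    by (elim exE conjE[of "fact_assignment _ _ _"]) (rule that)
  have "\<exists>e. fst e \<in> trm_set S D E V q F (fst (snd s)) \<and> snd e \<in> trm_set S D E V q F (snd (snd s))
      \<and> e \<in> sim (fst s) \<and> (fst (snd s) \<in> {Var x, Var y} \<longrightarrow> fst e = w (fst (snd s)))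
      \<and> (snd (snd s) \<in> {Var x, Var y} \<longrightarrow> snd e = w (snd (snd s)))" if "s \<in> sims q" for s
    using bspec[OF W[THEN conjunct2, THEN conjunct2, THEN conjunct2] that]
    by (cases s) (simp only: split_paired_Ex fst_conv snd_conv prod.case Bex_def, blast)
  then obtain e where e: "\<And>s. s \<in> sims q \<Longrightarrow>
      fst (e s) \<in> trm_set S D E V q F (fst (snd s)) \<and> snd (e s) \<in> trm_set S D E V q F (snd (snd s))
      \<and> e s \<in> sim (fst s) \<and> (fst (snd s) \<in> {Var x, Var y} \<longrightarrow> fst (e s) = w (fst (snd s)))
      \<and> (snd (snd s) \<in> {Var x, Var y} \<longrightarrow> snd (e s) = w (snd (snd s)))"
    by metis
  \<comment> \<open>\<open>Common\<close> does not occur in \<open>body_lits\<close>, so its value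
    is arbitrary.\<close>
  define \<rho> where "\<rho> r = (case r of Arg \<pi> i \<Rightarrow> Cst (fact_arg (F \<pi>) i) | Wit u \<Rightarrow> Cst (w u)
    | SimL s \<Rightarrow> Cst (fst (e s)) | SimR s \<Rightarrow> Cst (snd (e s)) | Common \<Rightarrow> undefined)" for r
  have a: "args_of \<rho> q F" by (simp add: args_of_def \<rho>_def)
  have "body_lits \<rho> (\<lambda>x. x) q {Var x, Var y} \<subseteq> induced_atoms S sim D E V"
    unfolding body_lits_iff[OF D q(1) F a]
  proof (intro conjI)
    show "\<forall>u \<in> cq_terms q. \<exists>c \<in> trm_set S D E V q F u. \<rho> (Wit u) = Cst c"
      using W by (simp add: \<rho>_def)
    show "\<forall>(p, u, u') \<in> sims q.
     \<exists>d \<in> trm_set S D E V q F u. \<exists>d' \<in> trm_set S D E V q F u'. (d, d') \<in> sim p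
       \<and> \<rho> (SimL (p, u, u')) = Cst d \<and> \<rho> (SimR (p, u, u')) = Cst d'
       \<and> (u \<in> {Var x, Var y} \<longrightarrow> \<rho> (Wit u) = Cst d)
       \<and> (u' \<in> {Var x, Var y} \<longrightarrow> \<rho> (Wit u') = Cst d')"
    proof clarify
      fix p u u' assume s: "(p, u, u') \<in> sims q"
      show "\<exists>d \<in> trm_set S D E V q F u. \<exists>d' \<in> trm_set S D E V q F u'. (d, d') \<in> sim p
       \<and> \<rho> (SimL (p, u, u')) = Cst d \<and> \<rho> (SimR (p, u, u')) = Cst d'
       \<and> (u \<in> {Var x, Var y} \<longrightarrow> \<rho> (Wit u) = Cst d)
       \<and> (u' \<in> {Var x, Var y} \<longrightarrow> \<rho> (Wit u') = Cst d')"
        using e[OF s]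
        by (intro bexI[of _ "fst (e (p, u, u'))"] bexI[of _ "snd (e (p, u, u'))"])
          (simp_all add: \<rho>_def)
    qed
  qed
  then show ?thesis using W by (intro exI[of _ \<rho>]) (simp add: \<rho>_def)
qed

lemma trm_set_cong:
  "(\<And>\<pi>. \<pi> \<in> ratoms q \<Longrightarrow> F \<pi> = F' \<pi>) \<Longrightarrow> trm_set S D E V q F u = trm_set S D E V q F' u"
  by (simp add: trm_set_def)

text \<open>An inequality requires disjoint sets for the chosen facts, so it must be checked over
  all constants, not only at the witnesses of \<open>\<rho>\<close>. The assignment
  \<open>\<rho>'\<close> reuses the tids of \<open>\<rho>\<close> and seeks a constant in both
  sets.\<close>

lemma sat_iff_body_lits:
  fixes q :: "(('o, 'v, 't) cst, 'r, 's) cq"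
  assumes D: "database S D" and E: "E \<subseteq> objs D \<times> objs D" and q: "wf_cq S q" "sims q = {}"
  shows "sat S sim D E V q \<longleftrightarrow> (\<exists>\<rho>. body_lits \<rho> (\<lambda>x. x) q {} \<subseteq> induced_atoms S sim D E V
    \<and> (\<forall>\<iota> \<in> ineqs q. \<nexists>\<rho>'. meet_lits \<rho>' (\<lambda>x. x) q \<iota> \<subseteq> induced_atoms S sim D E V
         \<and> tid_args \<rho>' q = tid_args \<rho> q))" (is "_ \<longleftrightarrow> ?r")
proof -
  have fin: "finite (ratoms q)" using q by (simp add: wf_cq_def)
  have meet: "(\<nexists>\<rho>'. meet_lits \<rho>' (\<lambda>x. x) q (u, u') \<subseteq> induced_atoms S sim D E V
         \<and> tid_args \<rho>' q = tid_args \<rho> q) \<longleftrightarrow> trm_set S D E V q F u \<inter> trm_set S D E V q F u' = {}"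
    if F: "fact_assignment D q F" "args_of \<rho> q F" for F \<rho> u u'
  proof -
    have "\<exists>\<rho>'. meet_lits \<rho>' (\<lambda>x. x) q (u, u') \<subseteq> induced_atoms S sim D E V
         \<and> tid_args \<rho>' q = tid_args \<rho> q"
      if c: "c \<in> trm_set S D E V q F u" "c \<in> trm_set S D E V q F u'" for c
    proof -
      let ?\<rho> = "\<rho>(Common := Cst c)"
      have a: "args_of ?\<rho> q F" using F(2) by (simp add: args_of_def)
      have "meet_lits ?\<rho> (\<lambda>x. x) q (u, u') \<subseteq> induced_atoms S sim D E V"
        using c F(1) a unfolding meet_lits_def Un_subset_iff wit_lits_iff[OF D q(1) F(1) a] rel_lits_iff
        by auto
      moreover have "tid_args ?\<rho> q = tid_args \<rho> q" by (simp add: tid_args_def)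
      ultimately show ?thesis by blast
    qed
    moreover have "trm_set S D E V q F u \<inter> trm_set S D E V q F u' \<noteq> {}"
      if m: "meet_lits \<rho>' (\<lambda>x. x) q (u, u') \<subseteq> induced_atoms S sim D E V"
        "tid_args \<rho>' q = tid_args \<rho> q" for \<rho>'
    proof -
      have "rel_lits \<rho>' q \<subseteq> induced_atoms S sim D E V" using m(1) by (simp add: meet_lits_def)
      then obtain F' where F': "fact_assignment D q F'" "args_of \<rho>' q F'"
        unfolding rel_lits_iff by blast
      \<comment> \<open>\<open>\<rho>'\<close> may bind everything else anew, but agreement on the
        tids already forces the same facts, hence the same sets.\<close>
      have FF: "F \<pi> = F' \<pi>" if \<pi>: "\<pi> \<in> ratoms q" for \<pi>
      proof -
        have "\<rho>' (Arg \<pi> 0) = \<rho> (Arg \<pi> 0)"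
          using m(2) \<pi> set_enum[OF fin] by (auto simp: tid_args_def)
        moreover have "F \<pi> \<in> D" "F' \<pi> \<in> D" "0 < length (snd \<pi>)"
          using F(1) F'(1) \<pi> by (auto simp: fact_assignment_def)
        ultimately show ?thesis
          using F(2) F'(2) \<pi> database_fact_eqI[OF D] by (auto simp: args_of_def)
      qed
      have eq: "trm_set S D E V q F v = trm_set S D E V q F' v" for v
        by (rule trm_set_cong) (rule FF)
      have "wit_lits \<rho>' (\<lambda>x. x) q u Common \<subseteq> induced_atoms S sim D E V"
        "wit_lits \<rho>' (\<lambda>x. x) q u' Common \<subseteq> induced_atoms S sim D E V"
        using m(1) by (simp_all add: meet_lits_def)
      then show ?thesis unfolding wit_lits_iff[OF D q(1) F'] eq by auto
    qed
    ultimately show ?thesis by blast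
  qed
  show ?thesis
  proof
    assume "sat S sim D E V q"
    then obtain F where F: "fact_assignment D q F"
      and ne: "\<forall>u \<in> cq_terms q. trm_set S D E V q F u \<noteq> {}"
      and I: "\<forall>(u, u') \<in> ineqs q. trm_set S D E V q F u \<inter> trm_set S D E V q F u' = {}"
      unfolding sat_iff[OF E] by blast
    have "\<forall>u \<in> cq_terms q. \<exists>c. c \<in> trm_set S D E V q F u" using ne by blast
    then obtain w where w: "\<And>u. u \<in> cq_terms q \<Longrightarrow> w u \<in> trm_set S D E V q F u"
      unfolding bchoice_iff by blast
    define \<rho> where "\<rho> r = (case r of Arg \<pi> i \<Rightarrow> Cst (fact_arg (F \<pi>) i) | Wit u \<Rightarrow> Cst (w u)
      | _ \<Rightarrow> undefined)" for r :: "(('o, 'v, 't) cst, 'r, 's) role"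
    have a: "args_of \<rho> q F" by (simp add: args_of_def \<rho>_def)
    have "body_lits \<rho> (\<lambda>x. x) q {} \<subseteq> induced_atoms S sim D E V"
      unfolding body_lits_iff[OF D q(1) F a] q(2) using w by (simp add: \<rho>_def)
    moreover have "\<nexists>\<rho>'. meet_lits \<rho>' (\<lambda>x. x) q \<iota> \<subseteq> induced_atoms S sim D E V
         \<and> tid_args \<rho>' q = tid_args \<rho> q" if "\<iota> \<in> ineqs q" for \<iota>
      using bspec[OF I that] meet[OF F a, of "fst \<iota>" "snd \<iota>"] by (simp add: case_prod_unfold)
    ultimately show ?r by blast
  next
    assume ?r
    then obtain \<rho> where body: "body_lits \<rho> (\<lambda>x. x) q {} \<subseteq> induced_atoms S sim D E V"
      and I: "\<forall>\<iota> \<in> ineqs q. \<nexists>\<rho>'. meet_lits \<rho>' (\<lambda>x. x) q \<iota> \<subseteq> induced_atoms S sim D E V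
         \<and> tid_args \<rho>' q = tid_args \<rho> q" by blast
    have "rel_lits \<rho> q \<subseteq> induced_atoms S sim D E V" using body by (simp add: body_lits_def)
    then obtain F where F: "fact_assignment D q F" "args_of \<rho> q F" unfolding rel_lits_iff by blast
    have "\<forall>u \<in> cq_terms q. trm_set S D E V q F u \<noteq> {}"
      using body unfolding body_lits_iff[OF D q(1) F] by blast
    moreover have "\<forall>(u, u') \<in> ineqs q. trm_set S D E V q F u \<inter> trm_set S D E V q F u' = {}"
    proof clarify
      fix u u' assume "(u, u') \<in> ineqs q"
      then show "trm_set S D E V q F u \<inter> trm_set S D E V q F u' = {}"
        using bspec[OF I] meet[OF F, of u u'] by simp
    qed
    ultimately show "sat S sim D E V q"
      unfolding sat_iff[OF E] q(2) using F(1) by (intro exI[of _ F]) simp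
  qed
qed

section \<open>The program\<close>

text \<open>Negation is evaluated in \<open>M\<close>, separately from the set \<open>X\<close>
  whose closedness is tested, so this is closedness under the reduct by \<open>M\<close>. Upper
  bounds on a stable model can thus be tried as \<open>X\<close> with \<open>M\<close>
  fixed.\<close>

definition rule_closed :: "('p, 'c) rule \<Rightarrow> ('p, 'c) gatm set \<Rightarrow> ('p, 'c) gatm set \<Rightarrow> bool" where
  "rule_closed r X M \<longleftrightarrow> (\<forall>\<theta>. ground_atm \<theta> ` set (pos r) \<subseteq> X \<longrightarrow>
     ground_atm \<theta> ` set (neg r) \<inter> M = {} \<longrightarrow> ground_atm \<theta> (head r) \<in> X)"

lemma rule_closed_derivable: "r \<in> \<Pi> \<Longrightarrow> rule_closed r (derivable \<Pi> F M) M"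
  unfolding rule_closed_def by (intro allI impI) (rule derivable.rule, auto)

lemma derivable_subset:
  assumes "F \<subseteq> X" and "\<And>r. r \<in> \<Pi> \<Longrightarrow> rule_closed r X M"
  shows "derivable \<Pi> F M \<subseteq> X"
proof
  fix a assume "a \<in> derivable \<Pi> F M"
  then show "a \<in> X"
  proof induction
    case (rule r \<theta>)
    have "ground_atm \<theta> ` set (pos r) \<subseteq> X" using rule.IH by blast
    moreover have "ground_atm \<theta> ` set (neg r) \<inter> M = {}" using rule.hyps by blast
    ultimately show ?case
      using assms(2)[OF rule.hyps(1)] by (simp add: rule_closed_def)
  qed (use assms(1) in blast)
qed

lemma ground_atm_pair: "ground_atm \<theta> (p, us) = (p, map (ground_trm \<theta>) us)"
  by (simp add: ground_atm_def)

lemma ground_atm_cong: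
  assumes "\<And>z. z \<in> atm_vars a \<Longrightarrow> \<theta> z = \<theta>' z"
  shows "ground_atm \<theta> a = ground_atm \<theta>' a"
proof -
  have "ground_trm \<theta> u = ground_trm \<theta>' u" if "u \<in> set (snd a)" for u
  proof (cases u)
    case (Var z)
    then show ?thesis using assms[of z] that by (simp add: mem_atm_vars)
  qed simp
  then show ?thesis by (simp add: ground_atm_def)
qed

text \<open>The closure clauses use variables below 6, so a substitution matters only through six
  constants. This trades the quantifier over substitutions for quantifiers over constants, which the
  simplifier can evaluate.\<close>

lemma rule_closed_iff_nth:
  fixes r :: "('p, 'c) rule"
  assumes "rule_vars r \<subseteq> {..<6}"
  shows "rule_closed r X M \<longleftrightarrow> (\<forall>a b c d e f.
     ground_atm (\<lambda>i. [a, b, c, d, e, f] ! i) ` set (pos r) \<subseteq> X \<longrightarrow>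
     ground_atm (\<lambda>i. [a, b, c, d, e, f] ! i) ` set (neg r) \<inter> M = {} \<longrightarrow>
     ground_atm (\<lambda>i. [a, b, c, d, e, f] ! i) (head r) \<in> X)" (is "_ \<longleftrightarrow> ?r")
proof
  assume ?r
  show "rule_closed r X M"
    unfolding rule_closed_def
  proof
    fix \<theta> :: "nat \<Rightarrow> 'c"
    define \<theta>' where "\<theta>' = (\<lambda>i. [\<theta> 0, \<theta> 1, \<theta> 2, \<theta> 3, \<theta> 4, \<theta> 5] ! i)"
    have *: "\<theta> i = \<theta>' i" if "i < 6" for i
    proof -
      have "i = 0 \<or> i = 1 \<or> i = 2 \<or> i = 3 \<or> i = 4 \<or> i = 5" using that by arith
      then show ?thesis by (auto simp: \<theta>'_def)
    qed
    have "ground_atm \<theta> a = ground_atm \<theta>' a" if "a \<in> rule_atoms r" for a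
    proof (rule ground_atm_cong, rule *)
      fix z assume "z \<in> atm_vars a"
      then show "z < 6" using that assms by (auto simp: rule_vars_def)
    qed
    then have "ground_atm \<theta> ` set (pos r) = ground_atm \<theta>' ` set (pos r)"
      "ground_atm \<theta> ` set (neg r) = ground_atm \<theta>' ` set (neg r)"
      "ground_atm \<theta> (head r) = ground_atm \<theta>' (head r)"
      by (auto simp: rule_atoms_def)
    then show "ground_atm \<theta> ` set (pos r) \<subseteq> X \<longrightarrow> ground_atm \<theta> ` set (neg r) \<inter> M = {} \<longrightarrow>
        ground_atm \<theta> (head r) \<in> X"
      using \<open>?r\<close> unfolding \<theta>'_def by presburger
  qed
qed (simp add: rule_closed_def)

lemma database_fact:
  assumes "database S D" "f \<in> D"
  shows "fst f \<in> dom S" "length (snd (snd f)) = length (the (S (fst f)))"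
proof -
  obtain R t cs where f: "f = (R, t, cs)" by (cases f)
  have "\<forall>(R, t, cs) \<in> D. \<exists>\<tau>. S R = Some \<tau> \<and> list_all2 has_ty cs \<tau>"
    using assms(1) by (simp add: database_def)
  then obtain \<tau> where "S R = Some \<tau>" "list_all2 has_ty cs \<tau>" using assms(2) f by blast
  then show "fst f \<in> dom S" "length (snd (snd f)) = length (the (S (fst f)))"
    using f by (auto dest: list_all2_lengthD)
qed

section \<open>Clauses for the positions of facts and for closure under equivalence\<close>

definition rel_rule ::
  "'r schema \<Rightarrow> (('r, 's) pred, 'c) atm \<Rightarrow> 'r \<Rightarrow> (('r, 's) pred, 'c) rule" where
  "rel_rule S h R = Rule h [(RelP R, map Var [0..<Suc (length (the (S R)))])] []"

text \<open>\<open>AtP\<close> gives access to a position independently of the relation symbol, so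
  that the closure clauses can be few and fixed. Reflexive pairs come only from positions of the
  right type and thus range over the objects and the cells of the database.\<close>

definition schema_rules ::
  "'r schema \<Rightarrow> (('r, 's) pred, ('o, 'v, 't) pcst) rule set" where
  "schema_rules S =
     (\<lambda>(R, i). rel_rule S (AtP, [Var 0, Con (Pos i), Var i]) R) `
       (SIGMA R : dom S. {..length (the (S R))})
     \<union> (\<lambda>(R, i). rel_rule S (EqO, [Var i, Var i]) R) ` {(R, i). pos_ty S R i ObjTy}
     \<union> (\<lambda>(R, i). rel_rule S (EqV, [Var 0, Con (Pos i), Var 0, Con (Pos i)]) R) `
         {(R, i). pos_ty S R i ValTy}"

text \<open>The three clauses for \<open>InP\<close> mirror the cases of \<open>induced_arg\<close>.
  Types are not tested: in the intended models \<open>EqO\<close> relates only objects and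
  \<open>EqV\<close> only cells. The reflexive pairs in the bodies for \<open>NeqO\<close> and
  \<open>NeqV\<close> act as domain guards and make these clauses safe.\<close>

definition closure_rules :: "(('r, 's) pred, ('o, 'v, 't) pcst) rule set" where
  "closure_rules =
    {Rule (DomP, [Var 2]) [(AtP, [Var 0, Var 1, Var 2])] [],
     Rule (SameP, [Var 0, Var 0]) [(DomP, [Var 0])] [],
     Rule (InP, [Var 0, Con (Pos 0), Var 1]) [(AtP, [Var 0, Con (Pos 0), Var 1])] [],
     Rule (InP, [Var 0, Var 1, Var 3]) [(AtP, [Var 0, Var 1, Var 2]), (EqO, [Var 2, Var 3])] [],
     Rule (InP, [Var 0, Var 1, Var 4])
       [(EqV, [Var 0, Var 1, Var 2, Var 3]), (AtP, [Var 2, Var 3, Var 4])] [],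
     Rule (EqO, [Var 1, Var 0]) [(EqO, [Var 0, Var 1])] [],
     Rule (EqO, [Var 0, Var 2]) [(EqO, [Var 0, Var 1]), (EqO, [Var 1, Var 2])] [],
     Rule (EqV, [Var 2, Var 3, Var 0, Var 1]) [(EqV, [Var 0, Var 1, Var 2, Var 3])] [],
     Rule (EqV, [Var 0, Var 1, Var 4, Var 5])
       [(EqV, [Var 0, Var 1, Var 2, Var 3]), (EqV, [Var 2, Var 3, Var 4, Var 5])] [],
     Rule (NeqO, [Var 0, Var 1]) [(EqO, [Var 0, Var 0]), (EqO, [Var 1, Var 1])]
       [(EqO, [Var 0, Var 1])],
     Rule (NeqV, [Var 0, Var 1, Var 2, Var 3])
       [(EqV, [Var 0, Var 1, Var 0, Var 1]), (EqV, [Var 2, Var 3, Var 2, Var 3])]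
       [(EqV, [Var 0, Var 1, Var 2, Var 3])]}"

lemma closure_rules_closed:
  "(\<forall>r \<in> closure_rules. rule_closed r X M) \<longleftrightarrow>
     (\<forall>t i c. (AtP, [t, i, c]) \<in> X \<longrightarrow> (DomP, [c]) \<in> X)
   \<and> (\<forall>c. (DomP, [c]) \<in> X \<longrightarrow> (SameP, [c, c]) \<in> X)
   \<and> (\<forall>t c. (AtP, [t, Pos 0, c]) \<in> X \<longrightarrow> (InP, [t, Pos 0, c]) \<in> X)
   \<and> (\<forall>t i c d. (AtP, [t, i, c]) \<in> X \<and> (EqO, [c, d]) \<in> X \<longrightarrow> (InP, [t, i, d]) \<in> X)
   \<and> (\<forall>t i t' j c. (EqV, [t, i, t', j]) \<in> X \<and> (AtP, [t', j, c]) \<in> X \<longrightarrow> (InP, [t, i, c]) \<in> X)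
   \<and> (\<forall>a b. (EqO, [a, b]) \<in> X \<longrightarrow> (EqO, [b, a]) \<in> X)
   \<and> (\<forall>a b c. (EqO, [a, b]) \<in> X \<and> (EqO, [b, c]) \<in> X \<longrightarrow> (EqO, [a, c]) \<in> X)
   \<and> (\<forall>t i t' j. (EqV, [t, i, t', j]) \<in> X \<longrightarrow> (EqV, [t', j, t, i]) \<in> X)
   \<and> (\<forall>t i t' j t'' k. (EqV, [t, i, t', j]) \<in> X \<and> (EqV, [t', j, t'', k]) \<in> X \<longrightarrow>
        (EqV, [t, i, t'', k]) \<in> X)
   \<and> (\<forall>a b. (EqO, [a, a]) \<in> X \<and> (EqO, [b, b]) \<in> X \<longrightarrow> (EqO, [a, b]) \<notin> M \<longrightarrow>
        (NeqO, [a, b]) \<in> X)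
   \<and> (\<forall>t i t' j. (EqV, [t, i, t, i]) \<in> X \<and> (EqV, [t', j, t', j]) \<in> X \<longrightarrow>
        (EqV, [t, i, t', j]) \<notin> M \<longrightarrow> (NeqV, [t, i, t', j]) \<in> X)"
  unfolding closure_rules_def ball_simps
  by (simp add: rule_closed_iff_nth rule_vars_def rule_atoms_def atm_vars_def ground_atm_pair)

text \<open>All facts of \<open>R\<close> have the arity fixed by the schema, so an instance of the
  body that holds is a fact of \<open>R\<close>, and the substitution agrees with
  \<open>fact_arg\<close> on all variables of the head.\<close>

lemma rel_rule_closed:
  fixes D :: "('o, 'v, 't, 'r) fact set"
  assumes D: "database S D" and R: "R \<in> dom S" and h: "atm_vars h \<subseteq> {..length (the (S R))}"
    and X: "\<And>R xs. (RelP R, xs) \<in> X \<longleftrightarrow>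
      (\<exists>f \<in> D. fst f = R \<and> xs = map (\<lambda>i. Cst (fact_arg f i)) [0..<Suc (length (snd (snd f)))])"
  shows "rule_closed (rel_rule S h R) X M \<longleftrightarrow>
    (\<forall>f \<in> D. fst f = R \<longrightarrow> ground_atm (\<lambda>i. Cst (fact_arg f i)) h \<in> X)"
proof -
  have len: "length (snd (snd f)) = length (the (S R))" if "f \<in> D" "fst f = R" for f
    using database_fact[OF D that(1)] that(2) by simp
  have eq: "map \<theta> [0..<Suc m] = map (\<lambda>i. Cst (fact_arg f i)) [0..<Suc n]
      \<longleftrightarrow> m = n \<and> (\<forall>i \<le> m. \<theta> i = Cst (fact_arg f i))" for m n \<theta> and f :: "('o, 'v, 't, 'r) fact"
    by (auto simp: list_eq_iff_nth_eq less_Suc_eq_le simp del: upt_Suc)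
  have "rule_closed (rel_rule S h R) X M \<longleftrightarrow> (\<forall>\<theta>. (\<exists>f \<in> D. fst f = R \<and>
      (\<forall>i \<le> length (the (S R)). \<theta> i = Cst (fact_arg f i))) \<longrightarrow> ground_atm \<theta> h \<in> X)"
  proof -
    have "(\<exists>f \<in> D. fst f = R \<and> map \<theta> [0..<Suc (length (the (S R)))]
          = map (\<lambda>i. Cst (fact_arg f i)) [0..<Suc (length (snd (snd f)))])
        \<longleftrightarrow> (\<exists>f \<in> D. fst f = R \<and> (\<forall>i \<le> length (the (S R)). \<theta> i = Cst (fact_arg f i)))" for \<theta>
      unfolding eq using len by metis
    then show ?thesis
      by (simp add: rule_closed_def rel_rule_def ground_atm_pair comp_def X del: upt_Suc)
  qed
  also have "\<dots> \<longleftrightarrow> (\<forall>f \<in> D. fst f = R \<longrightarrow> ground_atm (\<lambda>i. Cst (fact_arg f i)) h \<in> X)"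
  proof (intro iffI ballI allI impI)
    fix f assume *: "\<forall>\<theta>. (\<exists>f \<in> D. fst f = R \<and>
      (\<forall>i \<le> length (the (S R)). \<theta> i = Cst (fact_arg f i))) \<longrightarrow> ground_atm \<theta> h \<in> X"
      and "f \<in> D" "fst f = R"
    then show "ground_atm (\<lambda>i. Cst (fact_arg f i)) h \<in> X"
      by (intro mp[OF spec[OF *]] bexI[of _ f]) simp_all
  next
    fix \<theta> assume *: "\<forall>f \<in> D. fst f = R \<longrightarrow> ground_atm (\<lambda>i. Cst (fact_arg f i)) h \<in> X"
      and "\<exists>f \<in> D. fst f = R \<and> (\<forall>i \<le> length (the (S R)). \<theta> i = Cst (fact_arg f i))"
    then obtain f where f: "f \<in> D" "fst f = R"
      "\<forall>i \<le> length (the (S R)). \<theta> i = Cst (fact_arg f i)" by blast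
    have "ground_atm \<theta> h = ground_atm (\<lambda>i. Cst (fact_arg f i)) h"
      using f(3) h by (intro ground_atm_cong) blast
    then show "ground_atm \<theta> h \<in> X" using * f by simp
  qed
  finally show ?thesis .
qed

lemma pos_tyD: "pos_ty S R i T \<Longrightarrow> R \<in> dom S \<and> 1 \<le> i \<and> i \<le> length (the (S R))"
  by (auto simp: pos_ty_def)

lemma schema_rules_closed:
  assumes D: "database S D"
    and X: "\<And>R xs. (RelP R, xs) \<in> X \<longleftrightarrow>
      (\<exists>f \<in> D. fst f = R \<and> xs = map (\<lambda>i. Cst (fact_arg f i)) [0..<Suc (length (snd (snd f)))])"
  shows "(\<forall>r \<in> schema_rules S. rule_closed r X M) \<longleftrightarrow>
     (\<forall>f \<in> D. \<forall>i \<le> length (snd (snd f)). (AtP, [Cst (fact_arg f 0), Pos i, Cst (fact_arg f i)]) \<in> X)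
   \<and> (\<forall>f \<in> D. \<forall>i. pos_ty S (fst f) i ObjTy \<longrightarrow> (EqO, [Cst (fact_arg f i), Cst (fact_arg f i)]) \<in> X)
   \<and> (\<forall>f \<in> D. \<forall>i. pos_ty S (fst f) i ValTy \<longrightarrow>
        (EqV, [Cst (fact_arg f 0), Pos i, Cst (fact_arg f 0), Pos i]) \<in> X)"
proof -
  have at: "rule_closed (rel_rule S (AtP, [Var 0, Con (Pos i), Var i]) R) X M \<longleftrightarrow> (\<forall>f \<in> D. fst f = R
      \<longrightarrow> (AtP, [Cst (fact_arg f 0), Pos i, Cst (fact_arg f i)]) \<in> X)"
    if "R \<in> dom S" "i \<le> length (the (S R))" for R i
    using that by (subst rel_rule_closed[OF D _ _ X]) (auto simp: atm_vars_def ground_atm_def)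
  have o: "rule_closed (rel_rule S (EqO, [Var i, Var i]) R) X M \<longleftrightarrow> (\<forall>f \<in> D. fst f = R
      \<longrightarrow> (EqO, [Cst (fact_arg f i), Cst (fact_arg f i)]) \<in> X)"
    if "pos_ty S R i ObjTy" for R i
    using pos_tyD[OF that] by (subst rel_rule_closed[OF D _ _ X]) (auto simp: atm_vars_def ground_atm_def)
  have v: "rule_closed (rel_rule S (EqV, [Var 0, Con (Pos i), Var 0, Con (Pos i)]) R) X M \<longleftrightarrow>
      (\<forall>f \<in> D. fst f = R \<longrightarrow> (EqV, [Cst (fact_arg f 0), Pos i, Cst (fact_arg f 0), Pos i]) \<in> X)"
    if "pos_ty S R i ValTy" for R i
    using pos_tyD[OF that] by (subst rel_rule_closed[OF D _ _ X]) (auto simp: atm_vars_def ground_atm_def)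
  have "(\<forall>r \<in> schema_rules S. rule_closed r X M) \<longleftrightarrow>
     (\<forall>R i. R \<in> dom S \<longrightarrow> i \<le> length (the (S R)) \<longrightarrow> (\<forall>f \<in> D. fst f = R
      \<longrightarrow> (AtP, [Cst (fact_arg f 0), Pos i, Cst (fact_arg f i)]) \<in> X))
   \<and> (\<forall>R i. pos_ty S R i ObjTy \<longrightarrow> (\<forall>f \<in> D. fst f = R
      \<longrightarrow> (EqO, [Cst (fact_arg f i), Cst (fact_arg f i)]) \<in> X))
   \<and> (\<forall>R i. pos_ty S R i ValTy \<longrightarrow> 
      (\<forall>f \<in> D. fst f = R \<longrightarrow> (EqV, [Cst (fact_arg f 0), Pos i, Cst (fact_arg f 0), Pos i]) \<in> X))"
  proof -
    have sig: "(\<forall>x \<in> (SIGMA R : dom S. {..length (the (S R))}). P x) \<longleftrightarrow>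
        (\<forall>R i. R \<in> dom S \<longrightarrow> i \<le> length (the (S R)) \<longrightarrow> P (R, i))" for P
      by auto
    have ty: "(\<forall>x \<in> {(R, i). pos_ty S R i T}. P x) \<longleftrightarrow> (\<forall>R i. pos_ty S R i T \<longrightarrow> P (R, i))" for P T
      by auto
    show ?thesis
      unfolding schema_rules_def ball_Un ball_simps(9) sig ty prod.case conj_assoc
      by (intro arg_cong2[where f = "(\<and>)"] iff_allI imp_cong refl) (rule at o v; assumption)+
  qed
  also have "\<dots> \<longleftrightarrow>
     (\<forall>f \<in> D. \<forall>i \<le> length (snd (snd f)). (AtP, [Cst (fact_arg f 0), Pos i, Cst (fact_arg f i)]) \<in> X)
   \<and> (\<forall>f \<in> D. \<forall>i. pos_ty S (fst f) i ObjTy \<longrightarrow> (EqO, [Cst (fact_arg f i), Cst (fact_arg f i)]) \<in> X)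
   \<and> (\<forall>f \<in> D. \<forall>i. pos_ty S (fst f) i ValTy \<longrightarrow>
        (EqV, [Cst (fact_arg f 0), Pos i, Cst (fact_arg f 0), Pos i]) \<in> X)"
  proof -
    have le: "(\<forall>R i. R \<in> dom S \<longrightarrow> i \<le> length (the (S R)) \<longrightarrow> (\<forall>f \<in> D. fst f = R \<longrightarrow> P f i))
        \<longleftrightarrow> (\<forall>f \<in> D. \<forall>i \<le> length (snd (snd f)). P f i)" for P
      using database_fact[OF D] by metis
    have ty: "(\<forall>R i. pos_ty S R i T \<longrightarrow> (\<forall>f \<in> D. fst f = R \<longrightarrow> P f i))
        \<longleftrightarrow> (\<forall>f \<in> D. \<forall>i. pos_ty S (fst f) i T \<longrightarrow> P f i)" for P T
      by blast
    show ?thesis unfolding le ty ..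
  qed
  finally show ?thesis .
qed

section \<open>Numbering the variables of a compiled query\<close>

definition roles :: "('c, 'r, 's) cq \<Rightarrow> ('c, 'r, 's) role set" where
  "roles q = (\<lambda>(\<pi>, i). Arg \<pi> i) ` (SIGMA \<pi> : ratoms q. {..<length (snd \<pi>)})
     \<union> Wit ` cq_terms q \<union> SimL ` sims q \<union> SimR ` sims q \<union> {Common}"

text \<open>Variables of programs are natural numbers. Any numbering that is injective on the
  finitely many roles of the query will do.\<close>

definition code :: "('c, 'r, 's) cq \<Rightarrow> ('c, 'r, 's) role \<Rightarrow> nat" where
  "code q = (SOME f. inj_on f (roles q))"

abbreviation qvar :: "('c, 'r, 's) cq \<Rightarrow> ('c, 'r, 's) role \<Rightarrow> 'd trm" where
  "qvar q \<equiv> \<lambda>r. Var (code q r)"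

lemma finite_cq_terms: "wf_cq S q \<Longrightarrow> finite (cq_terms q)"
  unfolding wf_cq_def cq_terms_def by (auto simp: case_prod_unfold)

lemma finite_roles: "wf_cq S q \<Longrightarrow> finite (roles q)"
  using finite_cq_terms[of S q] unfolding roles_def by (auto simp: wf_cq_def intro!: finite_SigmaI)

text \<open>Injectivity of the numbering lets every assignment of the occurring roles be realised by
  a substitution, and \<open>P\<close> is insensitive to other roles. Closedness of a clause thus
  becomes a statement about assignments of roles, free of variable numbers.\<close>

lemma all_roles:
  assumes q: "wf_cq S q" and P: "\<And>\<rho> \<rho>'. (\<And>r. r \<in> roles q \<Longrightarrow> \<rho> r = \<rho>' r) \<Longrightarrow> P \<rho> = P \<rho>'"
  shows "(\<forall>\<theta>. P (\<lambda>r. \<theta> (code q r))) \<longleftrightarrow> (\<forall>\<rho>. P \<rho>)"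
proof (intro iffI allI)
  fix \<rho> assume *: "\<forall>\<theta>. P (\<lambda>r. \<theta> (code q r))"
  have "inj_on (code q) (roles q)"
    unfolding code_def using finite_imp_inj_to_nat_seg[OF finite_roles[OF q]] by (metis someI_ex)
  then have "P \<rho> = P (\<lambda>r. (\<rho> \<circ> inv_into (roles q) (code q)) (code q r))"
    by (intro P) simp
  then show "P \<rho>" using * by blast
qed simp

lemma roles_simps:
  "\<pi> \<in> ratoms q \<Longrightarrow> i < length (snd \<pi>) \<Longrightarrow> Arg \<pi> i \<in> roles q"
  "u \<in> cq_terms q \<Longrightarrow> Wit u \<in> roles q"
  "s \<in> sims q \<Longrightarrow> SimL s \<in> roles q" "s \<in> sims q \<Longrightarrow> SimR s \<in> roles q" "Common \<in> roles q"
  by (force simp: roles_def)+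

text \<open>This and the following congruences supply the premise of \<open>all_roles\<close>:
  compiled literals look only at roles of their query.\<close>

lemma rel_lits_cong:
  assumes "\<And>r. r \<in> roles q \<Longrightarrow> f r = g r"
  shows "rel_lits f q = rel_lits g q"
  unfolding rel_lits_def using assms roles_simps(1)[of _ q] by (intro image_cong) auto

lemma wit_lits_cong:
  assumes "\<And>r. r \<in> roles q \<Longrightarrow> f r = g r" and "r \<in> roles q"
  shows "wit_lits f k q u r = wit_lits g k q u r"
proof -
  have "f (Arg \<pi> 0) = g (Arg \<pi> 0)" if "\<pi> \<in> ratoms q" "i < length (snd \<pi>)" for \<pi> i
    using that by (intro assms(1) roles_simps(1)) auto
  then show ?thesis
    unfolding wit_lits_def assms(1)[OF assms(2)] by (intro arg_cong2[where f = "(\<union>)"] image_cong) auto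
qed

lemma body_lits_cong:
  assumes "\<And>r. r \<in> roles q \<Longrightarrow> f r = g r"
  shows "body_lits f k q A = body_lits g k q A"
proof -
  have "sim_lits f k q A s = sim_lits g k q A s" if s: "s \<in> sims q" for s
  proof -
    have "fst (snd s) \<in> cq_terms q" "snd (snd s) \<in> cq_terms q"
      using mem_cq_terms(2,3)[of "fst s" "fst (snd s)" "snd (snd s)" q] s by simp_all
    then show ?thesis
      unfolding sim_lits_def using s
      by (simp add: assms roles_simps wit_lits_cong[of q f g])
  qed
  then show ?thesis
    unfolding body_lits_def
    by (simp add: assms roles_simps rel_lits_cong[of q f g] wit_lits_cong[of q f g])
qed

lemma meet_lits_cong:
  assumes "\<And>r. r \<in> roles q \<Longrightarrow> f r = g r"
  shows "meet_lits f k q \<iota> = meet_lits g k q \<iota>"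
  unfolding meet_lits_def
  by (simp add: assms roles_simps rel_lits_cong[of q f g] wit_lits_cong[of q f g])

lemma tid_args_cong:
  assumes "wf_cq S q" "\<And>r. r \<in> roles q \<Longrightarrow> f r = g r"
  shows "tid_args f q = tid_args g q"
proof -
  have "set (enum (ratoms q)) = ratoms q" using assms(1) by (simp add: wf_cq_def set_enum)
  moreover have "f (Arg \<pi> 0) = g (Arg \<pi> 0)" if "\<pi> \<in> ratoms q" for \<pi>
    using that assms(1) by (intro assms(2) roles_simps(1)) (auto simp: wf_cq_def)
  ultimately show ?thesis by (simp add: tid_args_def)
qed

lemma finite_rel_lits: "wf_cq S q \<Longrightarrow> finite (rel_lits f q)"
  by (simp add: rel_lits_def wf_cq_def)

lemma finite_wit_lits:
  assumes "wf_cq S q" shows "finite (wit_lits f k q u r)"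
proof -
  have "finite (SIGMA \<pi> : ratoms q. {..<length (snd \<pi>)})"
    using assms by (auto simp: wf_cq_def intro!: finite_SigmaI)
  then have "finite {(\<pi>, i). \<pi> \<in> ratoms q \<and> i < length (snd \<pi>) \<and> snd \<pi> ! i = u}"
    by (rule finite_subset[rotated]) auto
  moreover have "finite {a. u = Con a}" by (cases u) auto
  ultimately show ?thesis by (simp add: wit_lits_def)
qed

lemma finite_body_lits:
  assumes q: "wf_cq S q" shows "finite (body_lits f k q A)"
proof -
  have "finite (sims q)" using q by (simp add: wf_cq_def)
  then show ?thesis
    unfolding body_lits_def sim_lits_def
    by (simp add: finite_cq_terms[OF q] finite_rel_lits[OF q] finite_wit_lits[OF q])
qed

lemma finite_meet_lits: "wf_cq S q \<Longrightarrow> finite (meet_lits f k q \<iota>)"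
  unfolding meet_lits_def by (simp add: finite_rel_lits finite_wit_lits)

section \<open>Clauses compiled from rules and denial constraints\<close>

definition obj_clause ::
  "bool \<Rightarrow> (('o, 'v, 't) cst, 'r, 's) obj_rule \<Rightarrow> (('r, 's) pred, ('o, 'v, 't) pcst) rule" where
  "obj_clause soft \<rho> =
    (let q = obody \<rho>; x = qvar q (Wit (Var (ox \<rho>))); y = qvar q (Wit (Var (oy \<rho>)))
     in Rule (EqO, [x, y]) (enum (body_lits (qvar q) Con q {Var (ox \<rho>), Var (oy \<rho>)}))
          (if soft then [(NeqO, [x, y])] else []))"

definition val_clause ::
  "bool \<Rightarrow> (('o, 'v, 't) cst, 'r, 's) val_rule \<Rightarrow> (('r, 's) pred, ('o, 'v, 't) pcst) rule" where
  "val_clause soft \<rho> =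
    (let q = vbody \<rho>; x = qvar q (Wit (Var (vx \<rho>))); y = qvar q (Wit (Var (vy \<rho>)));
         us = [x, Con (Pos (vi \<rho>)), y, Con (Pos (vj \<rho>))]
     in Rule (EqV, us) (enum (body_lits (qvar q) Con q {Var (vx \<rho>), Var (vy \<rho>)}))
          (if soft then [(NeqV, us)] else []))"

text \<open>Each inequality gets a predicate of its own, numbered by its index here. The denial
  constraint is kept in the pair, because the same inequality compares different sets in different
  constraints, and the recorded tids refer to the atoms of that constraint.\<close>

definition ineq_list ::
  "('c, 'r, 's) er_spec \<Rightarrow> (('c, 'r, 's) cq \<times> ('c trm \<times> 'c trm)) list" where
  "ineq_list \<Sigma> = enum (SIGMA q : denials \<Sigma>. ineqs q)"

text \<open>Every fact of the database is determined by its tid, so the tids suffice as arguments of the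
  atoms recording that two sets meet.\<close>

definition meet_clause ::
  "(('o, 'v, 't) cst, 'r, 's) er_spec \<Rightarrow> nat \<Rightarrow> (('r, 's) pred, ('o, 'v, 't) pcst) rule" where
  "meet_clause \<Sigma> k = (let q = fst (ineq_list \<Sigma> ! k); \<iota> = snd (ineq_list \<Sigma> ! k)
     in Rule (MeetP k, tid_args (qvar q) q) (enum (meet_lits (qvar q) Con q \<iota>)) [])"

text \<open>The atom \<open>FailP\<close> in the negative body makes this clause a constraint: no stable model satisfies
  the rest of the body.\<close>

definition denial_clause ::
  "(('o, 'v, 't) cst, 'r, 's) er_spec \<Rightarrow> (('o, 'v, 't) cst, 'r, 's) cq \<Rightarrow>
   (('r, 's) pred, ('o, 'v, 't) pcst) rule" where
  "denial_clause \<Sigma> q = Rule (FailP, []) (enum (body_lits (qvar q) Con q {}))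
     ((FailP, []) # map (\<lambda>k. (MeetP k, tid_args (qvar q) q))
        (filter (\<lambda>k. fst (ineq_list \<Sigma> ! k) = q) [0..<length (ineq_list \<Sigma>)]))"

lemma obj_clause_closed:
  fixes \<rho> :: "(('o, 'v, 't) cst, 'r, 's) obj_rule"
  assumes q: "wf_cq S (obody \<rho>)"
    and xy: "Var (ox \<rho>) \<in> cq_terms (obody \<rho>)" "Var (oy \<rho>) \<in> cq_terms (obody \<rho>)"
  shows "rule_closed (obj_clause soft \<rho>) X M \<longleftrightarrow>
    (\<forall>f. body_lits f (\<lambda>x. x) (obody \<rho>) {Var (ox \<rho>), Var (oy \<rho>)} \<subseteq> X \<longrightarrow>
      (soft \<longrightarrow> (NeqO, [f (Wit (Var (ox \<rho>))), f (Wit (Var (oy \<rho>)))]) \<notin> M) \<longrightarrow>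
      (EqO, [f (Wit (Var (ox \<rho>))), f (Wit (Var (oy \<rho>)))]) \<in> X)" (is "_ \<longleftrightarrow> (\<forall>f. ?P f)")
proof -
  have "rule_closed (obj_clause soft \<rho>) X M \<longleftrightarrow> (\<forall>\<theta>. ?P (\<lambda>r. \<theta> (code (obody \<rho>) r)))"
    by (cases soft) (simp_all add: rule_closed_def obj_clause_def Let_def set_enum[OF finite_body_lits[OF q]]
        ground_body_lits ground_atm_pair comp_def)
  also have "\<dots> \<longleftrightarrow> (\<forall>f. ?P f)"
  proof (rule all_roles[OF q])
    fix f g :: "(('o, 'v, 't) cst, 'r, 's) role \<Rightarrow> ('o, 'v, 't) pcst"
    assume *: "\<And>r. r \<in> roles (obody \<rho>) \<Longrightarrow> f r = g r"
    show "?P f = ?P g"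
      using xy by (simp only: body_lits_cong[OF *] *[OF roles_simps(2)])
  qed
  finally show ?thesis .
qed

lemma val_clause_closed:
  fixes \<rho> :: "(('o, 'v, 't) cst, 'r, 's) val_rule"
  assumes q: "wf_cq S (vbody \<rho>)"
    and xy: "Var (vx \<rho>) \<in> cq_terms (vbody \<rho>)" "Var (vy \<rho>) \<in> cq_terms (vbody \<rho>)"
  shows "rule_closed (val_clause soft \<rho>) X M \<longleftrightarrow>
    (\<forall>f. body_lits f (\<lambda>x. x) (vbody \<rho>) {Var (vx \<rho>), Var (vy \<rho>)} \<subseteq> X \<longrightarrow>
      (soft \<longrightarrow> (NeqV, [f (Wit (Var (vx \<rho>))), Pos (vi \<rho>), f (Wit (Var (vy \<rho>))), Pos (vj \<rho>)]) \<notin> M) \<longrightarrow>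
      (EqV, [f (Wit (Var (vx \<rho>))), Pos (vi \<rho>), f (Wit (Var (vy \<rho>))), Pos (vj \<rho>)]) \<in> X)"
    (is "_ \<longleftrightarrow> (\<forall>f. ?P f)")
proof -
  have "rule_closed (val_clause soft \<rho>) X M \<longleftrightarrow> (\<forall>\<theta>. ?P (\<lambda>r. \<theta> (code (vbody \<rho>) r)))"
    by (cases soft) (simp_all add: rule_closed_def val_clause_def Let_def set_enum[OF finite_body_lits[OF q]]
        ground_body_lits ground_atm_pair comp_def)
  also have "\<dots> \<longleftrightarrow> (\<forall>f. ?P f)"
  proof (rule all_roles[OF q])
    fix f g :: "(('o, 'v, 't) cst, 'r, 's) role \<Rightarrow> ('o, 'v, 't) pcst"
    assume *: "\<And>r. r \<in> roles (vbody \<rho>) \<Longrightarrow> f r = g r"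
    show "?P f = ?P g"
      using xy by (simp only: body_lits_cong[OF *] *[OF roles_simps(2)])
  qed
  finally show ?thesis .
qed

lemma map_tid_args: "map h (tid_args f q) = tid_args (\<lambda>r. h (f r)) q"
  by (simp add: tid_args_def)

lemma meet_clause_closed:
  fixes \<Sigma> :: "(('o, 'v, 't) cst, 'r, 's) er_spec"
  assumes q: "wf_cq S (fst (ineq_list \<Sigma> ! k))"
  shows "rule_closed (meet_clause \<Sigma> k) X M \<longleftrightarrow>
    (\<forall>f. meet_lits f (\<lambda>x. x) (fst (ineq_list \<Sigma> ! k)) (snd (ineq_list \<Sigma> ! k)) \<subseteq> X \<longrightarrow>
      (MeetP k, tid_args f (fst (ineq_list \<Sigma> ! k))) \<in> X)" (is "_ \<longleftrightarrow> (\<forall>f. ?P f)")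
proof -
  let ?q = "fst (ineq_list \<Sigma> ! k)"
  have "rule_closed (meet_clause \<Sigma> k) X M \<longleftrightarrow> (\<forall>\<theta>. ?P (\<lambda>r. \<theta> (code ?q r)))"
    by (simp add: rule_closed_def meet_clause_def Let_def set_enum[OF finite_meet_lits[OF q]]
        ground_meet_lits ground_atm_pair comp_def map_tid_args)
  also have "\<dots> \<longleftrightarrow> (\<forall>f. ?P f)"
  proof (rule all_roles[OF q])
    fix f g :: "(('o, 'v, 't) cst, 'r, 's) role \<Rightarrow> ('o, 'v, 't) pcst"
    assume *: "\<And>r. r \<in> roles ?q \<Longrightarrow> f r = g r"
    show "?P f = ?P g"
      by (simp only: meet_lits_cong[OF *] tid_args_cong[OF q *])
  qed
  finally show ?thesis .
qed

lemma denial_clause_closed: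
  fixes \<Sigma> :: "(('o, 'v, 't) cst, 'r, 's) er_spec"
  assumes q: "wf_cq S q"
  shows "rule_closed (denial_clause \<Sigma> q) X M \<longleftrightarrow>
    (\<forall>f. body_lits f (\<lambda>x. x) q {} \<subseteq> X \<longrightarrow> (FailP, []) \<notin> M \<and>
      (\<forall>k. k < length (ineq_list \<Sigma>) \<and> fst (ineq_list \<Sigma> ! k) = q \<longrightarrow> (MeetP k, tid_args f q) \<notin> M) \<longrightarrow>
      (FailP, []) \<in> X)" (is "_ \<longleftrightarrow> (\<forall>f. ?P f)")
proof -
  have "rule_closed (denial_clause \<Sigma> q) X M \<longleftrightarrow> (\<forall>\<theta>. ?P (\<lambda>r. \<theta> (code q r)))"
  proof -
    have disj: "h ` A \<inter> M = {} \<longleftrightarrow> (\<forall>k \<in> A. h k \<notin> M)" for h and A :: "nat set" by auto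
    show ?thesis
      by (simp add: rule_closed_def denial_clause_def set_enum[OF finite_body_lits[OF q]]
          ground_body_lits ground_atm_pair comp_def map_tid_args image_image disj)
  qed
  also have "\<dots> \<longleftrightarrow> (\<forall>f. ?P f)"
  proof (rule all_roles[OF q])
    fix f g :: "(('o, 'v, 't) cst, 'r, 's) role \<Rightarrow> ('o, 'v, 't) pcst"
    assume *: "\<And>r. r \<in> roles q \<Longrightarrow> f r = g r"
    show "?P f = ?P g"
      by (simp only: body_lits_cong[OF *] tid_args_cong[OF q *])
  qed
  finally show ?thesis .
qed

definition er_program ::
  "'r schema \<Rightarrow> (('o, 'v, 't) cst, 'r, 's) er_spec \<Rightarrow> (('r, 's) pred, ('o, 'v, 't) pcst) rule set" where
  "er_program S \<Sigma> = schema_rules S \<union> closure_rules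
     \<union> obj_clause False ` hard_obj \<Sigma> \<union> obj_clause True ` soft_obj \<Sigma>
     \<union> val_clause False ` hard_val \<Sigma> \<union> val_clause True ` soft_val \<Sigma>
     \<union> meet_clause \<Sigma> ` {..<length (ineq_list \<Sigma>)} \<union> denial_clause \<Sigma> ` denials \<Sigma>"

lemma set_ineq_list:
  assumes "wf_spec S \<Sigma>"
  shows "set (ineq_list \<Sigma>) = (SIGMA q : denials \<Sigma>. ineqs q)"
  unfolding ineq_list_def
  by (rule set_enum) (use assms in \<open>auto simp: wf_spec_def wf_denial_def wf_cq_def intro!: finite_SigmaI\<close>)

lemma finite_er_program:
  assumes "is_schema S" "wf_spec S \<Sigma>"
  shows "finite (er_program S \<Sigma>)"
proof -
  have 1: "finite (SIGMA R : dom S. {..length (the (S R))})"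
    using assms(1) by (auto simp: is_schema_def)
  have 2: "finite {(R, i). pos_ty S R i T}" for T
    by (rule finite_subset[OF _ 1]) (use pos_tyD in fastforce)
  show ?thesis
    using assms(2) 1 2 unfolding er_program_def schema_rules_def closure_rules_def wf_spec_def by simp
qed

section \<open>Safety and arities of the program\<close>

lemma atm_vars_simps: "atm_vars (p, us) = (\<Union>u \<in> set us. trm_vars u)"
  by (simp add: atm_vars_def)

lemma rel_vars_term: "x \<in> rel_vars q \<Longrightarrow> Var x \<in> cq_terms q"
  by (auto simp: rel_vars_def cq_terms_def mem_trm_vars)

lemma tid_var_atom:
  assumes "tid_var S q x i"
  obtains \<pi> where "\<pi> \<in> ratoms q" "0 < length (snd \<pi>)" "snd \<pi> ! 0 = Var x"
    "pos_ty S (fst \<pi>) i ValTy"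
proof -
  obtain R us where "{(\<pi>, k). \<pi> \<in> ratoms q \<and> k < length (snd \<pi>) \<and> snd \<pi> ! k = Var x} = {((R, us), 0)}"
    and ty: "pos_ty S R i ValTy"
    using assms by (auto simp: tid_var_def)
  then have "((R, us), 0) \<in> {(\<pi>, k). \<pi> \<in> ratoms q \<and> k < length (snd \<pi>) \<and> snd \<pi> ! k = Var x}"
    by simp
  then show ?thesis using that[of "(R, us)"] ty by auto
qed

lemma wf_obj_ruleD:
  assumes "wf_obj_rule S \<rho>"
  shows "wf_cq S (obody \<rho>)" "ineqs (obody \<rho>) = {}"
    "Var (ox \<rho>) \<in> cq_terms (obody \<rho>)" "Var (oy \<rho>) \<in> cq_terms (obody \<rho>)"
  using assms by (auto simp: wf_obj_rule_def only_obj_pos_def rel_vars_term)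

lemma wf_val_ruleD:
  assumes "wf_val_rule S \<rho>"
  shows "wf_cq S (vbody \<rho>)" "ineqs (vbody \<rho>) = {}"
    "Var (vx \<rho>) \<in> cq_terms (vbody \<rho>)" "Var (vy \<rho>) \<in> cq_terms (vbody \<rho>)"
proof -
  have "tid_var S (vbody \<rho>) (vx \<rho>) (vi \<rho>)" "tid_var S (vbody \<rho>) (vy \<rho>) (vj \<rho>)"
    and "wf_cq S (vbody \<rho>)" "ineqs (vbody \<rho>) = {}"
    using assms by (simp_all add: wf_val_rule_def)
  then show "wf_cq S (vbody \<rho>)" "ineqs (vbody \<rho>) = {}"
    "Var (vx \<rho>) \<in> cq_terms (vbody \<rho>)" "Var (vy \<rho>) \<in> cq_terms (vbody \<rho>)"
    by (metis tid_var_atom mem_cq_terms(1))+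
qed

lemma tid_args_vars:
  assumes q: "wf_cq S q" and L: "rel_lits (qvar q) q \<subseteq> L"
  shows "atm_vars (p, tid_args (qvar q) q) \<subseteq> \<Union> (atm_vars ` L)"
proof
  fix z assume "z \<in> atm_vars (p, tid_args (qvar q) q)"
  then obtain \<pi> where \<pi>: "\<pi> \<in> ratoms q" "z = code q (Arg \<pi> 0)"
    using q by (auto simp: atm_vars_simps tid_args_def wf_cq_def set_enum)
  have "0 < length (snd \<pi>)" using q \<pi>(1) by (auto simp: wf_cq_def)
  then have "z \<in> atm_vars (RelP (fst \<pi>), map (\<lambda>i. qvar q (Arg \<pi> i)) [0..<length (snd \<pi>)])"
    using \<pi>(2) by (auto simp: atm_vars_simps)
  then show "z \<in> \<Union> (atm_vars ` L)"
    using \<pi>(1) L unfolding rel_lits_def by blast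
qed

text \<open>The \<open>DomP\<close> literal of each witness is what makes the heads and negated
  atoms of the rule clauses safe.\<close>

lemma wit_vars:
  assumes "u \<in> cq_terms q"
  shows "code q (Wit u) \<in> \<Union> (atm_vars ` body_lits (qvar q) Con q A)"
proof -
  have "(DomP, [qvar q (Wit u)]) \<in> body_lits (qvar q) Con q A"
    using assms by (auto simp: body_lits_def wit_lits_def)
  then show ?thesis by (force simp: atm_vars_simps)
qed

lemma safeI:
  assumes "atm_vars h \<union> \<Union> (atm_vars ` set ns) \<subseteq> \<Union> (atm_vars ` set bs)"
  shows "safe (Rule h bs ns)"
  using assms unfolding safe_def rule_vars_def rule_atoms_def by simp

lemma safe_rel_rule: "atm_vars h \<subseteq> {..length (the (S R))} \<Longrightarrow> safe (rel_rule S h R)"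
  unfolding rel_rule_def by (rule safeI) (auto simp: atm_vars_simps simp del: upt_Suc)

lemma safe_obj_clause:
  assumes "wf_obj_rule S \<rho>"
  shows "safe (obj_clause soft \<rho>)"
  using wf_obj_ruleD[OF assms] wit_vars[of _ "obody \<rho>"]
  unfolding obj_clause_def Let_def
  by (intro safeI) (auto simp: atm_vars_simps set_enum finite_body_lits)

lemma safe_val_clause:
  assumes "wf_val_rule S \<rho>"
  shows "safe (val_clause soft \<rho>)"
  using wf_val_ruleD[OF assms] wit_vars[of _ "vbody \<rho>"]
  unfolding val_clause_def Let_def
  by (intro safeI) (auto simp: atm_vars_simps set_enum finite_body_lits)

lemma safe_meet_clause:
  assumes q: "wf_cq S (fst (ineq_list \<Sigma> ! k))"
  shows "safe (meet_clause \<Sigma> k)"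
  unfolding meet_clause_def Let_def
  by (intro safeI)
    (simp add: set_enum finite_meet_lits[OF q], rule tid_args_vars[OF q], simp add: meet_lits_def le_supI1)

lemma safe_denial_clause:
  assumes q: "wf_cq S q"
  shows "safe (denial_clause \<Sigma> q)"
  unfolding denial_clause_def
  by (intro safeI)
    (simp add: atm_vars_simps(1)[of _ "[]"] set_enum finite_body_lits[OF q] UN_subset_iff,
      intro allI impI, rule tid_args_vars[OF q], simp add: body_lits_def le_supI1)

lemma wf_ineq_list:
  assumes "wf_spec S \<Sigma>" "k < length (ineq_list \<Sigma>)"
  shows "fst (ineq_list \<Sigma> ! k) \<in> denials \<Sigma>" "snd (ineq_list \<Sigma> ! k) \<in> ineqs (fst (ineq_list \<Sigma> ! k))"
proof -
  have "ineq_list \<Sigma> ! k \<in> (SIGMA q : denials \<Sigma>. ineqs q)"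
    using set_ineq_list[OF assms(1)] nth_mem[OF assms(2)] by simp
  then show "fst (ineq_list \<Sigma> ! k) \<in> denials \<Sigma>"
    "snd (ineq_list \<Sigma> ! k) \<in> ineqs (fst (ineq_list \<Sigma> ! k))"
    by auto
qed

lemma wf_specD:
  assumes "wf_spec S \<Sigma>"
  shows "\<rho> \<in> hard_obj \<Sigma> \<union> soft_obj \<Sigma> \<Longrightarrow> wf_obj_rule S \<rho>"
    "\<rho>' \<in> hard_val \<Sigma> \<union> soft_val \<Sigma> \<Longrightarrow> wf_val_rule S \<rho>'"
    "q \<in> denials \<Sigma> \<Longrightarrow> wf_cq S q" "q \<in> denials \<Sigma> \<Longrightarrow> sims q = {}"
  using assms unfolding wf_spec_def wf_denial_def by blast+

lemma safe_closure_rules: "r \<in> closure_rules \<Longrightarrow> safe r"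
  unfolding closure_rules_def by (auto simp: safe_def rule_vars_def rule_atoms_def atm_vars_simps)

lemma safe_schema_rules: "r \<in> schema_rules S \<Longrightarrow> safe r"
  unfolding schema_rules_def
  by (auto simp: atm_vars_simps dest!: pos_tyD intro!: safe_rel_rule)

lemma safe_er_program:
  assumes "wf_spec S \<Sigma>" "r \<in> er_program S \<Sigma>"
  shows "safe r"
  using assms(2) unfolding er_program_def
  by (elim UnE imageE)
    (auto intro: safe_closure_rules safe_schema_rules safe_obj_clause safe_val_clause
      safe_meet_clause safe_denial_clause wf_specD[OF assms(1)] wf_ineq_list[OF assms(1)])

text \<open>The list follows the numbering of the \<open>Aux\<close> symbols, with
  \<open>DomP\<close> at index 2 and \<open>AtP\<close> at index 8. From 9 on, the arity of a
  \<open>MeetP\<close> symbol is the number of relational atoms of its denial constraint.\<close>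

definition aux_arity :: "('c, 'r, 's) er_spec \<Rightarrow> nat \<Rightarrow> nat" where
  "aux_arity \<Sigma> n = (if n < 9 then [0, 0, 1, 3, 2, 2, 4, 0, 3] ! n
     else length (enum (ratoms (fst (ineq_list \<Sigma> ! (n - 9))))))"

definition arity_ok ::
  "'r schema \<Rightarrow> ('c, 'r, 's) er_spec \<Rightarrow> (('r, 's) pred \<times> 'x list) \<Rightarrow> bool" where
  "arity_ok S \<Sigma> a \<longleftrightarrow> pred_arity S (aux_arity \<Sigma>) (fst a) = Some (length (snd a))"

lemma arity_ok_simps:
  "arity_ok S \<Sigma> (EqO, us) \<longleftrightarrow> length us = 2" "arity_ok S \<Sigma> (EqV, us) \<longleftrightarrow> length us = 4"
  "arity_ok S \<Sigma> (SimP p, us) \<longleftrightarrow> length us = 2"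
  "arity_ok S \<Sigma> (DomP, us) \<longleftrightarrow> length us = 1" "arity_ok S \<Sigma> (InP, us) \<longleftrightarrow> length us = 3"
  "arity_ok S \<Sigma> (SameP, us) \<longleftrightarrow> length us = 2" "arity_ok S \<Sigma> (NeqO, us) \<longleftrightarrow> length us = 2"
  "arity_ok S \<Sigma> (NeqV, us) \<longleftrightarrow> length us = 4" "arity_ok S \<Sigma> (FailP, us) \<longleftrightarrow> length us = 0"
  "arity_ok S \<Sigma> (AtP, us) \<longleftrightarrow> length us = 3"
  "arity_ok S \<Sigma> (MeetP k, us) \<longleftrightarrow> length us = length (enum (ratoms (fst (ineq_list \<Sigma> ! k))))"
  by (auto simp: arity_ok_def aux_arity_def)

lemma arity_ok_rel: "S R = Some \<tau> \<Longrightarrow> arity_ok S \<Sigma> (RelP R, us) \<longleftrightarrow> length us = Suc (length \<tau>)"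
  by (auto simp: arity_ok_def)

lemma arity_ok_rel_lits: "wf_cq S q \<Longrightarrow> a \<in> rel_lits f q \<Longrightarrow> arity_ok S \<Sigma> a"
  by (auto simp: rel_lits_def wf_cq_def arity_ok_rel arity_ok_def)

lemma arity_ok_wit_lits: "a \<in> wit_lits f k q u r \<Longrightarrow> arity_ok S \<Sigma> a"
  by (auto simp: wit_lits_def arity_ok_simps)

lemma arity_ok_body_lits:
  assumes "wf_cq S q" "a \<in> body_lits f k q A"
  shows "arity_ok S \<Sigma> a"
  using assms(2) unfolding body_lits_def sim_lits_def
  by (auto simp: arity_ok_simps intro: arity_ok_rel_lits[OF assms(1)] arity_ok_wit_lits)

lemma arity_ok_meet_lits:
  assumes "wf_cq S q" "a \<in> meet_lits f k q \<iota>"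
  shows "arity_ok S \<Sigma> a"
  using assms(2) arity_ok_rel_lits[OF assms(1)] arity_ok_wit_lits
  unfolding meet_lits_def by blast

lemma arity_ok_rel_rule:
  assumes "R \<in> dom S" "arity_ok S \<Sigma> h" "a \<in> rule_atoms (rel_rule S h R)"
  shows "arity_ok S \<Sigma> a"
  using assms by (auto simp: rel_rule_def rule_atoms_def arity_ok_rel simp del: upt_Suc)

lemma arity_ok_er_program:
  assumes \<Sigma>: "wf_spec S \<Sigma>" and r: "r \<in> er_program S \<Sigma>" and a: "a \<in> rule_atoms r"
  shows "arity_ok S \<Sigma> a"
proof -
  have obj: "arity_ok S \<Sigma> a" if "r = obj_clause soft \<rho>" "wf_obj_rule S \<rho>" for soft \<rho>
    using a wf_obj_ruleD(1)[OF that(2)] unfolding that(1)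
    by (auto simp: obj_clause_def Let_def rule_atoms_def set_enum finite_body_lits
        arity_ok_simps arity_ok_body_lits split: if_splits)
  have val: "arity_ok S \<Sigma> a" if "r = val_clause soft \<rho>" "wf_val_rule S \<rho>" for soft \<rho>
    using a wf_val_ruleD(1)[OF that(2)] unfolding that(1)
    by (auto simp: val_clause_def Let_def rule_atoms_def set_enum finite_body_lits
        arity_ok_simps arity_ok_body_lits split: if_splits)
  have meet: "arity_ok S \<Sigma> a" if "r = meet_clause \<Sigma> k" "k < length (ineq_list \<Sigma>)" for k
    using a wf_specD(3)[OF \<Sigma> wf_ineq_list(1)[OF \<Sigma> that(2)]] unfolding that(1)
    by (auto simp: meet_clause_def Let_def rule_atoms_def set_enum finite_meet_lits
        arity_ok_simps tid_args_def arity_ok_meet_lits)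
  have denial: "arity_ok S \<Sigma> a" if "r = denial_clause \<Sigma> q" "q \<in> denials \<Sigma>" for q
    using a wf_specD(3)[OF \<Sigma> that(2)] unfolding that(1)
    by (auto simp: denial_clause_def rule_atoms_def set_enum finite_body_lits
        arity_ok_simps tid_args_def arity_ok_body_lits)
  have closure: "arity_ok S \<Sigma> a" if "r \<in> closure_rules"
    using that a by (auto simp: closure_rules_def rule_atoms_def arity_ok_simps)
  have schema: "arity_ok S \<Sigma> a" if "r \<in> schema_rules S"
  proof -
    from that consider
        (at) R i where "R \<in> dom S" "r = rel_rule S (AtP, [Var 0, Con (Pos i), Var i]) R"
      | (eqo) R i where "pos_ty S R i ObjTy" "r = rel_rule S (EqO, [Var i, Var i]) R"
      | (eqv) R i where "pos_ty S R i ValTy"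
          "r = rel_rule S (EqV, [Var 0, Con (Pos i), Var 0, Con (Pos i)]) R"
      unfolding schema_rules_def by auto
    then show ?thesis
    proof cases
      case at
      then show ?thesis
        using at(1) by (auto simp: arity_ok_simps intro: arity_ok_rel_rule[OF _ _ a[unfolded at(2)]])
    next
      case eqo
      then show ?thesis
        using pos_tyD[OF eqo(1)] by (auto simp: arity_ok_simps intro: arity_ok_rel_rule[OF _ _ a[unfolded eqo(2)]])
    next
      case eqv
      then show ?thesis
        using pos_tyD[OF eqv(1)] by (auto simp: arity_ok_simps intro: arity_ok_rel_rule[OF _ _ a[unfolded eqv(2)]])
    qed
  qed
  show ?thesis
    using r unfolding er_program_def
    by (elim UnE imageE)
      (auto intro: schema closure obj val meet denial wf_specD[OF \<Sigma>])
qed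

lemma normal_er_program:
  assumes "is_schema S" "wf_spec S \<Sigma>"
  shows "normal_program S (er_program S \<Sigma>)"
  unfolding normal_program_def
proof (intro conjI exI[of _ "aux_arity \<Sigma>"])
  show "\<forall>r \<in> er_program S \<Sigma>. \<forall>(p, us) \<in> rule_atoms r.
      pred_arity S (aux_arity \<Sigma>) p = Some (length us)"
    using arity_ok_er_program[OF assms(2)] by (auto simp: arity_ok_def)
qed (use finite_er_program[OF assms] safe_er_program[OF assms(2)] in blast)+

section \<open>Candidate solutions\<close>

lemma EqRel_least: "equiv A r \<Longrightarrow> P \<subseteq> r \<Longrightarrow> EqRel P A \<subseteq> r"
  by (auto simp: EqRel_def)

lemma subset_EqRel: "P \<subseteq> EqRel P A"
  by (auto simp: EqRel_def)

text \<open>Since \<open>P\<close> lies in \<open>A \<times> A\<close>, the full relation is one of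
  the equivalences intersected, which bounds the intersection; the other properties are inherited
  from the members.\<close>

lemma equiv_EqRel:
  assumes "P \<subseteq> A \<times> A"
  shows "equiv A (EqRel P A)"
proof (rule equivI)
  have "equiv A (A \<times> A)" by (auto simp: equiv_def refl_on_def sym_def trans_def)
  then show "EqRel P A \<subseteq> A \<times> A" using assms by (rule EqRel_least)
  show "refl_on A (EqRel P A)" by (auto simp: EqRel_def refl_on_def equiv_def)
  show "sym (EqRel P A)" unfolding EqRel_def by (rule symI) (auto simp: equiv_def dest: symD)
  show "trans (EqRel P A)" unfolding EqRel_def by (rule transI) (auto simp: equiv_def dest: transD)
qed

text \<open>A constant carries its sort, so types can be read backwards: in a fact, an object can
  only stand at an object position, and index 0 holds a tid.\<close>

lemma obj_position:
  assumes "database S D" "f \<in> D"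
  shows "pos_ty S (fst f) i ObjTy \<Longrightarrow> fact_arg f i \<in> objs D"
    "i \<le> length (snd (snd f)) \<Longrightarrow> fact_arg f i \<in> objs D \<Longrightarrow> pos_ty S (fst f) i ObjTy"
proof -
  obtain R t cs where f: "f = (R, t, cs)" by (cases f)
  have "\<forall>(R, t, cs) \<in> D. \<exists>\<tau>. S R = Some \<tau> \<and> list_all2 has_ty cs \<tau>"
    using assms(1) by (simp add: database_def)
  then obtain \<tau> where \<tau>: "S R = Some \<tau>" "list_all2 has_ty cs \<tau>" using assms(2) f by blast
  have ty: "has_ty (fact_arg f i) (\<tau> ! (i - 1))" if "1 \<le> i" "i \<le> length cs" for i
    using that \<tau>(2) by (auto simp: fact_arg_def f nth_Cons' list_all2_conv_all_nth)
  have len: "length \<tau> = length cs" using \<tau>(2) by (simp add: list_all2_lengthD)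
  {
    assume "pos_ty S (fst f) i ObjTy"
    then have i: "1 \<le> i" "i \<le> length cs" "\<tau> ! (i - 1) = ObjTy"
      using \<tau>(1) len by (auto simp: pos_ty_def f)
    then have "has_ty (fact_arg f i) ObjTy" using ty by metis
    then obtain a where "fact_arg f i = Obj a" by (cases "fact_arg f i") auto
    moreover have "fact_arg f i \<in> set cs" using i by (auto simp: fact_arg_def f nth_Cons')
    ultimately show "fact_arg f i \<in> objs D"
      using assms(2) unfolding f objs_def by auto
  next
    assume i: "i \<le> length (snd (snd f))" and "fact_arg f i \<in> objs D"
    then obtain a where a: "fact_arg f i = Obj a" by (auto simp: objs_def)
    then have "1 \<le> i" by (cases i) (auto simp: fact_arg_def f)
    moreover then have "\<tau> ! (i - 1) = ObjTy" using ty[of i] i a f by simp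
    ultimately show "pos_ty S (fst f) i ObjTy"
      using \<tau>(1) len i by (auto simp: pos_ty_def f)
  }
qed

lemma fact_arg_dbdom:
  assumes "f \<in> D" "i \<le> length (snd (snd f))"
  shows "fact_arg f i \<in> dbdom D"
proof -
  obtain R t cs where f: "f = (R, t, cs)" by (cases f)
  have "i < length (Tid t # cs)" using assms(2) f by simp
  then have "(Tid t # cs) ! i \<in> set (Tid t # cs)" by (rule nth_mem)
  then have "fact_arg f i \<in> set (Tid t # cs)" by (simp only: fact_arg_def f fst_conv snd_conv)
  then show ?thesis using assms(1) f by (force simp: dbdom_def)
qed

lemma dbdom_fact_arg:
  assumes "c \<in> dbdom D"
  obtains f i where "f \<in> D" "i \<le> length (snd (snd f))" "c = fact_arg f i"
proof -
  from assms obtain R t cs where f: "(R, t, cs) \<in> D" "c \<in> set (Tid t # cs)"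
    by (auto simp: dbdom_def)
  then obtain i where "i < length (Tid t # cs)" "(Tid t # cs) ! i = c" by (metis in_set_conv_nth)
  then show ?thesis using that[of "(R, t, cs)" i] f by (simp add: fact_arg_def)
qed

lemma fact_arg_pos: "i \<noteq> 0 \<Longrightarrow> fact_arg (R, t, cs) i = cs ! (i - 1)"
  by (cases i) (simp_all add: fact_arg_def)

lemma induced_arg_0: "induced_arg S D E V f 0 = {fact_arg f 0}"
  by (cases f) (simp add: induced_arg_def fact_arg_def)

lemma induced_arg_obj:
  assumes "pos_ty S (fst f) i ObjTy"
  shows "induced_arg S D E V f i = {c. (fact_arg f i, c) \<in> E}"
proof -
  have "i \<noteq> 0" using pos_tyD[OF assms] by auto
  then show ?thesis using assms by (cases f) (simp add: induced_arg_def fact_arg_pos)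
qed

lemma induced_arg_val:
  "i \<noteq> 0 \<Longrightarrow> \<not> pos_ty S (fst f) i ObjTy \<Longrightarrow> induced_arg S D E V f i =
     {c. \<exists>t' j. ((fst (snd f), i), (t', j)) \<in> V \<and> const_at D t' j c}"
  by (cases f) (simp add: induced_arg_def)

lemma const_at_iff:
  "const_at D t i c \<longleftrightarrow>
    (\<exists>f \<in> D. fst (snd f) = t \<and> 1 \<le> i \<and> i \<le> length (snd (snd f)) \<and> c = fact_arg f i)"
  (is "_ \<longleftrightarrow> ?r")
proof
  assume "const_at D t i c"
  then obtain R cs where "(R, t, cs) \<in> D" "1 \<le> i" "i \<le> length cs" "c = cs ! (i - 1)"
    by (auto simp: const_at_def)
  then show ?r by (intro bexI[of _ "(R, t, cs)"]) (simp_all add: fact_arg_pos)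
next
  assume ?r
  then obtain R cs where "(R, t, cs) \<in> D" "1 \<le> i" "i \<le> length cs" "c = fact_arg (R, t, cs) i"
    by auto
  then show "const_at D t i c" unfolding const_at_def by (auto simp: fact_arg_pos)
qed

lemma cells_iff:
  "(t, i) \<in> cells S D \<longleftrightarrow> (\<exists>f \<in> D. fst (snd f) = t \<and> pos_ty S (fst f) i ValTy)"
  by (simp add: cells_def Bex_def split_paired_Ex)

lemma objs_iff:
  assumes "database S D"
  shows "c \<in> objs D \<longleftrightarrow> (\<exists>f \<in> D. \<exists>i. pos_ty S (fst f) i ObjTy \<and> c = fact_arg f i)"
proof
  assume c: "c \<in> objs D"
  then have "c \<in> dbdom D" by (force simp: objs_def dbdom_def)
  then obtain f i where "f \<in> D" "i \<le> length (snd (snd f))" "c = fact_arg f i"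
    by (rule dbdom_fact_arg)
  then show "\<exists>f \<in> D. \<exists>i. pos_ty S (fst f) i ObjTy \<and> c = fact_arg f i"
    using obj_position(2)[OF assms] c by blast
qed (use obj_position(1)[OF assms] in blast)

lemma answers_witness:
  assumes "E \<subseteq> objs D \<times> objs D" "ineqs q = {}" "Var x \<in> cq_terms q" "Var y \<in> cq_terms q"
    and "(a, b) \<in> answers S sim D E V q x y"
  shows "\<exists>F w. fact_assignment D q F \<and> (\<forall>u \<in> cq_terms q. w u \<in> trm_set S D E V q F u)
    \<and> w (Var x) = a \<and> w (Var y) = b"
proof -
  have weaken: "\<exists>F w. A F \<and> B F w \<and> C w \<and> G w" if "\<exists>F w. A F \<and> B F w \<and> C w \<and> G w \<and> H F w"
    for A :: "'f \<Rightarrow> bool" and B C G and H :: "'f \<Rightarrow> 'w \<Rightarrow> bool" using that by blast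
  show ?thesis using assms(5) unfolding answers_iff[OF assms(1-4)] by (rule weaken)
qed

text \<open>An answer variable occurs at an object position, whose argument set in the induced
  database consists of constants related by \<open>E\<close>.\<close>

lemma obj_answers:
  assumes E: "E \<subseteq> objs D \<times> objs D" and \<rho>: "wf_obj_rule S \<rho>"
    and ans: "(a, b) \<in> answers S sim D E V (obody \<rho>) (ox \<rho>) (oy \<rho>)"
  shows "a \<in> objs D" "b \<in> objs D"
proof -
  let ?q = "obody \<rho>"
  from answers_witness[OF E wf_obj_ruleD(2-4)[OF \<rho>] ans] obtain F w
    where Fw: "fact_assignment D ?q F \<and> (\<forall>u \<in> cq_terms ?q. w u \<in> trm_set S D E V ?q F u)
      \<and> w (Var (ox \<rho>)) = a \<and> w (Var (oy \<rho>)) = b" by (elim exE) (rule that)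
  note F = Fw[THEN conjunct1] and w = Fw[THEN conjunct2, THEN conjunct1]
    Fw[THEN conjunct2, THEN conjunct2, THEN conjunct1] Fw[THEN conjunct2, THEN conjunct2, THEN conjunct2]
  have "w (Var x) \<in> objs D" if x: "only_obj_pos S ?q x" for x
  proof -
    have "x \<in> rel_vars ?q" using x by (simp add: only_obj_pos_def)
    then obtain R us where us: "(R, us) \<in> ratoms ?q" "Var x \<in> set us"
      by (auto simp: rel_vars_def mem_trm_vars)
    then obtain i where i: "i < length us" "us ! i = Var x" by (metis in_set_conv_nth)
    have "pos_ty S R i ObjTy" using x us(1) i unfolding only_obj_pos_def by blast
    moreover have "fst (F (R, us)) = R" using F us(1) by (auto simp: fact_assignment_def)
    moreover have "w (Var x) \<in> induced_arg S D E V (F (R, us)) i"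
      using w(1) us(1) i \<open>x \<in> rel_vars ?q\<close> rel_vars_term by (fastforce simp: trm_set_def)
    ultimately show ?thesis using E induced_arg_obj[of S "F (R, us)"] by auto
  qed
  then show "a \<in> objs D" "b \<in> objs D" using \<rho> w by (auto simp: wf_obj_rule_def)
qed

text \<open>An answer variable stands in position 0, where the argument set is the singleton of the
  tid; the relation symbol of that atom makes the merged position a cell of the selected
  fact.\<close>

lemma val_answers:
  assumes E: "E \<subseteq> objs D \<times> objs D" and \<rho>: "wf_val_rule S \<rho>"
    and ans: "(a, b) \<in> answers S sim D E V (vbody \<rho>) (vx \<rho>) (vy \<rho>)"
  shows "\<exists>t t'. a = Tid t \<and> b = Tid t' \<and> (t, vi \<rho>) \<in> cells S D \<and> (t', vj \<rho>) \<in> cells S D"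
proof -
  let ?q = "vbody \<rho>"
  from answers_witness[OF E wf_val_ruleD(2-4)[OF \<rho>] ans] obtain F w
    where Fw: "fact_assignment D ?q F \<and> (\<forall>u \<in> cq_terms ?q. w u \<in> trm_set S D E V ?q F u)
      \<and> w (Var (vx \<rho>)) = a \<and> w (Var (vy \<rho>)) = b" by (elim exE) (rule that)
  note F = Fw[THEN conjunct1] and w = Fw[THEN conjunct2, THEN conjunct1]
    Fw[THEN conjunct2, THEN conjunct2, THEN conjunct1] Fw[THEN conjunct2, THEN conjunct2, THEN conjunct2]
  have "\<exists>t. w (Var x) = Tid t \<and> (t, i) \<in> cells S D" if x: "tid_var S ?q x i" for x i
  proof -
    obtain \<pi> where \<pi>: "\<pi> \<in> ratoms ?q" "0 < length (snd \<pi>)" "snd \<pi> ! 0 = Var x"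
      "pos_ty S (fst \<pi>) i ValTy" using tid_var_atom[OF x] .
    have "F \<pi> \<in> D" "fst (F \<pi>) = fst \<pi>" using F \<pi>(1) by (auto simp: fact_assignment_def)
    moreover have "w (Var x) \<in> trm_set S D E V ?q F (Var x)"
      using w(1) mem_cq_terms(1)[OF \<pi>(1,2)] \<pi>(3) by auto
    then have "w (Var x) \<in> induced_arg S D E V (F \<pi>) 0"
      using \<pi>(1-3) by (auto simp: trm_set_def)
    ultimately show ?thesis
      using \<pi>(4) by (auto simp: induced_arg_0 cells_iff fact_arg_def)
  qed
  from this[of "vx \<rho>" "vi \<rho>"] this[of "vy \<rho>" "vj \<rho>"] show ?thesis
    using \<rho> w(2,3) by (auto simp: wf_val_rule_def)
qed

lemma candidate_equiv:
  assumes \<Sigma>: "wf_spec S \<Sigma>" and "candidate S \<Sigma> sim D E V"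
  shows "equiv (objs D) E \<and> equiv (cells S D) V"
  using assms(2)
proof induction
  case init
  show ?case by (simp add: equiv_EqRel)
next
  case (obj E V \<rho> a b)
  have E: "E \<subseteq> objs D \<times> objs D" using obj.IH by (simp add: equiv_type)
  have "a \<in> objs D" "b \<in> objs D"
    using obj_answers[OF E wf_specD(1)[OF \<Sigma> obj.hyps(2)] obj.hyps(3)] by simp_all
  then show ?case using obj.IH E by (simp add: equiv_EqRel)
next
  case (val E V \<rho> t t')
  have E: "E \<subseteq> objs D \<times> objs D" "V \<subseteq> cells S D \<times> cells S D"
    using val.IH by (simp_all add: equiv_type)
  have "(t, vi \<rho>) \<in> cells S D" "(t', vj \<rho>) \<in> cells S D"
    using val_answers[OF E(1) wf_specD(2)[OF \<Sigma> val.hyps(2)] val.hyps(3)] by auto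
  then show ?case using val.IH E by (simp add: equiv_EqRel)
qed

section \<open>Interpretations built from an induced database\<close>

definition neg_pred :: "('r, 's) pred \<Rightarrow> bool" where
  "neg_pred p \<longleftrightarrow> p \<in> {NeqO, NeqV, FailP} \<union> range (\<lambda>k. MeetP k)"

lemma neg_pred_simps [simp]:
  "\<not> neg_pred (RelP R)" "\<not> neg_pred (SimP p)" "\<not> neg_pred EqO" "\<not> neg_pred EqV" "\<not> neg_pred DomP"
  "\<not> neg_pred InP" "\<not> neg_pred SameP" "\<not> neg_pred AtP"
  "neg_pred NeqO" "neg_pred NeqV" "neg_pred FailP" "neg_pred (MeetP k)"
  by (auto simp: neg_pred_def)

lemma induced_atoms_pos: "a \<in> induced_atoms S sim D E V \<Longrightarrow> \<not> neg_pred (fst a)"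
  by (auto simp: induced_atoms_def input_facts_def)

text \<open>The predicates in \<open>neg_pred\<close> occur only in heads and negative bodies, so
  adding their atoms to an interpretation enables no further positive body.\<close>

lemma body_lits_pos: "a \<in> body_lits f k q A \<Longrightarrow> \<not> neg_pred (fst a)"
  by (auto simp: body_lits_def rel_lits_def wit_lits_def sim_lits_def)

lemma meet_lits_pos: "a \<in> meet_lits f k q \<iota> \<Longrightarrow> \<not> neg_pred (fst a)"
  by (auto simp: meet_lits_def rel_lits_def wit_lits_def)

text \<open>\<open>Q\<close> stands for any set of \<open>neg_pred\<close> atoms containing at least
  the \<open>NeqO\<close> and \<open>NeqV\<close> atoms forced by \<open>M\<close>. It is kept
  abstract because one direction of the theorem takes all \<open>NeqO\<close> and
  \<open>NeqV\<close> atoms and the other exactly those of unmerged pairs.\<close>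

lemma base_rules_closed:
  fixes D :: "('o, 'v, 't, 'r) fact set"
  assumes D: "database S D" and E: "equiv (objs D) E" and V: "equiv (cells S D) V"
    and Q: "\<And>a. a \<in> Q \<Longrightarrow> neg_pred (fst a)"
    and QO: "\<And>a b. a \<in> objs D \<Longrightarrow> b \<in> objs D \<Longrightarrow> (EqO, [Cst a, Cst b]) \<notin> M \<Longrightarrow>
      (NeqO, [Cst a, Cst b]) \<in> Q"
    and QV: "\<And>t i t' j. (t, i) \<in> cells S D \<Longrightarrow> (t', j) \<in> cells S D \<Longrightarrow>
      (EqV, [Cst (Tid t), Pos i, Cst (Tid t'), Pos j]) \<notin> M \<Longrightarrow>
      (NeqV, [Cst (Tid t), Pos i, Cst (Tid t'), Pos j]) \<in> Q"
    and r: "r \<in> schema_rules S \<union> closure_rules"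
  shows "rule_closed r (induced_atoms S sim D E V \<union> Q) M"
proof -
  let ?I = "induced_atoms S sim D E V"
  have mem: "(p, xs) \<in> ?I \<union> Q \<longleftrightarrow> (p, xs) \<in> ?I" if "\<not> neg_pred p" for p xs
    using that Q by fastforce
  have EA: "E \<subseteq> objs D \<times> objs D" and VA: "V \<subseteq> cells S D \<times> cells S D"
    using E V by (simp_all add: equiv_type)
  have reflO: "(c, c) \<in> E" if "c \<in> objs D" for c using E that by (rule equiv_class_self[unfolded Image_singleton mem_Collect_eq])
  have reflV: "(c, c) \<in> V" if "c \<in> cells S D" for c using V that by (rule equiv_class_self[unfolded Image_singleton mem_Collect_eq])
  have tid: "fact_arg f 0 = Tid (fst (snd f))" for f :: "('o, 'v, 't, 'r) fact"
    by (simp add: fact_arg_def)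
  have 1: "\<forall>r \<in> schema_rules S. rule_closed r (?I \<union> Q) M"
  proof -
    have X: "(RelP R, xs) \<in> ?I \<union> Q \<longleftrightarrow>
      (\<exists>f \<in> D. fst f = R \<and> xs = map (\<lambda>i. Cst (fact_arg f i)) [0..<Suc (length (snd (snd f)))])"
      for R xs
      by (subst mem) (simp_all only: neg_pred_simps induced_atoms_iff not_False_eq_True)
    have at: "(AtP, [Cst (fact_arg f 0), Pos i, Cst (fact_arg f i)]) \<in> ?I"
      if "f \<in> D" "i \<le> length (snd (snd f))" for f i
      using that unfolding induced_atoms_iff by blast
    have o: "(EqO, [Cst (fact_arg f i), Cst (fact_arg f i)]) \<in> ?I"
      if "f \<in> D" "pos_ty S (fst f) i ObjTy" for f i
      using reflO[OF obj_position(1)[OF D that]] unfolding induced_atoms_iff by blast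
    have v: "(EqV, [Cst (fact_arg f 0), Pos i, Cst (fact_arg f 0), Pos i]) \<in> ?I"
      if "f \<in> D" "pos_ty S (fst f) i ValTy" for f i
    proof -
      have "(fst (snd f), i) \<in> cells S D" using that unfolding cells_iff by blast
      then show ?thesis using reflV unfolding induced_atoms_iff tid by blast
    qed
    show ?thesis unfolding schema_rules_closed[OF D X] using at o v by blast
  qed
  \<comment> \<open>Although the \<open>InP\<close> clause for \<open>EqO\<close> has no type test,
    \<open>E\<close> relates only objects, and an object at position \<open>i\<close> forces an
    object position.\<close>
  have InO: "d \<in> induced_arg S D E V f i"
    if "f \<in> D" "i \<le> length (snd (snd f))" "(fact_arg f i, d) \<in> E" for f i d
    using that obj_position(2)[OF D that(1,2)] EA by (auto simp: induced_arg_obj)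
  \<comment> \<open>Related cells lie at value positions, where the argument set is given by
    \<open>V\<close>; the fact \<open>f\<close> on the left exists because its cell is in
    \<open>cells S D\<close>.\<close>
  have InV: "\<exists>f \<in> D. fst (snd f) = t \<and> i \<le> length (snd (snd f)) \<and> fact_arg f' j \<in> induced_arg S D E V f i"
    if f': "f' \<in> D" "j \<le> length (snd (snd f'))" and v: "((t, i), (fst (snd f'), j)) \<in> V" for t i f' j
  proof -
    obtain f where f: "f \<in> D" "fst (snd f) = t" "pos_ty S (fst f) i ValTy"
      using subsetD[OF VA v] unfolding mem_Times_iff fst_conv cells_iff by blast
    obtain R where "pos_ty S R j ValTy"
      using subsetD[OF VA v] unfolding mem_Times_iff snd_conv cells_iff by blast
    then have "1 \<le> j" by (auto simp: pos_ty_def)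
    then have "const_at D (fst (snd f')) j (fact_arg f' j)" using f' by (auto simp: const_at_iff)
    moreover have "\<not> pos_ty S (fst f) i ObjTy" "i \<noteq> 0" "i \<le> length (snd (snd f))"
      using f(3) database_fact[OF D f(1)] by (auto simp: pos_ty_def)
    ultimately show ?thesis using f v by (intro bexI[of _ f]) (auto simp: induced_arg_val)
  qed
  have InI: "(InP, [Cst (fact_arg f 0), Pos i, Cst c]) \<in> ?I \<union> Q"
    if "f \<in> D" "i \<le> length (snd (snd f))" "c \<in> induced_arg S D E V f i" for f i c
    using that unfolding Un_iff induced_atoms_iff by blast
  have 2: "\<forall>r \<in> closure_rules. rule_closed r (?I \<union> Q) M"
    unfolding closure_rules_closed
  proof (intro conjI allI impI)
    fix t i c assume "(AtP, [t, i, c]) \<in> ?I \<union> Q"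
    then show "(DomP, [c]) \<in> ?I \<union> Q" using fact_arg_dbdom by (auto simp del: Un_iff simp: mem induced_atoms_iff)
  next
    fix t c assume "(AtP, [t, Pos 0, c]) \<in> ?I \<union> Q"
    then show "(InP, [t, Pos 0, c]) \<in> ?I \<union> Q"
      by (auto simp del: Un_iff simp: mem induced_atoms_iff induced_arg_0)
  next
    fix t i c d assume "(AtP, [t, i, c]) \<in> ?I \<union> Q \<and> (EqO, [c, d]) \<in> ?I \<union> Q"
    then obtain f i' d' where "t = Cst (fact_arg f 0)" "i = Pos i'" "d = Cst d'" "f \<in> D"
      "i' \<le> length (snd (snd f))" "(fact_arg f i', d') \<in> E"
      by (auto simp del: Un_iff simp: mem induced_atoms_iff)
    then show "(InP, [t, i, d]) \<in> ?I \<union> Q" using InI[OF _ _ InO] by simp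
  next
    fix t i t' j c assume "(EqV, [t, i, t', j]) \<in> ?I \<union> Q \<and> (AtP, [t', j, c]) \<in> ?I \<union> Q"
    then obtain t0 i0 f' j' where "t = Cst (Tid t0)" "i = Pos i0" "c = Cst (fact_arg f' j')"
      "f' \<in> D" "j' \<le> length (snd (snd f'))" "((t0, i0), (fst (snd f'), j')) \<in> V"
      by (auto simp del: Un_iff simp: mem induced_atoms_iff tid)
    then obtain f where "f \<in> D" "fst (snd f) = t0" "i0 \<le> length (snd (snd f))"
      "fact_arg f' j' \<in> induced_arg S D E V f i0"
      using InV by blast
    then show "(InP, [t, i, c]) \<in> ?I \<union> Q"
      using InI[of f i0] tid[of f] \<open>t = _\<close> \<open>i = _\<close> \<open>c = _\<close> by simp
  next
    fix a b c assume "(EqO, [a, b]) \<in> ?I \<union> Q \<and> (EqO, [b, c]) \<in> ?I \<union> Q"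
    then show "(EqO, [a, c]) \<in> ?I \<union> Q"
      using E by (auto simp del: Un_iff simp: mem induced_atoms_iff equiv_def dest: transD)
  next
    fix t i t' j t'' k assume "(EqV, [t, i, t', j]) \<in> ?I \<union> Q \<and> (EqV, [t', j, t'', k]) \<in> ?I \<union> Q"
    then show "(EqV, [t, i, t'', k]) \<in> ?I \<union> Q"
      using V by (auto simp del: Un_iff simp: mem induced_atoms_iff equiv_def dest: transD)
  next
    fix a b assume "(EqO, [a, a]) \<in> ?I \<union> Q \<and> (EqO, [b, b]) \<in> ?I \<union> Q" "(EqO, [a, b]) \<notin> M"
    then show "(NeqO, [a, b]) \<in> ?I \<union> Q"
      using EA QO by (auto simp del: Un_iff simp: mem induced_atoms_iff)
  next
    fix t i t' j assume "(EqV, [t, i, t, i]) \<in> ?I \<union> Q \<and> (EqV, [t', j, t', j]) \<in> ?I \<union> Q"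
      "(EqV, [t, i, t', j]) \<notin> M"
    moreover then obtain s k s' l where "((s, k), (s, k)) \<in> V" "((s', l), (s', l)) \<in> V"
      "t = Cst (Tid s)" "i = Pos k" "t' = Cst (Tid s')" "j = Pos l"
      by (auto simp del: Un_iff simp: mem induced_atoms_iff)
    moreover then have "(s, k) \<in> cells S D" "(s', l) \<in> cells S D" using VA by blast+
    ultimately show "(NeqV, [t, i, t', j]) \<in> ?I \<union> Q"
      using QV by simp
  qed (use E V in \<open>auto simp del: Un_iff simp: mem induced_atoms_iff equiv_def dest: symD\<close>)
  show ?thesis using r 1 2 by blast
qed

lemma RelP_input_facts:
  "(RelP R, xs) \<in> (input_facts sim D :: (('r, 's) pred, ('o, 'v, 't) pcst) gatm set) \<longleftrightarrow>
    (\<exists>f \<in> D. fst f = R \<and> xs = map (\<lambda>i. Cst (fact_arg f i)) [0..<Suc (length (snd (snd f)))])"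
proof -
  have "(RelP R, xs) \<in> (input_facts sim D :: (('r, 's) pred, ('o, 'v, 't) pcst) gatm set) \<longleftrightarrow>
    (RelP R, xs) \<in> (induced_atoms S sim D {} {} :: (('r, 's) pred, ('o, 'v, 't) pcst) gatm set)" for S
    by (auto simp: induced_atoms_def)
  then show ?thesis unfolding induced_atoms_iff by blast
qed

text \<open>Reflexivity comes from the schema clauses, symmetry and transitivity from the closure
  clauses. Restricting to objects and cells gives the carriers that \<open>EqRel_least\<close> asks
  for, even if \<open>X\<close> has further \<open>EqO\<close> or \<open>EqV\<close> atoms.\<close>

lemma closed_equiv:
  fixes X :: "(('r, 's) pred, ('o, 'v, 't) pcst) gatm set"
  assumes D: "database S D"
    and rel: "\<And>R xs. (RelP R, xs) \<in> X \<longleftrightarrow> (RelP R, xs) \<in> input_facts sim D"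
    and closed: "\<And>r. r \<in> schema_rules S \<union> closure_rules \<Longrightarrow> rule_closed r X M"
  shows "equiv (objs D) {(a, b). a \<in> objs D \<and> b \<in> objs D \<and> (EqO, [Cst a, Cst b]) \<in> X}"
    (is "equiv _ ?E")
    and "equiv (cells S D) {((t, i), (t', j)). (t, i) \<in> cells S D \<and> (t', j) \<in> cells S D \<and>
      (EqV, [Cst (Tid t), Pos i, Cst (Tid t'), Pos j]) \<in> X}" (is "equiv _ ?V")
proof -
  have "\<forall>r \<in> closure_rules. rule_closed r X M" using closed by blast
  note c = this[unfolded closure_rules_closed]
  have symO: "\<forall>a b. (EqO, [a, b]) \<in> X \<longrightarrow> (EqO, [b, a]) \<in> X"
    using c by (elim conjE) assumption
  have transO: "\<forall>a b c. (EqO, [a, b]) \<in> X \<and> (EqO, [b, c]) \<in> X \<longrightarrow> (EqO, [a, c]) \<in> X"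
    using c by (elim conjE) assumption
  have symV: "\<forall>t i t' j. (EqV, [t, i, t', j]) \<in> X \<longrightarrow> (EqV, [t', j, t, i]) \<in> X"
    using c by (elim conjE) assumption
  have transV: "\<forall>t i t' j t'' k. (EqV, [t, i, t', j]) \<in> X \<and> (EqV, [t', j, t'', k]) \<in> X \<longrightarrow>
      (EqV, [t, i, t'', k]) \<in> X"
    using c by (elim conjE) assumption
  have X: "(RelP R, xs) \<in> X \<longleftrightarrow>
      (\<exists>f \<in> D. fst f = R \<and> xs = map (\<lambda>i. Cst (fact_arg f i)) [0..<Suc (length (snd (snd f)))])" for R xs
    unfolding rel by (rule RelP_input_facts)
  have "\<forall>r \<in> schema_rules S. rule_closed r X M" using closed by blast
  note s = this[unfolded schema_rules_closed[OF D X]]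
  show "equiv (objs D) ?E"
  proof (rule equivI)
    have "(EqO, [Cst c, Cst c]) \<in> X" if "c \<in> objs D" for c
    proof -
      obtain f i where "f \<in> D" "pos_ty S (fst f) i ObjTy" "c = fact_arg f i"
        using \<open>c \<in> objs D\<close> unfolding objs_iff[OF D] by blast
      then show ?thesis using s by blast
    qed
    then show "refl_on (objs D) ?E" by (auto simp: refl_on_def)
    show "sym ?E" using symO by (auto intro!: symI)
    show "trans ?E"
    proof (rule transI)
      fix a b d assume "(a, b) \<in> ?E" "(b, d) \<in> ?E"
      then show "(a, d) \<in> ?E" using transO[rule_format, of "Cst a" "Cst b" "Cst d"] by simp
    qed
  qed auto
  show "equiv (cells S D) ?V"
  proof (rule equivI)
    have "(EqV, [Cst (Tid t), Pos i, Cst (Tid t), Pos i]) \<in> X" if ti: "(t, i) \<in> cells S D" for t i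
    proof -
      obtain f where f: "f \<in> D" "fst (snd f) = t" "pos_ty S (fst f) i ValTy"
        using ti unfolding cells_iff by blast
      then have "(EqV, [Cst (fact_arg f 0), Pos i, Cst (fact_arg f 0), Pos i]) \<in> X"
        using s by blast
      then show ?thesis using f(2) by (simp add: fact_arg_def)
    qed
    then show "refl_on (cells S D) ?V" by (auto simp: refl_on_def)
    show "sym ?V" using symV by (auto intro!: symI)
    have "((t, i), (t'', k)) \<in> ?V" if "((t, i), (t', j)) \<in> ?V" "((t', j), (t'', k)) \<in> ?V"
      for t i t' j t'' k
      using that transV[rule_format, of "Cst (Tid t)" "Pos i" "Cst (Tid t')" "Pos j" "Cst (Tid t'')" "Pos k"]
      by simp
    then show "trans ?V" by (intro transI) auto
  qed auto
qed

text \<open>\<open>E\<close> and \<open>V\<close> may be smaller than what \<open>X\<close>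
  contains: the description of an induced database is derived without negation, hence is monotone in
  them. This lets intermediate candidates be followed inside a fixed closed set.\<close>

lemma induced_atoms_subset:
  fixes X :: "(('r, 's) pred, ('o, 'v, 't) pcst) gatm set"
  assumes D: "database S D"
    and rel: "\<And>R xs. (RelP R, xs) \<in> X \<longleftrightarrow> (RelP R, xs) \<in> input_facts sim D"
    and F: "input_facts sim D \<subseteq> X"
    and EO: "\<And>a b. (a, b) \<in> E \<Longrightarrow> (EqO, [Cst a, Cst b]) \<in> X"
    and EV: "\<And>t i t' j. ((t, i), (t', j)) \<in> V \<Longrightarrow> (EqV, [Cst (Tid t), Pos i, Cst (Tid t'), Pos j]) \<in> X"
    and closed: "\<And>r. r \<in> schema_rules S \<union> closure_rules \<Longrightarrow> rule_closed r X M"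
  shows "induced_atoms S sim D E V \<subseteq> X"
proof -
  have X: "(RelP R, xs) \<in> X \<longleftrightarrow>
      (\<exists>f \<in> D. fst f = R \<and> xs = map (\<lambda>i. Cst (fact_arg f i)) [0..<Suc (length (snd (snd f)))])" for R xs
    unfolding rel by (rule RelP_input_facts)
  have "\<forall>r \<in> schema_rules S. rule_closed r X M" using closed by blast
  note schema = this[unfolded schema_rules_closed[OF D X]]
  have "\<forall>r \<in> closure_rules. rule_closed r X M" using closed by blast
  note c = this[unfolded closure_rules_closed]
  have at: "(AtP, [Cst (fact_arg f 0), Pos i, Cst (fact_arg f i)]) \<in> X"
    if "f \<in> D" "i \<le> length (snd (snd f))" for f i
    using schema that by blast
  have dom: "(DomP, [Cst c]) \<in> X" if "c \<in> dbdom D" for c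
    using that at c[THEN conjunct1] by (metis dbdom_fact_arg)
  have same: "(SameP, [Cst c, Cst c]) \<in> X" if "c \<in> dbdom D" for c
    using dom[OF that] c[THEN conjunct2, THEN conjunct1] by blast
  have "(InP, [Cst (fact_arg f 0), Pos i, Cst d]) \<in> X"
    if f: "f \<in> D" "i \<le> length (snd (snd f))" and d: "d \<in> induced_arg S D E V f i" for f i d
  proof -
    consider "i = 0" | "pos_ty S (fst f) i ObjTy" | "i \<noteq> 0" "\<not> pos_ty S (fst f) i ObjTy" by blast
    then show ?thesis
    proof cases
      case 1
      then show ?thesis
        using c[THEN conjunct2, THEN conjunct2, THEN conjunct1] at[OF f] d
        by (simp add: induced_arg_0)
    next
      case 2
      then have "(fact_arg f i, d) \<in> E" using d by (simp add: induced_arg_obj)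
      then show ?thesis
        using c[THEN conjunct2, THEN conjunct2, THEN conjunct2, THEN conjunct1] at[OF f] EO by blast
    next
      case 3
      then obtain f' j where f': "((fst (snd f), i), (fst (snd f'), j)) \<in> V" "f' \<in> D"
        "j \<le> length (snd (snd f'))" "d = fact_arg f' j"
        using d by (auto simp: induced_arg_val const_at_iff)
      have "(EqV, [Cst (fact_arg f 0), Pos i, Cst (fact_arg f' 0), Pos j]) \<in> X"
        using EV[OF f'(1)] by (simp add: fact_arg_def)
      then show ?thesis
        using c[THEN conjunct2, THEN conjunct2, THEN conjunct2, THEN conjunct2, THEN conjunct1]
          at[OF f'(2,3)] f'(4) by blast
    qed
  qed
  then show ?thesis
    using F at dom same EO EV unfolding induced_atoms_def by auto
qed

section \<open>Stable models are solutions\<close>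

text \<open>The heads of those instances of meet clauses whose bodies hold in \<open>I\<close>;
  since no \<open>MeetP\<close> atom occurs in a positive body, one round of derivation
  suffices.\<close>

definition meet_atoms ::
  "(('o, 'v, 't) cst, 'r, 's) er_spec \<Rightarrow> (('r, 's) pred, ('o, 'v, 't) pcst) gatm set \<Rightarrow>
   (('r, 's) pred, ('o, 'v, 't) pcst) gatm set" where
  "meet_atoms \<Sigma> I = {(MeetP k, tid_args f (fst (ineq_list \<Sigma> ! k))) | k f. k < length (ineq_list \<Sigma>)
     \<and> meet_lits f (\<lambda>x. x) (fst (ineq_list \<Sigma> ! k)) (snd (ineq_list \<Sigma> ! k)) \<subseteq> I}"

lemma meet_atoms_neg: "a \<in> meet_atoms \<Sigma> I \<Longrightarrow> neg_pred (fst a)"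
  by (auto simp: meet_atoms_def)

lemma rule_closed_Int: "rule_closed r X M \<Longrightarrow> rule_closed r Y M \<Longrightarrow> rule_closed r (X \<inter> Y) M"
  by (simp add: rule_closed_def)

lemma er_program_cases:
  assumes "r \<in> er_program S \<Sigma>"
  obtains (base) "r \<in> schema_rules S \<union> closure_rules"
  | (obj) soft \<rho> where "r = obj_clause soft \<rho>" "\<rho> \<in> hard_obj \<Sigma> \<union> soft_obj \<Sigma>"
      "\<not> soft \<Longrightarrow> \<rho> \<in> hard_obj \<Sigma>"
  | (val) soft \<rho> where "r = val_clause soft \<rho>" "\<rho> \<in> hard_val \<Sigma> \<union> soft_val \<Sigma>"
      "\<not> soft \<Longrightarrow> \<rho> \<in> hard_val \<Sigma>"
  | (meet) k where "r = meet_clause \<Sigma> k" "k < length (ineq_list \<Sigma>)"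
  | (denial) q where "r = denial_clause \<Sigma> q" "q \<in> denials \<Sigma>"
proof -
  consider "r \<in> schema_rules S \<union> closure_rules"
    | \<rho> where "r = obj_clause False \<rho>" "\<rho> \<in> hard_obj \<Sigma>" | \<rho> where "r = obj_clause True \<rho>" "\<rho> \<in> soft_obj \<Sigma>"
    | \<rho> where "r = val_clause False \<rho>" "\<rho> \<in> hard_val \<Sigma>" | \<rho> where "r = val_clause True \<rho>" "\<rho> \<in> soft_val \<Sigma>"
    | k where "r = meet_clause \<Sigma> k" "k < length (ineq_list \<Sigma>)"
    | q where "r = denial_clause \<Sigma> q" "q \<in> denials \<Sigma>"
    using assms unfolding er_program_def by blast
  then show ?thesis by cases (use that in auto)
qed

lemma head_er_program: "r \<in> er_program S \<Sigma> \<Longrightarrow> fst (head r) \<noteq> RelP R"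
  unfolding er_program_def schema_rules_def closure_rules_def
  by (auto simp: rel_rule_def obj_clause_def val_clause_def meet_clause_def denial_clause_def Let_def)

lemma derivable_RelP:
  "(RelP R, xs) \<in> derivable (er_program S \<Sigma>) F M \<longleftrightarrow> (RelP R, xs) \<in> F"
proof
  assume "(RelP R, xs) \<in> derivable (er_program S \<Sigma>) F M"
  then show "(RelP R, xs) \<in> F"
  proof cases
    case (rule r \<theta>)
    then have "fst (head r) = RelP R" by (simp add: ground_atm_def)
    moreover have "fst (head r) \<noteq> RelP R" using rule(2) by (rule head_er_program)
    ultimately show ?thesis by simp
  qed
qed (rule derivable.fact)

text \<open>If the constraint were violated, its compiled body would hold and no
  \<open>MeetP\<close> atom for the chosen tids could be in \<open>M\<close>, since each of those
  records a common element in the induced database. The clause would then derive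
  \<open>FailP\<close>.\<close>

lemma denial_satisfied:
  fixes q :: "(('o, 'v, 't) cst, 'r, 's) cq"
  assumes \<Sigma>: "wf_spec S \<Sigma>" and D: "database S D" and E: "E \<subseteq> objs D \<times> objs D"
    and q: "q \<in> denials \<Sigma>" and X: "induced_atoms S sim D E V \<subseteq> X"
    and meet: "\<And>a. a \<in> M \<Longrightarrow> fst a \<in> range (\<lambda>k. MeetP k) \<Longrightarrow> a \<in> meet_atoms \<Sigma> (induced_atoms S sim D E V)"
    and closed: "rule_closed (denial_clause \<Sigma> q) X M" and fail: "(FailP, []) \<notin> X" "(FailP, []) \<notin> M"
  shows "\<not> sat S sim D E V q"
proof
  assume "sat S sim D E V q"
  then obtain f where f: "body_lits f (\<lambda>x. x) q {} \<subseteq> induced_atoms S sim D E V"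
    and I: "\<forall>\<iota> \<in> ineqs q. \<nexists>g. meet_lits g (\<lambda>x. x) q \<iota> \<subseteq> induced_atoms S sim D E V
         \<and> tid_args g q = tid_args f q"
    unfolding sat_iff_body_lits[OF D E wf_specD(3,4)[OF \<Sigma> q]] by blast
  have "(MeetP k, tid_args f q) \<notin> M"
    if k: "k < length (ineq_list \<Sigma>)" "fst (ineq_list \<Sigma> ! k) = q" for k
  proof
    assume "(MeetP k, tid_args f q) \<in> M"
    then have "(MeetP k, tid_args f q) \<in> meet_atoms \<Sigma> (induced_atoms S sim D E V)"
      using meet by simp
    then obtain g where "meet_lits g (\<lambda>x. x) q (snd (ineq_list \<Sigma> ! k)) \<subseteq> induced_atoms S sim D E V"
      "tid_args g q = tid_args f q"
      using k(2) by (auto simp: meet_atoms_def)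
    moreover have "snd (ineq_list \<Sigma> ! k) \<in> ineqs q" using wf_ineq_list(2)[OF \<Sigma> k(1)] k(2) by simp
    ultimately show False using I by blast
  qed
  then show False
    using closed f X fail unfolding denial_clause_closed[OF wf_specD(3)[OF \<Sigma> q]] by blast
qed

lemma solution_if_stable:
  fixes \<Sigma> :: "(('o, 'v, 't) cst, 'r, 's) er_spec" and D :: "('o, 'v, 't, 'r) fact set"
  assumes \<Sigma>: "wf_spec S \<Sigma>" and D: "database S D"
    and M: "derivable (er_program S \<Sigma>) (input_facts sim D) M = M"
    and EM: "\<And>a b. (EqO, [a, b]) \<in> M \<longleftrightarrow> (\<exists>c d. a = Cst c \<and> b = Cst d \<and> (c, d) \<in> E)"
    and VM: "\<And>a b c d. (EqV, [a, b, c, d]) \<in> M \<longleftrightarrow>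
      (\<exists>t i t' j. a = Cst (Tid t) \<and> b = Pos i \<and> c = Cst (Tid t') \<and> d = Pos j \<and> ((t, i), (t', j)) \<in> V)"
  shows "(E, V) \<in> Sol S \<Sigma> sim D"
proof -
  have closed: "rule_closed r M M" if "r \<in> er_program S \<Sigma>" for r
    using rule_closed_derivable[OF that, of "input_facts sim D" M] M by simp
  have base: "rule_closed r M M" if "r \<in> schema_rules S \<union> closure_rules" for r
    using that by (intro closed) (auto simp: er_program_def)
  have input: "input_facts sim D \<subseteq> M"
    using derivable.fact[of _ "input_facts sim D" "er_program S \<Sigma>" M] unfolding M by blast
  have rel: "(RelP R, xs) \<in> M \<longleftrightarrow> (RelP R, xs) \<in> input_facts sim D" for R xs
    using derivable_RelP[of R xs S \<Sigma> "input_facts sim D" M] unfolding M .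
  have IM: "induced_atoms S sim D E V \<subseteq> M"
    by (rule induced_atoms_subset[OF D rel input _ _ base]) (simp_all add: EM VM)
  \<comment> \<open>Nothing yet confines \<open>E\<close> and \<open>V\<close> to objects and cells.
    The restrictions are finite equivalences; that they lose nothing follows once \<open>M\<close>
    is bounded.\<close>
  define E' where "E' = E \<inter> objs D \<times> objs D"
  define V' where "V' = V \<inter> cells S D \<times> cells S D"
  have "E' = {(a, b). a \<in> objs D \<and> b \<in> objs D \<and> (EqO, [Cst a, Cst b]) \<in> M}"
    by (auto simp: E'_def EM)
  then have E': "equiv (objs D) E'" using closed_equiv(1)[OF D rel base] by simp
  have "V' = {((t, i), (t', j)). (t, i) \<in> cells S D \<and> (t', j) \<in> cells S D \<and>
      (EqV, [Cst (Tid t), Pos i, Cst (Tid t'), Pos j]) \<in> M}"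
    by (auto simp: V'_def VM)
  then have V': "equiv (cells S D) V'" using closed_equiv(2)[OF D rel base] by simp
  have finD: "finite D" using D by (simp add: database_def)
  have finO: "finite (objs D)"
  proof (rule finite_subset)
    show "objs D \<subseteq> (\<Union>f \<in> D. set (snd (snd f)))" by (force simp: objs_def)
  qed (use finD in simp)
  have finC: "finite (cells S D)"
  proof (rule finite_subset)
    show "cells S D \<subseteq> (\<Union>f \<in> D. {fst (snd f)} \<times> {..length (the (S (fst f)))})"
    proof clarify
      fix t i assume "(t, i) \<in> cells S D"
      then obtain f where "f \<in> D" "fst (snd f) = t" "pos_ty S (fst f) i ValTy"
        unfolding cells_iff by blast
      then show "(t, i) \<in> (\<Union>f \<in> D. {fst (snd f)} \<times> {..length (the (S (fst f)))})"
        using pos_tyD[of S "fst f" i ValTy] by (intro UN_I[of f]) simp_all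
    qed
  qed (use finD in simp)
  have fin: "finite E'" "finite V'"
    using finO finC by (simp_all add: E'_def V'_def)
  \<comment> \<open>Finiteness of \<open>E'\<close> and \<open>V'\<close> bounds the total
    cardinality, so a candidate of maximal size below them exists.\<close>
  define P where "P = (\<lambda>(E0, V0). candidate S \<Sigma> sim D E0 V0 \<and> E0 \<subseteq> E' \<and> V0 \<subseteq> V')"
  have init: "P (EqRel {} (objs D), EqRel {} (cells S D))"
    unfolding P_def using E' V' by (simp add: candidate.init EqRel_least)
  have bound: "\<forall>p. P p \<longrightarrow> card (fst p) + card (snd p) < Suc (card E' + card V')"
    using fin by (auto simp: P_def less_Suc_eq_le intro!: add_mono card_mono)
  obtain E0 V0 where P0: "P (E0, V0)"
    and max: "\<And>p. P p \<Longrightarrow> card (fst p) + card (snd p) \<le> card E0 + card V0"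
    using ex_has_greatest_nat[OF init bound] by fastforce
  have cand: "candidate S \<Sigma> sim D E0 V0" and sub: "E0 \<subseteq> E'" "V0 \<subseteq> V'"
    using P0 by (simp_all add: P_def)
  have maxE: "E1 = E0" if "P (E1, V0)" "E0 \<subseteq> E1" for E1
  proof -
    have "finite E1" using that(1) fin(1) finite_subset by (auto simp: P_def)
    moreover have "card E1 \<le> card E0" using max[OF that(1)] by simp
    ultimately show ?thesis using card_seteq[of E1 E0] that(2) by simp
  qed
  have maxV: "V1 = V0" if "P (E0, V1)" "V0 \<subseteq> V1" for V1
  proof -
    have "finite V1" using that(1) fin(2) finite_subset by (auto simp: P_def)
    moreover have "card V1 \<le> card V0" using max[OF that(1)] by simp
    ultimately show ?thesis using card_seteq[of V1 V0] that(2) by simp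
  qed
  have eq0: "equiv (objs D) E0" "equiv (cells S D) V0" using candidate_equiv[OF \<Sigma> cand] by simp_all
  have E0: "E0 \<subseteq> objs D \<times> objs D" using eq0(1) by (rule equiv_type)
  let ?I = "induced_atoms S sim D E0 V0"
  define Q where "Q = {a :: (('r, 's) pred, ('o, 'v, 't) pcst) gatm. fst a \<in> {NeqO, NeqV}}
    \<union> {a. a = (FailP, []) \<and> (FailP, []) \<notin> M} \<union> meet_atoms \<Sigma> ?I"
  have Qneg: "neg_pred (fst a)" if "a \<in> Q" for a
    using that meet_atoms_neg[of a \<Sigma>] by (auto simp: Q_def)
  have body: "body_lits f (\<lambda>x. x) q A \<subseteq> ?I" if "body_lits f (\<lambda>x. x) q A \<subseteq> (?I \<union> Q) \<inter> M" for f q A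
    using that Qneg body_lits_pos by blast
  \<comment> \<open>Intersecting with \<open>M\<close> ensures that a body true in this set is true
    in \<open>M\<close>; closedness of \<open>M\<close> then puts the head, and with it the new
    merge, into \<open>M\<close>.\<close>
  have X_closed: "rule_closed r ((?I \<union> Q) \<inter> M) M" if r: "r \<in> er_program S \<Sigma>" for r
  proof -
    have obj_step: "rule_closed r ((?I \<union> Q) \<inter> M) M"
      if r': "r = obj_clause soft \<rho>" and \<rho>: "\<rho> \<in> hard_obj \<Sigma> \<union> soft_obj \<Sigma>" for soft \<rho>
    proof -
      note w = wf_obj_ruleD[OF wf_specD(1)[OF \<Sigma> \<rho>]]
      show ?thesis
        unfolding r' obj_clause_closed[OF w(1,3,4)]
      proof (intro allI impI)
        fix f :: "(('o, 'v, 't) cst, 'r, 's) role \<Rightarrow> ('o, 'v, 't) pcst"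
        let ?h = "(EqO, [f (Wit (Var (ox \<rho>))), f (Wit (Var (oy \<rho>)))])"
        assume b: "body_lits f (\<lambda>x. x) (obody \<rho>) {Var (ox \<rho>), Var (oy \<rho>)} \<subseteq> (?I \<union> Q) \<inter> M"
          and n: "soft \<longrightarrow> (NeqO, [f (Wit (Var (ox \<rho>))), f (Wit (Var (oy \<rho>)))]) \<notin> M"
        have hM: "?h \<in> M"
          using closed[OF r, unfolded r' obj_clause_closed[OF w(1,3,4)]] b n by blast
        obtain x y where xy: "f (Wit (Var (ox \<rho>))) = Cst x" "f (Wit (Var (oy \<rho>))) = Cst y"
          "(x, y) \<in> answers S sim D E0 V0 (obody \<rho>) (ox \<rho>) (oy \<rho>)"
          using body_lits_answers[OF D E0 w body[OF b]] by blast
        have "(x, y) \<in> E'"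
          using hM EM xy obj_answers[OF E0 wf_specD(1)[OF \<Sigma> \<rho>] xy(3)] by (simp add: E'_def)
        then have "EqRel (E0 \<union> {(x, y)}) (objs D) \<subseteq> E'" using sub(1) by (intro EqRel_least[OF E']) simp
        \<comment> \<open>The enlarged relation is again part of a candidate below \<open>E'\<close>
          and \<open>V'\<close>, so maximality leaves no room for growth.\<close>
        then have "EqRel (E0 \<union> {(x, y)}) (objs D) = E0"
          using candidate.obj[OF cand \<rho> xy(3)] sub(2) subset_EqRel[of "E0 \<union> {(x, y)}" "objs D"]
          by (intro maxE) (simp_all add: P_def)
        then have "(x, y) \<in> E0" using subset_EqRel[of "E0 \<union> {(x, y)}" "objs D"] by blast
        then show "?h \<in> (?I \<union> Q) \<inter> M" using hM xy(1,2) by (simp add: induced_atoms_iff)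
      qed
    qed
    have val_step: "rule_closed r ((?I \<union> Q) \<inter> M) M"
      if r': "r = val_clause soft \<rho>" and \<rho>: "\<rho> \<in> hard_val \<Sigma> \<union> soft_val \<Sigma>" for soft \<rho>
    proof -
      note w = wf_val_ruleD[OF wf_specD(2)[OF \<Sigma> \<rho>]]
      show ?thesis
        unfolding r' val_clause_closed[OF w(1,3,4)]
      proof (intro allI impI)
        fix f :: "(('o, 'v, 't) cst, 'r, 's) role \<Rightarrow> ('o, 'v, 't) pcst"
        let ?h = "(EqV, [f (Wit (Var (vx \<rho>))), Pos (vi \<rho>), f (Wit (Var (vy \<rho>))), Pos (vj \<rho>)])"
        assume b: "body_lits f (\<lambda>x. x) (vbody \<rho>) {Var (vx \<rho>), Var (vy \<rho>)} \<subseteq> (?I \<union> Q) \<inter> M"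
          and n: "soft \<longrightarrow>
            (NeqV, [f (Wit (Var (vx \<rho>))), Pos (vi \<rho>), f (Wit (Var (vy \<rho>))), Pos (vj \<rho>)]) \<notin> M"
        have hM: "?h \<in> M"
          using closed[OF r, unfolded r' val_clause_closed[OF w(1,3,4)]] b n by blast
        obtain x y where xy: "f (Wit (Var (vx \<rho>))) = Cst x" "f (Wit (Var (vy \<rho>))) = Cst y"
          "(x, y) \<in> answers S sim D E0 V0 (vbody \<rho>) (vx \<rho>) (vy \<rho>)"
          using body_lits_answers[OF D E0 w body[OF b]] by blast
        obtain t t' where t: "x = Tid t" "y = Tid t'" "(t, vi \<rho>) \<in> cells S D" "(t', vj \<rho>) \<in> cells S D"
          using val_answers[OF E0 wf_specD(2)[OF \<Sigma> \<rho>] xy(3)] by blast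
        let ?p = "((t, vi \<rho>), (t', vj \<rho>))"
        have "?p \<in> V'" using hM VM xy t by (simp add: V'_def)
        then have "EqRel (V0 \<union> {?p}) (cells S D) \<subseteq> V'" using sub(2) by (intro EqRel_least[OF V']) simp
        then have "EqRel (V0 \<union> {?p}) (cells S D) = V0"
          using candidate.val[OF cand \<rho> xy(3)[unfolded t(1,2)]] sub(1) subset_EqRel[of "V0 \<union> {?p}" "cells S D"]
          by (intro maxV) (simp_all add: P_def)
        then have "?p \<in> V0" using subset_EqRel[of "V0 \<union> {?p}" "cells S D"] by blast
        then show "?h \<in> (?I \<union> Q) \<inter> M" using hM xy(1,2) t by (simp add: induced_atoms_iff)
      qed
    qed
    have meet_step: "rule_closed r (?I \<union> Q) M" if r': "r = meet_clause \<Sigma> k" and k: "k < length (ineq_list \<Sigma>)" for k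
    proof -
      have q: "wf_cq S (fst (ineq_list \<Sigma> ! k))" using wf_specD(3)[OF \<Sigma> wf_ineq_list(1)[OF \<Sigma> k]] .
      have "meet_lits f (\<lambda>x. x) (fst (ineq_list \<Sigma> ! k)) (snd (ineq_list \<Sigma> ! k)) \<subseteq> ?I"
        if "meet_lits f (\<lambda>x. x) (fst (ineq_list \<Sigma> ! k)) (snd (ineq_list \<Sigma> ! k)) \<subseteq> ?I \<union> Q" for f
        using that Qneg meet_lits_pos by blast
      then show ?thesis
        unfolding r' meet_clause_closed[OF q] using k unfolding Q_def meet_atoms_def by blast
    qed
    have denial_step: "rule_closed r (?I \<union> Q) M" if r': "r = denial_clause \<Sigma> q" and q: "q \<in> denials \<Sigma>" for q
      unfolding r' denial_clause_closed[OF wf_specD(3)[OF \<Sigma> q]] by (simp add: Q_def)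
    have bas: "rule_closed r (?I \<union> Q) M" if "r \<in> schema_rules S \<union> closure_rules"
      using that by (intro base_rules_closed[OF D eq0 Qneg]) (simp_all add: Q_def)
    have int: "rule_closed r ((?I \<union> Q) \<inter> M) M" if "rule_closed r (?I \<union> Q) M"
      using that closed[OF r] by (rule rule_closed_Int)
    from r show ?thesis
    proof (cases rule: er_program_cases)
      case base
      then show ?thesis by (intro int bas)
    next
      case (obj soft \<rho>)
      then show ?thesis by (intro obj_step)
    next
      case (val soft \<rho>)
      then show ?thesis by (intro val_step)
    next
      case (meet k)
      then show ?thesis by (intro int meet_step)
    next
      case (denial q)
      then show ?thesis by (intro int denial_step)
    qed
  qed
  have "input_facts sim D \<subseteq> (?I \<union> Q) \<inter> M" using input by (auto simp: induced_atoms_def)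
  then have "derivable (er_program S \<Sigma>) (input_facts sim D) M \<subseteq> (?I \<union> Q) \<inter> M"
    using X_closed by (rule derivable_subset)
  then have MX: "M \<subseteq> ?I \<union> Q" unfolding M by blast
  have "(a, b) \<in> E0" if "(a, b) \<in> E" for a b
  proof -
    have "(EqO, [Cst a, Cst b]) \<in> ?I \<union> Q" using MX EM that by blast
    then show ?thesis using Qneg by (fastforce simp: induced_atoms_iff)
  qed
  then have EE: "E = E0" using sub(1) by (auto simp: E'_def)
  have "((t, i), (t', j)) \<in> V0" if "((t, i), (t', j)) \<in> V" for t i t' j
  proof -
    have "(EqV, [Cst (Tid t), Pos i, Cst (Tid t'), Pos j]) \<in> ?I \<union> Q" using MX VM that by blast
    then show ?thesis using Qneg by (fastforce simp: induced_atoms_iff)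
  qed
  then have VV: "V = V0" using sub(2) by (auto simp: V'_def)
  have hard_obj: "answers S sim D E V (obody \<rho>) (ox \<rho>) (oy \<rho>) \<subseteq> E" if \<rho>: "\<rho> \<in> hard_obj \<Sigma>" for \<rho>
  proof clarify
    fix x y assume xy: "(x, y) \<in> answers S sim D E V (obody \<rho>) (ox \<rho>) (oy \<rho>)"
    have \<rho>': "\<rho> \<in> hard_obj \<Sigma> \<union> soft_obj \<Sigma>" using \<rho> by blast
    note w = wf_obj_ruleD[OF wf_specD(1)[OF \<Sigma> \<rho>']]
    obtain f where f: "body_lits f (\<lambda>x. x) (obody \<rho>) {Var (ox \<rho>), Var (oy \<rho>)} \<subseteq> ?I"
      "f (Wit (Var (ox \<rho>))) = Cst x" "f (Wit (Var (oy \<rho>))) = Cst y"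
      using answers_body_lits[OF D E0 w xy[unfolded EE VV]] by blast
    have "rule_closed (obj_clause False \<rho>) M M" using \<rho> by (intro closed) (simp add: er_program_def)
    then have "(EqO, [Cst x, Cst y]) \<in> M"
      using f IM unfolding obj_clause_closed[OF w(1,3,4)] EE VV by fastforce
    then show "(x, y) \<in> E" using EM by simp
  qed
  have hard_val: "((t, vi \<rho>), (t', vj \<rho>)) \<in> V" if \<rho>: "\<rho> \<in> hard_val \<Sigma>"
    and xy: "(Tid t, Tid t') \<in> answers S sim D E V (vbody \<rho>) (vx \<rho>) (vy \<rho>)" for \<rho> t t'
  proof -
    have \<rho>': "\<rho> \<in> hard_val \<Sigma> \<union> soft_val \<Sigma>" using \<rho> by blast
    note w = wf_val_ruleD[OF wf_specD(2)[OF \<Sigma> \<rho>']]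
    obtain f where f: "body_lits f (\<lambda>x. x) (vbody \<rho>) {Var (vx \<rho>), Var (vy \<rho>)} \<subseteq> ?I"
      "f (Wit (Var (vx \<rho>))) = Cst (Tid t)" "f (Wit (Var (vy \<rho>))) = Cst (Tid t')"
      using answers_body_lits[OF D E0 w xy[unfolded EE VV]] by blast
    have "rule_closed (val_clause False \<rho>) M M" using \<rho> by (intro closed) (simp add: er_program_def)
    then have "(EqV, [Cst (Tid t), Pos (vi \<rho>), Cst (Tid t'), Pos (vj \<rho>)]) \<in> M"
      using f IM unfolding val_clause_closed[OF w(1,3,4)] EE VV by fastforce
    then show ?thesis using VM by simp
  qed
  have fail: "(FailP, []) \<notin> M"
  proof
    assume "(FailP, []) \<in> M"
    moreover have "(FailP, []) \<notin> ?I" using induced_atoms_pos[of _ S sim D E0 V0] by fastforce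
    ultimately have "(FailP, []) \<in> Q" using MX by blast
    then show False using \<open>(FailP, []) \<in> M\<close> by (auto simp: Q_def meet_atoms_def)
  qed
  have "\<not> sat S sim D E V q" if q: "q \<in> denials \<Sigma>" for q
    unfolding EE VV
  proof (rule denial_satisfied[OF \<Sigma> D E0 q _ _ _ fail fail])
    show "?I \<subseteq> M" using IM unfolding EE VV .
    show "a \<in> meet_atoms \<Sigma> ?I" if "a \<in> M" "fst a \<in> range (\<lambda>k. MeetP k)" for a
    proof -
      have "neg_pred (fst a)" using that(2) by auto
      then have "a \<in> Q" using MX that(1) induced_atoms_pos by blast
      then show ?thesis using that(2) by (auto simp: Q_def)
    qed
    show "rule_closed (denial_clause \<Sigma> q) M M" using q by (intro closed) (simp add: er_program_def)
  qed
  then show ?thesis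
    using cand hard_obj hard_val unfolding Sol_def EE VV by simp
qed

section \<open>Solutions are stable models\<close>

text \<open>\<open>FailP\<close> is absent, and \<open>NeqO\<close> and \<open>NeqV\<close> hold
  exactly the complements of \<open>E\<close> and \<open>V\<close> over objects and cells; an
  applicable soft clause is thus blocked precisely when it would merge beyond the solution.\<close>

definition solution_model ::
  "'r schema \<Rightarrow> (('o, 'v, 't) cst, 'r, 's) er_spec \<Rightarrow> ('s \<Rightarrow> ('o, 'v, 't) cst rel) \<Rightarrow>
   ('o, 'v, 't, 'r) fact set \<Rightarrow> ('o, 'v, 't) cst rel \<Rightarrow> 't cell rel \<Rightarrow>
   (('r, 's) pred, ('o, 'v, 't) pcst) gatm set" where
  "solution_model S \<Sigma> sim D E V = induced_atoms S sim D E V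
     \<union> ({(NeqO, [Cst a, Cst b]) | a b. a \<in> objs D \<and> b \<in> objs D \<and> (a, b) \<notin> E}
     \<union> {(NeqV, [Cst (Tid t), Pos i, Cst (Tid t'), Pos j]) | t i t' j.
          (t, i) \<in> cells S D \<and> (t', j) \<in> cells S D \<and> ((t, i), (t', j)) \<notin> V}
     \<union> meet_atoms \<Sigma> (induced_atoms S sim D E V))"

lemma EqO_solution_model:
  "(EqO, xs) \<in> solution_model S \<Sigma> sim D E V \<longleftrightarrow> (\<exists>a b. xs = [Cst a, Cst b] \<and> (a, b) \<in> E)"
  by (auto simp: solution_model_def induced_atoms_iff meet_atoms_def)

lemma EqV_solution_model:
  "(EqV, xs) \<in> solution_model S \<Sigma> sim D E V \<longleftrightarrow>
    (\<exists>t i t' j. xs = [Cst (Tid t), Pos i, Cst (Tid t'), Pos j] \<and> ((t, i), (t', j)) \<in> V)"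
  by (auto simp: solution_model_def induced_atoms_iff meet_atoms_def)

lemma NeqO_solution_model:
  "(NeqO, xs) \<in> solution_model S \<Sigma> sim D E V \<longleftrightarrow>
    (\<exists>a b. xs = [Cst a, Cst b] \<and> a \<in> objs D \<and> b \<in> objs D \<and> (a, b) \<notin> E)"
  using induced_atoms_pos[of "(NeqO, xs)" S sim D E V] by (auto simp: solution_model_def meet_atoms_def)

lemma NeqV_solution_model:
  "(NeqV, xs) \<in> solution_model S \<Sigma> sim D E V \<longleftrightarrow>
    (\<exists>t i t' j. xs = [Cst (Tid t), Pos i, Cst (Tid t'), Pos j] \<and>
      (t, i) \<in> cells S D \<and> (t', j) \<in> cells S D \<and> ((t, i), (t', j)) \<notin> V)"
  using induced_atoms_pos[of "(NeqV, xs)" S sim D E V] by (auto simp: solution_model_def meet_atoms_def)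

text \<open>Closedness of the model gives one inclusion: hard clauses by the solution conditions,
  soft ones because unmerged pairs are blocked. For the other, the generation of the solution as a
  candidate is replayed inside the derivable atoms.\<close>

lemma stable_if_solution:
  fixes \<Sigma> :: "(('o, 'v, 't) cst, 'r, 's) er_spec" and D :: "('o, 'v, 't, 'r) fact set"
  assumes \<Sigma>: "wf_spec S \<Sigma>" and D: "database S D" and sol: "(E, V) \<in> Sol S \<Sigma> sim D"
  shows "derivable (er_program S \<Sigma>) (input_facts sim D) (solution_model S \<Sigma> sim D E V)
    = solution_model S \<Sigma> sim D E V"
proof -
  let ?I = "induced_atoms S sim D E V" and ?M = "solution_model S \<Sigma> sim D E V"
  have cand: "candidate S \<Sigma> sim D E V"
    and hard_obj: "\<And>\<rho> a b. \<rho> \<in> hard_obj \<Sigma> \<Longrightarrow>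
      (a, b) \<in> answers S sim D E V (obody \<rho>) (ox \<rho>) (oy \<rho>) \<Longrightarrow> (a, b) \<in> E"
    and hard_val: "\<And>\<rho> t t'. \<rho> \<in> hard_val \<Sigma> \<Longrightarrow>
      (Tid t, Tid t') \<in> answers S sim D E V (vbody \<rho>) (vx \<rho>) (vy \<rho>) \<Longrightarrow>
      ((t, vi \<rho>), (t', vj \<rho>)) \<in> V"
    and denials: "\<And>q. q \<in> denials \<Sigma> \<Longrightarrow> \<not> sat S sim D E V q"
    using sol unfolding Sol_def by blast+
  have eq: "equiv (objs D) E" "equiv (cells S D) V" using candidate_equiv[OF \<Sigma> cand] by simp_all
  have E: "E \<subseteq> objs D \<times> objs D" using eq(1) by (rule equiv_type)
  define Q where "Q = {(NeqO, [Cst a, Cst b]) | a b. a \<in> objs D \<and> b \<in> objs D \<and> (a, b) \<notin> E}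
     \<union> {(NeqV, [Cst (Tid t), Pos i, Cst (Tid t'), Pos j]) | t i t' j.
          (t, i) \<in> cells S D \<and> (t', j) \<in> cells S D \<and> ((t, i), (t', j)) \<notin> V}
     \<union> meet_atoms \<Sigma> ?I"
  have MQ: "?M = ?I \<union> Q" by (simp add: solution_model_def Q_def)
  have Qneg: "neg_pred (fst a)" if "a \<in> Q" for a
    using that meet_atoms_neg[of a \<Sigma>] by (auto simp: Q_def)
  have body: "L \<subseteq> ?I" if "L \<subseteq> ?M" "\<And>a. a \<in> L \<Longrightarrow> \<not> neg_pred (fst a)" for L
    using that Qneg unfolding MQ by blast
  have body_I: "body_lits f (\<lambda>x. x) q A \<subseteq> ?I" if "body_lits f (\<lambda>x. x) q A \<subseteq> ?M" for f q A
    using that by (rule body) (rule body_lits_pos)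
  have "derivable (er_program S \<Sigma>) (input_facts sim D) ?M \<subseteq> ?M"
  proof (rule derivable_subset)
    show "input_facts sim D \<subseteq> ?M" by (auto simp: solution_model_def induced_atoms_def)
    fix r assume "r \<in> er_program S \<Sigma>"
    then show "rule_closed r ?M ?M"
    proof (cases rule: er_program_cases)
      case base
      show ?thesis
        unfolding MQ
      proof (rule base_rules_closed[OF D eq Qneg _ _ base])
        fix a b assume "a \<in> objs D" "b \<in> objs D" "(EqO, [Cst a, Cst b]) \<notin> ?I \<union> Q"
        then show "(NeqO, [Cst a, Cst b]) \<in> Q" by (auto simp: Q_def induced_atoms_iff)
      next
        fix t i t' j assume "(t, i) \<in> cells S D" "(t', j) \<in> cells S D"
          "(EqV, [Cst (Tid t), Pos i, Cst (Tid t'), Pos j]) \<notin> ?I \<union> Q"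
        then show "(NeqV, [Cst (Tid t), Pos i, Cst (Tid t'), Pos j]) \<in> Q"
          by (auto simp: Q_def induced_atoms_iff)
      qed
    next
      case (obj soft \<rho>)
      note w = wf_obj_ruleD[OF wf_specD(1)[OF \<Sigma> obj(2)]]
      show ?thesis
        unfolding obj(1) obj_clause_closed[OF w(1,3,4)]
      proof (intro allI impI)
        fix f :: "(('o, 'v, 't) cst, 'r, 's) role \<Rightarrow> ('o, 'v, 't) pcst"
        assume b: "body_lits f (\<lambda>x. x) (obody \<rho>) {Var (ox \<rho>), Var (oy \<rho>)} \<subseteq> ?M"
          and n: "soft \<longrightarrow> (NeqO, [f (Wit (Var (ox \<rho>))), f (Wit (Var (oy \<rho>)))]) \<notin> ?M"
        obtain x y where xy: "f (Wit (Var (ox \<rho>))) = Cst x" "f (Wit (Var (oy \<rho>))) = Cst y"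
          "(x, y) \<in> answers S sim D E V (obody \<rho>) (ox \<rho>) (oy \<rho>)"
          using body_lits_answers[OF D E w body_I[OF b]] by blast
        have "(x, y) \<in> E"
        proof (cases soft)
          case True
          \<comment> \<open>If the pair of objects were outside \<open>E\<close>, its
            \<open>NeqO\<close> atom would be in the model, contrary to \<open>n\<close>.\<close>
          then show ?thesis
            using n obj_answers[OF E wf_specD(1)[OF \<Sigma> obj(2)] xy(3)]
            unfolding xy(1,2) NeqO_solution_model by blast
        next
          case False
          then show ?thesis using hard_obj[OF obj(3) xy(3)] by simp
        qed
        then show "(EqO, [f (Wit (Var (ox \<rho>))), f (Wit (Var (oy \<rho>)))]) \<in> ?M"
          using xy(1,2) by (simp add: EqO_solution_model)
      qed
    next
      case (val soft \<rho>)
      note w = wf_val_ruleD[OF wf_specD(2)[OF \<Sigma> val(2)]]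
      show ?thesis
        unfolding val(1) val_clause_closed[OF w(1,3,4)]
      proof (intro allI impI)
        fix f :: "(('o, 'v, 't) cst, 'r, 's) role \<Rightarrow> ('o, 'v, 't) pcst"
        assume b: "body_lits f (\<lambda>x. x) (vbody \<rho>) {Var (vx \<rho>), Var (vy \<rho>)} \<subseteq> ?M"
          and n: "soft \<longrightarrow>
            (NeqV, [f (Wit (Var (vx \<rho>))), Pos (vi \<rho>), f (Wit (Var (vy \<rho>))), Pos (vj \<rho>)]) \<notin> ?M"
        obtain x y where xy: "f (Wit (Var (vx \<rho>))) = Cst x" "f (Wit (Var (vy \<rho>))) = Cst y"
          "(x, y) \<in> answers S sim D E V (vbody \<rho>) (vx \<rho>) (vy \<rho>)"
          using body_lits_answers[OF D E w body_I[OF b]] by blast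
        obtain t t' where t: "x = Tid t" "y = Tid t'" "(t, vi \<rho>) \<in> cells S D" "(t', vj \<rho>) \<in> cells S D"
          using val_answers[OF E wf_specD(2)[OF \<Sigma> val(2)] xy(3)] by blast
        have "((t, vi \<rho>), (t', vj \<rho>)) \<in> V"
        proof (cases soft)
          case True
          then show ?thesis using n t unfolding xy(1,2) NeqV_solution_model by blast
        next
          case False
          then show ?thesis using hard_val[OF val(3) xy(3)[unfolded t(1,2)]] by simp
        qed
        then show "(EqV, [f (Wit (Var (vx \<rho>))), Pos (vi \<rho>), f (Wit (Var (vy \<rho>))), Pos (vj \<rho>)]) \<in> ?M"
          using xy(1,2) t(1,2) by (simp add: EqV_solution_model)
      qed
    next
      case (meet k)
      have q: "wf_cq S (fst (ineq_list \<Sigma> ! k))"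
        using wf_specD(3)[OF \<Sigma> wf_ineq_list(1)[OF \<Sigma> meet(2)]] .
      show ?thesis
        unfolding meet(1) meet_clause_closed[OF q]
      proof (intro allI impI)
        fix f :: "(('o, 'v, 't) cst, 'r, 's) role \<Rightarrow> ('o, 'v, 't) pcst"
        assume "meet_lits f (\<lambda>x. x) (fst (ineq_list \<Sigma> ! k)) (snd (ineq_list \<Sigma> ! k)) \<subseteq> ?M"
        then have "meet_lits f (\<lambda>x. x) (fst (ineq_list \<Sigma> ! k)) (snd (ineq_list \<Sigma> ! k)) \<subseteq> ?I"
          by (rule body) (rule meet_lits_pos)
        then show "(MeetP k, tid_args f (fst (ineq_list \<Sigma> ! k))) \<in> ?M"
          using meet(2) unfolding MQ Q_def meet_atoms_def by blast
      qed
    next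
      case (denial q)
      note q = wf_specD(3,4)[OF \<Sigma> denial(2)]
      show ?thesis
        unfolding denial(1) denial_clause_closed[OF q(1)]
      proof (intro allI impI)
        fix f :: "(('o, 'v, 't) cst, 'r, 's) role \<Rightarrow> ('o, 'v, 't) pcst"
        assume b: "body_lits f (\<lambda>x. x) q {} \<subseteq> ?M"
          and n: "(FailP, []) \<notin> ?M \<and> (\<forall>k. k < length (ineq_list \<Sigma>) \<and> fst (ineq_list \<Sigma> ! k) = q \<longrightarrow>
            (MeetP k, tid_args f q) \<notin> ?M)"
        have "\<not> (meet_lits g (\<lambda>x. x) q \<iota> \<subseteq> ?I \<and> tid_args g q = tid_args f q)"
          if \<iota>: "\<iota> \<in> ineqs q" for \<iota> g
        proof
          assume g: "meet_lits g (\<lambda>x. x) q \<iota> \<subseteq> ?I \<and> tid_args g q = tid_args f q"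
          have "(q, \<iota>) \<in> set (ineq_list \<Sigma>)" using set_ineq_list[OF \<Sigma>] denial(2) \<iota> by simp
          then obtain k where k: "k < length (ineq_list \<Sigma>)" "ineq_list \<Sigma> ! k = (q, \<iota>)"
            by (metis in_set_conv_nth)
          have "(MeetP k, tid_args g q) \<in> meet_atoms \<Sigma> ?I"
            unfolding meet_atoms_def using k g by (auto intro!: exI[of _ k] exI[of _ g])
          then show False using n k g unfolding MQ Q_def by simp
        qed
        \<comment> \<open>An applicable instance would make the body of the constraint satisfied,
          which a solution forbids; the clause is thus closed vacuously.\<close>
        then have "sat S sim D E V q"
          unfolding sat_iff_body_lits[OF D E q] using body_I[OF b] by blast
        then show "(FailP, []) \<in> ?M" using denials[OF denial(2)] by blast
      qed
    qed
  qed
  moreover have "?M \<subseteq> derivable (er_program S \<Sigma>) (input_facts sim D) ?M" (is "_ \<subseteq> ?X")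
  proof -
    have closed: "rule_closed r ?X ?M" if "r \<in> er_program S \<Sigma>" for r
      using that by (rule rule_closed_derivable)
    have base: "rule_closed r ?X ?M" if "r \<in> schema_rules S \<union> closure_rules" for r
      using that by (intro closed) (auto simp: er_program_def)
    have input: "input_facts sim D \<subseteq> ?X" by (auto intro: derivable.fact)
    have rel: "(RelP R, xs) \<in> ?X \<longleftrightarrow> (RelP R, xs) \<in> input_facts sim D" for R xs
      by (rule derivable_RelP)
    have IX: "induced_atoms S sim D E1 V1 \<subseteq> ?X"
      if "\<And>a b. (a, b) \<in> E1 \<Longrightarrow> (EqO, [Cst a, Cst b]) \<in> ?X"
        "\<And>t i t' j. ((t, i), (t', j)) \<in> V1 \<Longrightarrow> (EqV, [Cst (Tid t), Pos i, Cst (Tid t'), Pos j]) \<in> ?X"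
      for E1 V1
      by (rule induced_atoms_subset[OF D rel input that base])
    have "\<forall>r \<in> closure_rules. rule_closed r ?X ?M" using base by blast
    note c = this[unfolded closure_rules_closed]
    have neqO: "\<forall>a b. (EqO, [a, a]) \<in> ?X \<and> (EqO, [b, b]) \<in> ?X \<longrightarrow> (EqO, [a, b]) \<notin> ?M \<longrightarrow>
        (NeqO, [a, b]) \<in> ?X"
      using c by (elim conjE) assumption
    have neqV: "\<forall>t i t' j. (EqV, [t, i, t, i]) \<in> ?X \<and> (EqV, [t', j, t', j]) \<in> ?X \<longrightarrow>
        (EqV, [t, i, t', j]) \<notin> ?M \<longrightarrow> (NeqV, [t, i, t', j]) \<in> ?X"
      using c by (elim conjE) assumption
    \<comment> \<open>The derived pairs form equivalences, so they absorb the \<open>EqRel\<close>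
      taken in each candidate step.\<close>
    define ED where "ED = {(a, b). a \<in> objs D \<and> b \<in> objs D \<and> (EqO, [Cst a, Cst b]) \<in> ?X}"
    define VD where "VD = {((t, i), (t', j)). (t, i) \<in> cells S D \<and> (t', j) \<in> cells S D \<and>
      (EqV, [Cst (Tid t), Pos i, Cst (Tid t'), Pos j]) \<in> ?X}"
    have ED: "equiv (objs D) ED" and VD: "equiv (cells S D) VD"
      unfolding ED_def VD_def using closed_equiv[OF D rel base] by simp_all
    have reflO: "(EqO, [Cst c, Cst c]) \<in> ?X" if "c \<in> objs D" for c
      using ED that by (auto simp: equiv_def refl_on_def ED_def)
    have reflV: "(EqV, [Cst (Tid t), Pos i, Cst (Tid t), Pos i]) \<in> ?X" if "(t, i) \<in> cells S D" for t i
      using VD that by (auto simp: equiv_def refl_on_def VD_def)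
    \<comment> \<open>Candidates only grow, so the assumptions \<open>E1 \<subseteq> E\<close> and
      \<open>V1 \<subseteq> V\<close> pass down to every earlier stage.\<close>
    have "E1 \<subseteq> ED \<and> V1 \<subseteq> VD" if "candidate S \<Sigma> sim D E1 V1" "E1 \<subseteq> E" "V1 \<subseteq> V" for E1 V1
      using that
    proof (induction)
      case init
      show ?case using ED VD by (simp add: EqRel_least)
    next
      case (obj E1 V1 \<rho> a b)
      have ab: "(a, b) \<in> E" and sub: "E1 \<subseteq> E"
        using obj.prems(1) subset_EqRel[of "E1 \<union> {(a, b)}" "objs D"] by auto
      then have IH: "E1 \<subseteq> ED" "V1 \<subseteq> VD" using obj.IH obj.prems(2) by simp_all
      have I1: "induced_atoms S sim D E1 V1 \<subseteq> ?X"
        by (rule IX) (use IH in \<open>auto simp: ED_def VD_def\<close>)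
      note w = wf_obj_ruleD[OF wf_specD(1)[OF \<Sigma> obj.hyps(2)]]
      have E1: "E1 \<subseteq> objs D \<times> objs D" using sub E by blast
      obtain f where f: "body_lits f (\<lambda>x. x) (obody \<rho>) {Var (ox \<rho>), Var (oy \<rho>)} \<subseteq> induced_atoms S sim D E1 V1"
        "f (Wit (Var (ox \<rho>))) = Cst a" "f (Wit (Var (oy \<rho>))) = Cst b"
        using answers_body_lits[OF D E1 w obj.hyps(3)] by blast
      \<comment> \<open>Whether the rule is hard or soft is immaterial: the pair is merged in the
        solution, so its \<open>NeqO\<close> atom is false in the model.\<close>
      obtain soft where "obj_clause soft \<rho> \<in> er_program S \<Sigma>"
        using obj.hyps(2) unfolding er_program_def by blast
      note cl = closed[OF this, unfolded obj_clause_closed[OF w(1,3,4)], rule_format, of f]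
      have "(NeqO, [Cst a, Cst b]) \<notin> ?M" using ab by (simp add: NeqO_solution_model)
      then have "(EqO, [Cst a, Cst b]) \<in> ?X" using cl[OF subset_trans[OF f(1) I1]] f(2,3) by simp
      then have "(a, b) \<in> ED" using ab E by (auto simp: ED_def)
      then show ?case using IH by (simp add: EqRel_least[OF ED])
    next
      case (val E1 V1 \<rho> t t')
      let ?p = "((t, vi \<rho>), (t', vj \<rho>))"
      have ab: "?p \<in> V" and sub: "V1 \<subseteq> V"
        using val.prems(2) subset_EqRel[of "V1 \<union> {?p}" "cells S D"] by auto
      then have IH: "E1 \<subseteq> ED" "V1 \<subseteq> VD" using val.IH val.prems(1) by simp_all
      have I1: "induced_atoms S sim D E1 V1 \<subseteq> ?X"
        by (rule IX) (use IH in \<open>auto simp: ED_def VD_def\<close>)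
      note w = wf_val_ruleD[OF wf_specD(2)[OF \<Sigma> val.hyps(2)]]
      have E1: "E1 \<subseteq> objs D \<times> objs D" using val.prems(1) E by blast
      obtain f where f: "body_lits f (\<lambda>x. x) (vbody \<rho>) {Var (vx \<rho>), Var (vy \<rho>)} \<subseteq> induced_atoms S sim D E1 V1"
        "f (Wit (Var (vx \<rho>))) = Cst (Tid t)" "f (Wit (Var (vy \<rho>))) = Cst (Tid t')"
        using answers_body_lits[OF D E1 w val.hyps(3)] by blast
      obtain soft where "val_clause soft \<rho> \<in> er_program S \<Sigma>"
        using val.hyps(2) unfolding er_program_def by blast
      note cl = closed[OF this, unfolded val_clause_closed[OF w(1,3,4)], rule_format, of f]
      have "(NeqV, [Cst (Tid t), Pos (vi \<rho>), Cst (Tid t'), Pos (vj \<rho>)]) \<notin> ?M"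
        using ab by (simp add: NeqV_solution_model)
      then have "(EqV, [Cst (Tid t), Pos (vi \<rho>), Cst (Tid t'), Pos (vj \<rho>)]) \<in> ?X"
        using cl[OF subset_trans[OF f(1) I1]] f(2,3) by simp
      moreover have "(t, vi \<rho>) \<in> cells S D" "(t', vj \<rho>) \<in> cells S D"
        using val_answers[OF E1 wf_specD(2)[OF \<Sigma> val.hyps(2)] val.hyps(3)] by auto
      ultimately have "?p \<in> VD" by (simp add: VD_def)
      then show ?case using IH by (simp add: EqRel_least[OF VD])
    qed
    then have "E \<subseteq> ED" "V \<subseteq> VD" using cand by blast+
    then have I: "?I \<subseteq> ?X" by (intro IX) (auto simp: ED_def VD_def)
    have "a \<in> ?X" if a: "a \<in> Q" for a
    proof -
      from a consider (o) x y where "a = (NeqO, [Cst x, Cst y])" "x \<in> objs D" "y \<in> objs D" "(x, y) \<notin> E"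
        | (v) t i t' j where "a = (NeqV, [Cst (Tid t), Pos i, Cst (Tid t'), Pos j])"
            "(t, i) \<in> cells S D" "(t', j) \<in> cells S D" "((t, i), (t', j)) \<notin> V"
        | (m) k f where "a = (MeetP k, tid_args f (fst (ineq_list \<Sigma> ! k)))" "k < length (ineq_list \<Sigma>)"
            "meet_lits f (\<lambda>x. x) (fst (ineq_list \<Sigma> ! k)) (snd (ineq_list \<Sigma> ! k)) \<subseteq> ?I"
        unfolding Q_def meet_atoms_def by blast
      then show ?thesis
      proof cases
        case o
        then show ?thesis
          using neqO[rule_format, of "Cst x" "Cst y"] reflO by (simp add: EqO_solution_model)
      next
        case v
        then show ?thesis
          using neqV[rule_format, of "Cst (Tid t)" "Pos i" "Cst (Tid t')" "Pos j"] reflV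
          by (simp add: EqV_solution_model)
      next
        case m
        have "meet_clause \<Sigma> k \<in> er_program S \<Sigma>" using m(2) by (simp add: er_program_def)
        from closed[OF this] show ?thesis
          unfolding meet_clause_closed[OF wf_specD(3)[OF \<Sigma> wf_ineq_list(1)[OF \<Sigma> m(2)]]] m(1)
          using m(3) I by blast
      qed
    qed
    then show ?thesis using I unfolding MQ by blast
  qed
  ultimately show ?thesis by blast
qed

theorem theorem3:
  fixes S :: "'r schema"
    and \<Sigma> :: "(('o :: infinite, 'v :: infinite, 't :: infinite) cst, 'r, 's) er_spec"
  assumes "is_schema S" and "wf_spec S \<Sigma>"
  shows "\<exists>\<Pi> :: (('r, 's) pred, ('o, 'v, 't) pcst) rule set.
    normal_program S \<Pi> \<and>
    (\<forall>(sim :: 's \<Rightarrow> ('o, 'v, 't) cst rel) (D :: ('o, 'v, 't, 'r) fact set)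
      (E :: ('o, 'v, 't) cst rel) (V :: 't cell rel).
        database S D \<longrightarrow>
        ((E, V) \<in> Sol S \<Sigma> sim D \<longleftrightarrow>
         (\<exists>M. stable_model \<Pi> (input_facts sim D) M \<and>
              map_prod Cst Cst ` E = {(a, b). (EqO, [a, b]) \<in> M} \<and>
              map_prod pcell pcell ` V =
                {((t, i), (t', i')). (EqV, [t, i, t', i']) \<in> M})))"
proof (intro exI[of _ "er_program S \<Sigma>"] conjI allI impI iffI)
  show "normal_program S (er_program S \<Sigma>)" using assms by (rule normal_er_program)
  fix sim :: "'s \<Rightarrow> ('o, 'v, 't) cst rel" and D :: "('o, 'v, 't, 'r) fact set"
    and E :: "('o, 'v, 't) cst rel" and V :: "'t cell rel"
  assume D: "database S D"
  have stable: "stable_model (er_program S \<Sigma>) (input_facts sim D) M \<longleftrightarrow>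
      derivable (er_program S \<Sigma>) (input_facts sim D) M = M" for M
    using safe_er_program[OF assms(2)] by (subst stable_model_iff) auto
  {
    assume sol: "(E, V) \<in> Sol S \<Sigma> sim D"
    let ?M = "solution_model S \<Sigma> sim D E V"
    have "map_prod Cst Cst ` E = {(a, b). (EqO, [a, b]) \<in> ?M}"
      by (force simp: EqO_solution_model)
    moreover have "map_prod pcell pcell ` V = {((t, i), (t', i')). (EqV, [t, i, t', i']) \<in> ?M}"
      by (force simp: EqV_solution_model pcell_def)
    ultimately show "\<exists>M. stable_model (er_program S \<Sigma>) (input_facts sim D) M \<and>
        map_prod Cst Cst ` E = {(a, b). (EqO, [a, b]) \<in> M} \<and>
        map_prod pcell pcell ` V = {((t, i), (t', i')). (EqV, [t, i, t', i']) \<in> M}"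
      using stable stable_if_solution[OF assms(2) D sol] by blast
  next
    assume "\<exists>M. stable_model (er_program S \<Sigma>) (input_facts sim D) M \<and>
        map_prod Cst Cst ` E = {(a, b). (EqO, [a, b]) \<in> M} \<and>
        map_prod pcell pcell ` V = {((t, i), (t', i')). (EqV, [t, i, t', i']) \<in> M}"
    then obtain M where M: "derivable (er_program S \<Sigma>) (input_facts sim D) M = M"
      and EM: "map_prod Cst Cst ` E = {(a, b). (EqO, [a, b]) \<in> M}"
      and VM: "map_prod pcell pcell ` V = {((t, i), (t', i')). (EqV, [t, i, t', i']) \<in> M}"
      unfolding stable by blast
    show "(E, V) \<in> Sol S \<Sigma> sim D"
    \<comment> \<open>The image equations also fix the shape of the atoms of \<open>M\<close>: the
      arguments of \<open>EqO\<close> are database constants, and those of \<open>EqV\<close>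
      alternate between tids and positions.\<close>
    proof (rule solution_if_stable[OF assms(2) D M])
      fix a b
      have "(EqO, [a, b]) \<in> M \<longleftrightarrow> (a, b) \<in> map_prod Cst Cst ` E" unfolding EM by simp
      then show "(EqO, [a, b]) \<in> M \<longleftrightarrow> (\<exists>c d. a = Cst c \<and> b = Cst d \<and> (c, d) \<in> E)" by auto
    next
      fix a b c d
      have "(EqV, [a, b, c, d]) \<in> M \<longleftrightarrow> ((a, b), (c, d)) \<in> map_prod pcell pcell ` V"
        unfolding VM by simp
      then show "(EqV, [a, b, c, d]) \<in> M \<longleftrightarrow>
        (\<exists>t i t' j. a = Cst (Tid t) \<and> b = Pos i \<and> c = Cst (Tid t') \<and> d = Pos j \<and> ((t, i), (t', j)) \<in> V)"
        by (force simp: pcell_def)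
    qed
  }
qed

end
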